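(* Let $X$ be a nonempty finite set of points in $\mathbb{P}^1\times\mathbb{P}^1$. Then for all integers $a\ge|\pi_1(X)|-1$, the minimal free resolution of $S/(I_X\cap\langle x_0,x_1\rangle^a)$ is a virtual resolution of $S/I_X$ of length two.
   Context: $\Bbbk$ is a field of characteristic $0$ and $S=\Bbbk[x_0,x_1,y_0,y_1]$ is the $\mathbb{Z}^2$-graded coordinate ring of $\mathbb{P}^1\times\mathbb{P}^1$, with $\deg x_i=(1,0)$, $\deg y_i=(0,1)$. $B=\langle x_0,x_1\rangle\cap\langle y_0,y_1\rangle$ is the irrelevant ideal. For an $S$-module $M$, $\Gamma_B(M)=\{m\in M: B^tm=0\text{ for some }t\in\mathbb{N}\}$. Virtual resolution: a complex $\mathcal{F}_\bullet=\cdots\to F_2\to F_1\to F_0$ of finitely generated free $S$-modules is a virtual resolution of a finitely generated $S$-module $M$ if (1) for each $i>0$ there is $t$ with $B^tH_i(\mathcal{F}_\bullet)=0$, and (2) $H_0(\mathcal{F}_\bullet)/\Gamma_B(H_0(\mathcal{F}_\bullet))\cong M/\Gamma_B(M)$. Its length is the largest $i$ with $F_i\ne0$. Points: for $P=[a_0:a_1]\times[b_0:b_1]$, $I_P=\langle a_1x_0-a_0x_1,\ b_1y_0-b_0y_1\rangle$; for a finite set $X=\{P_1,\dots,P_s\}$ of distinct points, $I_X=I_{P_1}\cap\cdots\cap I_{P_s}$. $\pi_1:\mathbb{P}^1\times\mathbb{P}^1\to\mathbb{P}^1$ is the projection to the first coordinate, so $\pi_1(X)$ is the set of distinct first coordinates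 of points of $X$. By convention $\langle x_0,x_1\rangle^0=S$. *)

theory Defs
  imports
    "Jordan_Normal_Form.Matrix_Kernel"
    "HOL-Algebra.Ideal_Product"
    "HOL-Library.Poly_Mapping"
    "HOL-Library.Product_Plus"
begin

section \<open>Modules over a commutative ring\<close>

definition ring_module :: "('r, 'c) ring_scheme \<Rightarrow> ('r, 'r) module" where
  "ring_module R = \<lparr>carrier = carrier R, mult = mult R, one = one R, zero = zero R,
     add = add R, smult = mult R\<rparr>"

text \<open>The elements of the quotient are the additive cosets of \<open>N\<close>. The fields \<open>mult\<close> and \<open>one\<close>
  of a module record play no role, as in \<^const>\<open>module_vec\<close>.\<close>

definition quot_module :: "('r, 'm, 'c) module_scheme \<Rightarrow> 'm set \<Rightarrow> ('r, 'm set) module" where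
  "quot_module M N = \<lparr>carrier = a_rcosets\<^bsub>M\<^esub> N, mult = undefined, one = undefined, zero = N,
     add = set_add M, smult = (\<lambda>r C. \<Union>c\<in>C. N +>\<^bsub>M\<^esub> (r \<odot>\<^bsub>M\<^esub> c))\<rparr>"

definition module_isomorphic ::
  "('r, 'd) ring_scheme \<Rightarrow> ('r, 'm, 'e) module_scheme \<Rightarrow> ('r, 'n, 'f) module_scheme \<Rightarrow> bool" where
  "module_isomorphic R M N \<longleftrightarrow> (\<exists>f \<in> LinearCombinations.module_hom R M N. bij_betw f (carrier M) (carrier N))"

definition fin_gen_module :: "('r, 'd) ring_scheme \<Rightarrow> ('r, 'm, 'e) module_scheme \<Rightarrow> bool" where
  "fin_gen_module R M \<longleftrightarrow>
     Module.module R M \<and> (\<exists>A. finite A \<and> A \<subseteq> carrier M \<and> LinearCombinations.module.span R M A = carrier M)"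

text \<open>The power is taken in the monoid of ideals, whose unit is \<^term>\<open>carrier R\<close>;
  so \<open>I\<^sup>0 = R\<close>.\<close>

definition ideal_pow :: "('r, 'd) ring_scheme \<Rightarrow> 'r set \<Rightarrow> nat \<Rightarrow> 'r set" where
  "ideal_pow R I t = I [^]\<^bsub>ideals_set R\<^esub> t"

definition ideal_times_module ::
  "('r, 'd) ring_scheme \<Rightarrow> 'r set \<Rightarrow> ('r, 'm, 'e) module_scheme \<Rightarrow> 'm set" where
  "ideal_times_module R I M = LinearCombinations.module.span R M {a \<odot>\<^bsub>M\<^esub> v | a v. a \<in> I \<and> v \<in> carrier M}"

text \<open>The submodule \<open>\<Gamma>\<^sub>I(M)\<close>.\<close>

definition torsion ::
  "('r, 'd) ring_scheme \<Rightarrow> 'r set \<Rightarrow> ('r, 'm, 'e) module_scheme \<Rightarrow> 'm set" where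
  "torsion R I M = {m \<in> carrier M. \<exists>t. \<forall>b \<in> ideal_pow R I t. b \<odot>\<^bsub>M\<^esub> m = \<zero>\<^bsub>M\<^esub>}"


section \<open>Complexes of finitely generated free modules\<close>

text \<open>A complex \<open>\<cdots> \<rightarrow> F\<^sub>2 \<rightarrow> F\<^sub>1 \<rightarrow> F\<^sub>0\<close> of finitely generated free modules over the ring \<open>'a\<close>, in
  chosen bases: \<open>F\<^sub>i\<close> is the module of column vectors of length \<open>rk F i\<close>, and \<open>diff F i\<close> is
  the matrix of \<open>F\<^sub>i \<rightarrow> F\<^bsub>i-1\<^esub>\<close>. The value \<open>diff F 0\<close> is never used.\<close>

record 'a free_complex =
  rk :: "nat \<Rightarrow> nat"
  diff :: "nat \<Rightarrow> 'a mat"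

definition is_complex :: "'a::comm_ring_1 free_complex \<Rightarrow> bool" where
  "is_complex F \<longleftrightarrow>
     (\<forall>i. diff F (Suc i) \<in> carrier_mat (rk F i) (rk F (Suc i))) \<and>
     (\<forall>i. diff F (Suc i) * diff F (Suc (Suc i)) = 0\<^sub>m (rk F i) (rk F (Suc (Suc i))))"

definition free_mod :: "'a::comm_ring_1 free_complex \<Rightarrow> nat \<Rightarrow> ('a, 'a vec) module" where
  "free_mod F i = module_vec TYPE('a) (rk F i)"

definition cycles :: "'a::comm_ring_1 free_complex \<Rightarrow> nat \<Rightarrow> 'a vec set" where
  "cycles F i = (if i = 0 then carrier (free_mod F 0) else mat_kernel (diff F i))"

definition boundaries :: "'a::comm_ring_1 free_complex \<Rightarrow> nat \<Rightarrow> 'a vec set" where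
  "boundaries F i = (\<lambda>v. diff F (Suc i) *\<^sub>v v) ` carrier (free_mod F (Suc i))"

definition homology :: "'a::comm_ring_1 free_complex \<Rightarrow> nat \<Rightarrow> ('a, 'a vec set) module" where
  "homology F i = quot_module ((free_mod F i)\<lparr>carrier := cycles F i\<rparr>) (boundaries F i)"

definition has_length :: "'a::comm_ring_1 free_complex \<Rightarrow> nat \<Rightarrow> bool" where
  "has_length F l \<longleftrightarrow>
     carrier (free_mod F l) \<noteq> {\<zero>\<^bsub>free_mod F l\<^esub>} \<and>
     (\<forall>i > l. carrier (free_mod F i) = {\<zero>\<^bsub>free_mod F i\<^esub>})"


section \<open>The coordinate ring of the product of two projective lines\<close>

datatype var = X0 | X1 | Y0 | Y1

text \<open>Exponent vectors are finitely supported functions from variables to \<open>nat\<close>; a polynomial is a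
  finitely supported function from exponent vectors to the field, and \<open>*\<close> is convolution.\<close>

type_synonym 'k bipoly = "(var \<Rightarrow>\<^sub>0 nat) \<Rightarrow>\<^sub>0 'k"

definition coord :: "var \<Rightarrow> 'k::field bipoly" where
  "coord v = Poly_Mapping.single (Poly_Mapping.single v 1) 1"

definition const :: "'k::field \<Rightarrow> 'k bipoly" where
  "const c = Poly_Mapping.single 0 c"

abbreviation S_ring :: "'k::field bipoly ring" where
  "S_ring \<equiv> class_ring"

definition bidegree :: "(var \<Rightarrow>\<^sub>0 nat) \<Rightarrow> int \<times> int" where
  "bidegree m = (int (Poly_Mapping.lookup m X0 + Poly_Mapping.lookup m X1), int (Poly_Mapping.lookup m Y0 + Poly_Mapping.lookup m Y1))"

text \<open>The graded piece \<open>S\<^sub>d\<close>, for \<open>d \<in> \<int>\<^sup>2\<close>.\<close>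

definition S_piece :: "int \<times> int \<Rightarrow> 'k::field bipoly set" where
  "S_piece d = {p. \<forall>m \<in> Poly_Mapping.keys p. bidegree m = d}"

definition x_ideal :: "'k::field bipoly set" where
  "x_ideal = Idl\<^bsub>S_ring\<^esub> {coord X0, coord X1}"

definition y_ideal :: "'k::field bipoly set" where
  "y_ideal = Idl\<^bsub>S_ring\<^esub> {coord Y0, coord Y1}"

definition irrelevant_ideal :: "'k::field bipoly set" where
  "irrelevant_ideal = x_ideal \<inter> y_ideal"

definition max_ideal :: "'k::field bipoly set" where
  "max_ideal = Idl\<^bsub>S_ring\<^esub> {coord X0, coord X1, coord Y0, coord Y1}"

definition S_mod_ideal :: "'k::field bipoly set \<Rightarrow> ('k bipoly, 'k bipoly set) module" where
  "S_mod_ideal J = quot_module (ring_module S_ring) J"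

text \<open>The \<open>\<int>\<^sup>2\<close>-grading that \<open>S/J\<close> inherits from \<open>S\<close> (for bihomogeneous \<open>J\<close>).\<close>

definition S_mod_ideal_piece :: "'k::field bipoly set \<Rightarrow> int \<times> int \<Rightarrow> 'k bipoly set set" where
  "S_mod_ideal_piece J d = (\<lambda>p. J +>\<^bsub>S_ring\<^esub> p) ` S_piece d"


section \<open>Minimal free resolutions and virtual resolutions\<close>

text \<open>The degree \<open>d\<close> piece of the free module \<open>\<Oplus>\<^sub>j S(-s j)\<close>, whose \<open>j\<close>-th basis vector has degree
  \<open>s j\<close>.\<close>

definition free_piece :: "nat \<Rightarrow> (nat \<Rightarrow> int \<times> int) \<Rightarrow> int \<times> int \<Rightarrow> 'k::field bipoly vec set" where
  "free_piece n s d = {v \<in> carrier_vec n. \<forall>j < n. v $ j \<in> S_piece (d - s j)}"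

text \<open>\<open>M\<close> is a graded module with pieces \<open>G d\<close>. In the graded structure \<open>s i j\<close> is the degree of the
  \<open>j\<close>-th basis vector of \<open>F\<^sub>i\<close>, and \<open>\<epsilon>\<close> is the augmentation \<open>F\<^sub>0 \<rightarrow> M\<close>; all maps have degree \<open>0\<close>.
  The last clause is minimality.\<close>

definition minimal_free_resolution ::
  "'k::field bipoly free_complex \<Rightarrow> ('k bipoly, 'm) module \<Rightarrow> (int \<times> int \<Rightarrow> 'm set) \<Rightarrow> bool" where
  "minimal_free_resolution F M G \<longleftrightarrow>
     is_complex F \<and>
     (\<forall>i > 0. cycles F i = boundaries F i) \<and>
     (\<exists>\<epsilon> \<in> LinearCombinations.module_hom S_ring (free_mod F 0) M. \<exists>s.
        \<epsilon> ` carrier (free_mod F 0) = carrier M \<and>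
        {v \<in> carrier (free_mod F 0). \<epsilon> v = \<zero>\<^bsub>M\<^esub>} = boundaries F 0 \<and>
        (\<forall>d. \<epsilon> ` free_piece (rk F 0) (s 0) d \<subseteq> G d) \<and>
        (\<forall>i d. (\<lambda>v. diff F (Suc i) *\<^sub>v v) ` free_piece (rk F (Suc i)) (s (Suc i)) d
                 \<subseteq> free_piece (rk F i) (s i) d)) \<and>
     (\<forall>i. boundaries F i \<subseteq> ideal_times_module S_ring max_ideal (free_mod F i))"

definition virtual_resolution ::
  "'k::field bipoly free_complex \<Rightarrow> ('k bipoly, 'm) module \<Rightarrow> bool" where
  "virtual_resolution F M \<longleftrightarrow>
     fin_gen_module S_ring M \<and>
     is_complex F \<and>
     (\<forall>i > 0. \<exists>t. \<forall>b \<in> ideal_pow S_ring irrelevant_ideal t. \<forall>h \<in> carrier (homology F i).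
        b \<odot>\<^bsub>homology F i\<^esub> h = \<zero>\<^bsub>homology F i\<^esub>) \<and>
     module_isomorphic S_ring
       (quot_module (homology F 0) (torsion S_ring irrelevant_ideal (homology F 0)))
       (quot_module M (torsion S_ring irrelevant_ideal M))"


section \<open>Points\<close>

definition proj_rel :: "(('k::field \<times> 'k) \<times> ('k \<times> 'k)) set" where
  "proj_rel = {(u, v). u \<noteq> (0, 0) \<and> v \<noteq> (0, 0) \<and>
     (\<exists>c. c \<noteq> 0 \<and> fst v = c * fst u \<and> snd v = c * snd u)}"

text \<open>A point of the projective line is the set of all its homogeneous coordinate vectors.\<close>

definition P1 :: "('k::field \<times> 'k) set set" where
  "P1 = (UNIV - {(0, 0)}) // proj_rel"

definition x_form :: "'k::field \<times> 'k \<Rightarrow> 'k bipoly" where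
  "x_form u = const (snd u) * coord X0 - const (fst u) * coord X1"

definition y_form :: "'k::field \<times> 'k \<Rightarrow> 'k bipoly" where
  "y_form v = const (snd v) * coord Y0 - const (fst v) * coord Y1"

text \<open>Using all coordinate vectors of a point as generators avoids choosing one; the lemma
  \<open>point_ideal_eq\<close> below shows that one coordinate vector in each factor suffices.\<close>

definition point_ideal :: "('k::field \<times> 'k) set \<times> ('k \<times> 'k) set \<Rightarrow> 'k bipoly set" where
  "point_ideal P = Idl\<^bsub>S_ring\<^esub> (x_form ` fst P \<union> y_form ` snd P)"

definition points_ideal :: "(('k::field \<times> 'k) set \<times> ('k \<times> 'k) set) set \<Rightarrow> 'k bipoly set" where
  "points_ideal X = (\<Inter>P \<in> X. point_ideal P)"

lemma equiv_proj_rel: "equiv (UNIV - {(0, 0)}) (proj_rel :: (('k::field \<times> 'k) \<times> _) set)"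
proof (rule equivI)
  show "proj_rel \<subseteq> (UNIV - {(0, 0)}) \<times> (UNIV - {(0, 0) :: 'k \<times> 'k})"
    by (auto simp: proj_rel_def)
  show "refl_on (UNIV - {(0, 0)}) (proj_rel :: (('k \<times> 'k) \<times> _) set)"
    by (auto simp: refl_on_def proj_rel_def intro: exI[of _ 1])
  show "sym (proj_rel :: (('k \<times> 'k) \<times> _) set)"
  proof (rule symI)
    fix u v :: "'k \<times> 'k" assume "(u, v) \<in> proj_rel"
    then obtain c where "u \<noteq> (0, 0)" "v \<noteq> (0, 0)" "c \<noteq> 0" "fst v = c * fst u" "snd v = c * snd u"
      by (auto simp: proj_rel_def)
    then show "(v, u) \<in> proj_rel"
      by (auto simp: proj_rel_def intro!: exI[of _ "inverse c"])
  qed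
  show "trans (proj_rel :: (('k \<times> 'k) \<times> _) set)"
  proof (rule transI)
    fix u v w :: "'k \<times> 'k" assume uv: "(u, v) \<in> proj_rel" and vw: "(v, w) \<in> proj_rel"
    from uv obtain c where c: "u \<noteq> (0, 0)" "c \<noteq> 0" "fst v = c * fst u" "snd v = c * snd u"
      by (auto simp: proj_rel_def)
    from vw obtain d where d: "w \<noteq> (0, 0)" "d \<noteq> 0" "fst w = d * fst v" "snd w = d * snd v"
      by (auto simp: proj_rel_def)
    have "d * c \<noteq> 0" "fst w = (d * c) * fst u" "snd w = (d * c) * snd u"
      using c d by simp_all
    then show "(u, w) \<in> proj_rel"
      unfolding proj_rel_def using c(1) d(1) by blast
  qed
qed

lemma point_ideal_eq:
  fixes u v :: "'k::field \<times> 'k"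
  assumes "u \<noteq> (0, 0)" and "v \<noteq> (0, 0)"
  shows "point_ideal (proj_rel `` {u}, proj_rel `` {v}) = Idl\<^bsub>S_ring\<^esub> {x_form u, y_form v}"
proof -
  let ?S = "S_ring :: 'k bipoly ring"
  let ?G = "x_form ` (proj_rel `` {u}) \<union> y_form ` (proj_rel `` {v})"
  have R: "ring ?S" by (rule class_ring.ring_axioms)
  have const_mult: "const (c * d) = const c * const d" for c d :: 'k
    by (simp add: const_def mult_single)
  have "u \<in> proj_rel `` {u}" "v \<in> proj_rel `` {v}"
    using assms by (auto simp: proj_rel_def intro: exI[of _ 1])
  then have "{x_form u, y_form v} \<subseteq> Idl\<^bsub>?S\<^esub> ?G"
    using ring.genideal_self[OF R, of ?G] by auto
  then have le: "Idl\<^bsub>?S\<^esub> {x_form u, y_form v} \<subseteq> Idl\<^bsub>?S\<^esub> ?G"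
    by (intro ring.genideal_minimal[OF R] ring.genideal_ideal[OF R]) auto
  have I: "ideal (Idl\<^bsub>?S\<^esub> {x_form u, y_form v}) ?S"
    by (intro ring.genideal_ideal[OF R]) auto
  have gens: "x_form u \<in> Idl\<^bsub>?S\<^esub> {x_form u, y_form v}" "y_form v \<in> Idl\<^bsub>?S\<^esub> {x_form u, y_form v}"
    using ring.genideal_self[OF R, of "{x_form u, y_form v}"] by auto
  have "x_form w \<in> Idl\<^bsub>?S\<^esub> {x_form u, y_form v}" if "w \<in> proj_rel `` {u}" for w
  proof -
    from that obtain c where "fst w = c * fst u" "snd w = c * snd u" by (auto simp: proj_rel_def)
    then have "x_form w = const c * x_form u"
      by (simp add: x_form_def const_mult algebra_simps)
    then show ?thesis using ideal.I_l_closed[OF I gens(1), of "const c"] by simp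
  qed
  moreover have "y_form w \<in> Idl\<^bsub>?S\<^esub> {x_form u, y_form v}" if "w \<in> proj_rel `` {v}" for w
  proof -
    from that obtain c where "fst w = c * fst v" "snd w = c * snd v" by (auto simp: proj_rel_def)
    then have "y_form w = const c * y_form v"
      by (simp add: y_form_def const_mult algebra_simps)
    then show ?thesis using ideal.I_l_closed[OF I gens(2), of "const c"] by simp
  qed
  ultimately have "?G \<subseteq> Idl\<^bsub>?S\<^esub> {x_form u, y_form v}" by blast
  then have "Idl\<^bsub>?S\<^esub> ?G \<subseteq> Idl\<^bsub>?S\<^esub> {x_form u, y_form v}"
    by (rule ring.genideal_minimal[OF R I])
  with le show ?thesis by (simp add: point_ideal_def)
qed

end

theory Submission
  imports Defs
begin

text \<open>
  Let \<open>l\<^sub>i\<close> be the linear form of a point \<open>u\<^sub>i\<close> of \<open>\<pi>\<^sub>1(X)\<close> and \<open>g\<^sub>i\<close> the form in \<open>y\<^sub>0, y\<^sub>1\<close> that cuts out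
  the fibre of \<open>X\<close> over \<open>u\<^sub>i\<close>, so that \<open>I\<^sub>X\<close> is the intersection of the ideals \<open>\<langle>l\<^sub>i, g\<^sub>i\<rangle>\<close>. Adding points
  with empty fibre (and \<open>g\<^sub>i = 1\<close>) we may assume that there are \<open>a + 1\<close> of them; this is where
  \<open>a \<ge> |\<pi>\<^sub>1(X)| - 1\<close> enters. Then the products \<open>e\<^sub>i\<close> of all \<open>l\<^sub>j\<close> with \<open>j \<noteq> i\<close> generate \<open>\<langle>x\<^sub>0, x\<^sub>1\<rangle>\<^sup>a\<close>,
  and \<open>I\<^sub>X \<inter> \<langle>x\<^sub>0, x\<^sub>1\<rangle>\<^sup>a\<close> is generated by the \<open>g\<^sub>i e\<^sub>i\<close> and the product \<open>l\<^sub>0 \<cdots> l\<^sub>a\<close>. If a point was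
  added, the last generator is redundant. In both cases the relations are of the form
  \<open>l\<^sub>i \<cdot> h\<^sub>i = b\<^sub>i \<cdot> H\<close>, which gives a minimal resolution of Hilbert--Burch type, and every other
  minimal resolution has the same length by comparison. It is virtual because \<open>B\<^sup>a I\<^sub>X\<close> is
  contained in \<open>I\<^sub>X \<inter> \<langle>x\<^sub>0, x\<^sub>1\<rangle>\<^sup>a\<close>, so both quotients have the same torsion-free part.
\<close>


section \<open>Ideals of a commutative ring type\<close>

text \<open>The claim concerns every minimal resolution \<open>F\<close>, given by matrices, and its
  two halves use different information. Virtuality uses that \<open>F\<close> resolves
  \<open>S/J\<close>, whatever its ranks are. Length two is read off from one explicit resolution: a
  rank that vanishes in one minimal resolution vanishes in every other, and this is applied in both
  directions.

  Minimality is also the reason why the explicit resolution comes in two versions. Over an added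
  point \<open>g_i = 1\<close>, and the relation \<open>l_i * h_i = g_i * H\<close> would have a
  unit coefficient. Dropping \<open>H\<close> moves the form of one added point into all remaining
  coefficients, which makes them nonunits. Added points exist because a field of characteristic 0 is
  infinite.

  Ideals of points are handled by substitutions. Restriction to a fibre or to a point is made an
  endomorphism of the domain \<open>S\<close> whose kernel is the ideal in question, so a factor
  that does not vanish there can be cancelled.\<close>

lemma ideal_class_ring_iff:
  fixes I :: "'a::comm_ring_1 set"
  shows "ideal I class_ring \<longleftrightarrow>
    0 \<in> I \<and> (\<forall>a\<in>I. \<forall>b\<in>I. a + b \<in> I) \<and> (\<forall>r. \<forall>a\<in>I. r * a \<in> I)"
proof
  assume "ideal I class_ring"
  then interpret ideal I "class_ring :: 'a ring" .
  show "0 \<in> I \<and> (\<forall>a\<in>I. \<forall>b\<in>I. a + b \<in> I) \<and> (\<forall>r. \<forall>a\<in>I. r * a \<in> I)"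
    using zero_closed a_closed I_l_closed by auto
next
  assume I: "0 \<in> I \<and> (\<forall>a\<in>I. \<forall>b\<in>I. a + b \<in> I) \<and> (\<forall>r. \<forall>a\<in>I. r * a \<in> I)"
  show "ideal I class_ring"
  proof (rule idealI)
    show "ring (class_ring :: 'a ring)" by (rule class_ring.ring_axioms)
    \<comment> \<open>\<open>- x\<close> is the multiple of \<open>x\<close> by \<open>- 1\<close>;
      this supplies the inverses of the additive subgroup.\<close>
    have "- x \<in> I" if "x \<in> I" for x
      using I that by (metis mult_minus1)
    moreover have "a_inv (class_ring :: 'a ring) = uminus"
      by (simp add: class_ring_simps)
    ultimately show "subgroup I (add_monoid (class_ring :: 'a ring))"
      using I by (auto simp: subgroup_def a_inv_def)
  next
    fix a x assume "a \<in> I" "x \<in> carrier (class_ring :: 'a ring)"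
    then show "x \<otimes>\<^bsub>class_ring\<^esub> a \<in> I" "a \<otimes>\<^bsub>class_ring\<^esub> x \<in> I"
      using I by (simp_all add: mult.commute[of a])
  qed
qed

lemma ideal_class_ringD:
  fixes I :: "'a::comm_ring_1 set"
  assumes "ideal I class_ring"
  shows "0 \<in> I" "a \<in> I \<Longrightarrow> b \<in> I \<Longrightarrow> a + b \<in> I" "a \<in> I \<Longrightarrow> r * a \<in> I"
    "a \<in> I \<Longrightarrow> - a \<in> I" "a \<in> I \<Longrightarrow> b \<in> I \<Longrightarrow> a - b \<in> I"
    "(\<And>i. i \<in> A \<Longrightarrow> f i \<in> I) \<Longrightarrow> sum f A \<in> I"
proof -
  note I = assms[unfolded ideal_class_ring_iff]
  show "0 \<in> I" and add: "a \<in> I \<Longrightarrow> b \<in> I \<Longrightarrow> a + b \<in> I" and "a \<in> I \<Longrightarrow> r * a \<in> I" for a b r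
    using I by auto
  show neg: "a \<in> I \<Longrightarrow> - a \<in> I" for a
    using I by (metis mult_minus1)
  show "a \<in> I \<Longrightarrow> b \<in> I \<Longrightarrow> a - b \<in> I"
    using add[of a "- b"] neg[of b] by simp
  show "(\<And>i. i \<in> A \<Longrightarrow> f i \<in> I) \<Longrightarrow> sum f A \<in> I"
    using I by (induction A rule: infinite_finite_induct) auto
qed

lemma genideal_class_ring:
  fixes A :: "'a::comm_ring_1 set"
  shows "ideal (Idl\<^bsub>class_ring\<^esub> A) class_ring" "A \<subseteq> Idl\<^bsub>class_ring\<^esub> A"
    "ideal I class_ring \<Longrightarrow> A \<subseteq> I \<Longrightarrow> Idl\<^bsub>class_ring\<^esub> A \<subseteq> I"
  by (simp_all add: ring.genideal_ideal ring.genideal_self ring.genideal_minimal class_ring.ring_axioms)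

text \<open>Coefficients are attached to the indices and not to the values \<open>f i\<close>, so
  repeated generators are harmless and the products of linear forms below keep their
  numbering.\<close>

lemma genideal_image_finite:
  fixes f :: "'i \<Rightarrow> 'a::comm_ring_1"
  assumes "finite A"
  shows "Idl\<^bsub>class_ring\<^esub> (f ` A) = range (\<lambda>c. \<Sum>i\<in>A. c i * f i)" (is "?L = ?R")
proof
  have "0 \<in> ?R"
    by (rule range_eqI[of _ _ "\<lambda>_. 0"]) simp
  moreover have "x + y \<in> ?R" if x: "x \<in> ?R" and y: "y \<in> ?R" for x y
  proof -
    from x y obtain c d where "x = (\<Sum>i\<in>A. c i * f i)" "y = (\<Sum>i\<in>A. d i * f i)" by blast
    then have "x + y = (\<Sum>i\<in>A. (c i + d i) * f i)" by (simp add: sum.distrib algebra_simps)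
    then show ?thesis by (rule range_eqI[where x = "\<lambda>i. c i + d i"])
  qed
  moreover have "r * x \<in> ?R" if x: "x \<in> ?R" for r x
  proof -
    from x obtain c where "x = (\<Sum>i\<in>A. c i * f i)" by blast
    then have "r * x = (\<Sum>i\<in>A. (r * c i) * f i)" by (simp add: sum_distrib_left algebra_simps)
    then show ?thesis by (rule range_eqI[where x = "\<lambda>i. r * c i"])
  qed
  ultimately have "ideal ?R class_ring"
    unfolding ideal_class_ring_iff by blast
  moreover have "f i \<in> ?R" if "i \<in> A" for i
  proof (rule range_eqI[of _ _ "\<lambda>j. if j = i then 1 else 0"])
    show "f i = (\<Sum>j\<in>A. (if j = i then 1 else 0) * f j)"
      using assms that by (simp add: if_distrib[of "\<lambda>c. c * _"] sum.delta cong: if_cong)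
  qed
  ultimately show "?L \<subseteq> ?R"
    by (intro genideal_class_ring(3)) auto
  show "?R \<subseteq> ?L"
  proof
    fix p assume "p \<in> ?R"
    then obtain c where p: "p = (\<Sum>i\<in>A. c i * f i)" by blast
    have "f i \<in> ?L" if "i \<in> A" for i
      using genideal_class_ring(2) that by blast
    then show "p \<in> ?L"
      unfolding p by (intro ideal_class_ringD(3,6)[OF genideal_class_ring(1)])
  qed
qed

lemma genideal_pair:
  fixes x y :: "'a::comm_ring_1"
  shows "Idl\<^bsub>class_ring\<^esub> {x, y} = {s * x + t * y | s t. True}"
proof -
  \<comment> \<open>A pair is a family indexed by the booleans; this also covers
    \<open>x = y\<close>.\<close>
  have "Idl\<^bsub>class_ring\<^esub> ((\<lambda>b. if b then x else y) ` UNIV) = {s * x + t * y | s t. True}"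
    unfolding genideal_image_finite[OF finite]
  proof (intro equalityI subsetI)
    fix p assume "p \<in> {s * x + t * y | s t. True}"
    then obtain s t where "p = s * x + t * y" by blast
    then show "p \<in> range (\<lambda>c. \<Sum>b\<in>UNIV. c b * (if b then x else y))"
      by (intro range_eqI[of _ _ "\<lambda>b. if b then s else t"]) (simp add: UNIV_bool)
  next
    fix p assume "p \<in> range (\<lambda>c. \<Sum>b\<in>UNIV. c b * (if b then x else y))"
    then obtain c where "p = c True * x + c False * y" by (auto simp: UNIV_bool add.commute)
    then show "p \<in> {s * x + t * y | s t. True}" by blast
  qed
  moreover have "(\<lambda>b. if b then x else y) ` UNIV = {x, y}" by (auto simp: UNIV_bool)
  ultimately show ?thesis by simp
qed

lemma genideal_pairI:
  fixes x y :: "'a::comm_ring_1"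
  shows "s * x + t * y \<in> Idl\<^bsub>class_ring\<^esub> {x, y}"
  by (auto simp: genideal_pair)

lemma genideal_pairE:
  fixes x y :: "'a::comm_ring_1"
  assumes "p \<in> Idl\<^bsub>class_ring\<^esub> {x, y}"
  obtains s t where "p = s * x + t * y"
  using assms unfolding genideal_pair by blast

section \<open>Powers of an ideal\<close>

lemma ideal_pow_0 [simp]: "ideal_pow R I 0 = carrier R"
  by (simp add: ideal_pow_def nat_pow_def ideals_set_def)

lemma ideal_pow_Suc: "ideal_pow R I (Suc t) = ideal_prod R (ideal_pow R I t) I"
  by (simp add: ideal_pow_def nat_pow_def ideals_set_def)

lemma ideal_ideal_pow:
  fixes I :: "'a::comm_ring_1 set"
  assumes "ideal I class_ring"
  shows "ideal (ideal_pow class_ring I t) class_ring"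
proof (induction t)
  case 0
  then show ?case by (simp add: ideal_class_ring_iff)
next
  case (Suc t)
  then show ?case
    unfolding ideal_pow_Suc by (intro ring.ideal_prod_is_ideal assms class_ring.ring_axioms)
qed

text \<open>Lets conditions that hold for two different exponents be used together with their sum as
  common exponent.\<close>

lemma ideal_pow_add_subset:
  fixes I :: "'a::comm_ring_1 set"
  assumes "ideal I class_ring"
  shows "ideal_pow class_ring I (s + t) \<subseteq> ideal_pow class_ring I s"
proof (induction t)
  case (Suc t)
  have "ideal_pow class_ring I (s + Suc t) \<subseteq> ideal_pow class_ring I (s + t)"
    using ring.ideal_prod_inter[OF class_ring.ring_axioms ideal_ideal_pow[OF assms, of "s + t"] assms]
    by (simp add: ideal_pow_Suc)
  with Suc show ?case by blast
qed simp

lemma ideal_pow_mono: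
  assumes "I \<subseteq> J"
  shows "ideal_pow R I t \<subseteq> ideal_pow R J t"
proof (induction t)
  case (Suc t)
  show ?case unfolding ideal_pow_Suc
  proof
    fix x assume "x \<in> ideal_prod R (ideal_pow R I t) I"
    then show "x \<in> ideal_prod R (ideal_pow R J t) J"
      by induction (use Suc assms in \<open>blast intro: ideal_prod.intros\<close>)+
  qed
qed simp

lemma prod_in_ideal_pow:
  fixes f :: "'i \<Rightarrow> 'a::comm_ring_1"
  assumes "finite A" and "\<And>i. i \<in> A \<Longrightarrow> f i \<in> I"
  shows "prod f A \<in> ideal_pow class_ring I (card A)"
  using assms
proof (induction A)
  case (insert i A)
  then have "prod f A \<otimes>\<^bsub>class_ring\<^esub> f i \<in> ideal_prod class_ring (ideal_pow class_ring I (card A)) I"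
    by (intro ideal_prod.prod) auto
  with insert show ?case by (simp add: ideal_pow_Suc mult.commute)
qed simp


section \<open>Substitution homomorphisms of the coordinate ring\<close>

text \<open>A linear order on the variables orders the exponent vectors, and through that order the
  polynomials form an integral domain. Any linear order would serve.\<close>

instantiation var :: linorder
begin

definition var_rank :: "var \<Rightarrow> nat" where
  "var_rank v = (case v of X0 \<Rightarrow> 0 | X1 \<Rightarrow> 1 | Y0 \<Rightarrow> 2 | Y1 \<Rightarrow> 3)"

definition less_eq_var :: "var \<Rightarrow> var \<Rightarrow> bool" where
  "less_eq_var v w \<longleftrightarrow> var_rank v \<le> var_rank w"

definition less_var :: "var \<Rightarrow> var \<Rightarrow> bool" where
  "less_var v w \<longleftrightarrow> var_rank v < var_rank w"

instance
  by standard (auto simp: less_eq_var_def less_var_def var_rank_def split: var.splits)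

end

section \<open>Constants and the substitution endomorphisms\<close>

lemma const_add: "const (c + d) = const c + const d"
  by (simp add: const_def single_add)

lemma const_mult: "const (c * d) = const c * const d"
  by (simp add: const_def mult_single)

lemma const_uminus: "const (- c) = - const c"
  by (simp add: const_def single_uminus)

lemma const_diff: "const (c - d) = const c - const d"
  by (simp add: const_def single_diff)

lemma const_0 [simp]: "const 0 = 0"
  by (simp add: const_def)

lemma const_1 [simp]: "const 1 = 1"
  by (simp add: const_def)

lemma const_eq_0_iff [simp]: "const c = 0 \<longleftrightarrow> c = 0"
proof
  assume "const c = 0"
  then have "Poly_Mapping.lookup (const c) 0 = 0" by simp
  then show "c = 0" by (simp add: const_def)
qed simp

lemma bipoly_induct [case_names single plus]:
  fixes p :: "'k::field bipoly"
  assumes single: "\<And>m c. P (Poly_Mapping.single m c)"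
    and plus: "\<And>p q. P p \<Longrightarrow> P q \<Longrightarrow> P (p + q)"
  shows "P p"
proof -
  have "P (\<Sum>m\<in>A. Poly_Mapping.single m (c m))" if "finite A" for A and c :: "_ \<Rightarrow> 'k"
    using that
  proof (induction A)
    case empty
    then show ?case using single[of 0 0] by simp
  qed (auto intro: plus single)
  moreover have "p = (\<Sum>m\<in>Poly_Mapping.keys p. Poly_Mapping.single m (Poly_Mapping.lookup p m))"
    by (rule poly_mapping_eqI)
      (auto simp: lookup_sum lookup_single when_def sum.delta in_keys_iff)
  ultimately show ?thesis by (metis finite_keys)
qed

definition monom_subst :: "(var \<Rightarrow> 'k::field bipoly) \<Rightarrow> (var \<Rightarrow>\<^sub>0 nat) \<Rightarrow> 'k bipoly" where
  "monom_subst f m = (\<Prod>v\<in>{X0, X1, Y0, Y1}. f v ^ Poly_Mapping.lookup m v)"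

text \<open>The values lie in \<open>S\<close> itself, so that one construction covers restriction
  to a fibre or a point, evaluation at a vector (constant values) and the constant term (all values
  0).\<close>

definition subst :: "(var \<Rightarrow> 'k::field bipoly) \<Rightarrow> 'k bipoly \<Rightarrow> 'k bipoly" where
  "subst f p = (\<Sum>m\<in>Poly_Mapping.keys p. const (Poly_Mapping.lookup p m) * monom_subst f m)"

lemma monom_subst_add: "monom_subst f (m + n) = monom_subst f m * monom_subst f n"
  by (simp add: monom_subst_def lookup_add power_add prod.distrib)

lemma subst_single: "subst f (Poly_Mapping.single m c) = const c * monom_subst f m"
  by (simp add: subst_def)

lemma subst_add: "subst f (p + q) = subst f p + subst f q"
  unfolding subst_def
  by (rule setsum_keys_plus_distrib) (simp_all add: const_add algebra_simps)

lemma subst_0 [simp]: "subst f 0 = 0"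
  by (simp add: subst_def)

lemma subst_uminus: "subst f (- p) = - subst f p"
  using subst_add[of f p "- p"] by (simp add: eq_neg_iff_add_eq_0 add.commute)

lemma subst_diff: "subst f (p - q) = subst f p - subst f q"
  using subst_add[of f p "- q"] by (simp add: subst_uminus)

lemma subst_mult: "subst f (p * q) = subst f p * subst f q"
proof (induction p rule: bipoly_induct)
  case (single m c)
  show ?case
  proof (induction q rule: bipoly_induct)
    case (single n d)
    then show ?case
      by (simp add: mult_single subst_single monom_subst_add const_mult)
  qed (simp add: subst_add distrib_left)
qed (simp add: subst_add distrib_right)

lemma subst_const [simp]: "subst f (const c) = const c"
  by (simp add: const_def subst_single monom_subst_def)

lemma subst_1 [simp]: "subst f 1 = 1"
  using subst_const[of f 1] by simp

lemma subst_coord [simp]: "subst f (coord v) = f v"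
  by (cases v) (simp_all add: coord_def subst_single monom_subst_def lookup_single)

lemma subst_sum: "subst f (sum g A) = (\<Sum>i\<in>A. subst f (g i))"
  by (induction A rule: infinite_finite_induct) (simp_all add: subst_add)

lemma subst_prod: "subst f (prod g A) = (\<Prod>i\<in>A. subst f (g i))"
  by (induction A rule: infinite_finite_induct) (simp_all add: subst_mult)

lemma monom_induct [case_names 0 add]:
  fixes m :: "var \<Rightarrow>\<^sub>0 nat"
  assumes "P 0" and add: "\<And>v m. P m \<Longrightarrow> P (Poly_Mapping.single v 1 + m)"
  shows "P m"
proof (induction m rule: update_induct)
  case const
  then show ?case by (rule assms)
next
  case (update m v n)
  have "P (Poly_Mapping.single v k + m)" for k
  proof (induction k)
    case (Suc k)
    have "Poly_Mapping.single v (Suc k) + m = Poly_Mapping.single v 1 + (Poly_Mapping.single v k + m)"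
      by (simp add: single_add[symmetric] add.assoc[symmetric])
    then show ?case using add[OF Suc] by simp
  qed (simp add: update)
  moreover have "Poly_Mapping.update v n m = Poly_Mapping.single v n + m"
    using update(1)
    by (intro poly_mapping_eqI) (auto simp: lookup_update lookup_add lookup_single when_def in_keys_iff)
  ultimately show ?case by simp
qed

text \<open>Modulo \<open>I\<close> the identity and \<open>subst f\<close> are algebra maps that
  agree on the variables. For a substitution that kills \<open>I\<close> this gives the less obvious
  half of "the kernel is \<open>I\<close>": if \<open>subst f p = 0\<close>, then \<open>p\<close>
  itself is the difference that lies in \<open>I\<close>.\<close>

lemma subst_congruent:
  assumes I: "ideal I S_ring" and "\<And>v. coord v - f v \<in> I"
  shows "p - subst f p \<in> I"
proof (induction p rule: bipoly_induct)
  case (single m c)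
  have "Poly_Mapping.single m 1 - subst f (Poly_Mapping.single m 1) \<in> I"
  proof (induction m rule: monom_induct)
    case 0
    then show ?case using ideal_class_ringD(1)[OF I] by simp
  next
    case (add v m)
    let ?p = "Poly_Mapping.single m (1::'a)"
    have eq: "Poly_Mapping.single (Poly_Mapping.single v 1 + m) (1::'a) = coord v * ?p"
      by (simp add: coord_def mult_single)
    \<comment> \<open>The difference of two products, changed one factor at a time.\<close>
    have "coord v * ?p - f v * subst f ?p = coord v * (?p - subst f ?p) + subst f ?p * (coord v - f v)"
      by (simp add: algebra_simps)
    also have "\<dots> \<in> I"
      using ideal_class_ringD(2,3)[OF I] add assms(2) by blast
    finally show ?case unfolding eq subst_mult subst_coord .
  qed
  from ideal_class_ringD(3)[OF I this, of "const c"] show ?case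
    by (simp add: subst_mult subst_single right_diff_distrib) (simp add: const_def mult_single)
next
  case (plus p q)
  then have "(p - subst f p) + (q - subst f q) \<in> I" by (rule ideal_class_ringD(2)[OF I])
  then show ?case by (simp add: subst_add algebra_simps)
qed


section \<open>Linear forms and ideals of points\<close>

text \<open>The determinant of the two vectors is nonzero; for nonzero vectors this means that they
  represent different points of the projective line.\<close>

definition nonprop :: "'k::field \<times> 'k \<Rightarrow> 'k \<times> 'k \<Rightarrow> bool" where
  "nonprop u w \<longleftrightarrow> fst u * snd w \<noteq> snd u * fst w"

lemma nonprop_sym: "nonprop u w \<Longrightarrow> nonprop w u"
  by (auto simp: nonprop_def mult.commute)

text \<open>A covector with value 1 at \<open>u\<close>. It serves as a coordinate on the line
  through \<open>u\<close>, so that restriction to the point \<open>u\<close> takes values in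
  \<open>S\<close> again.\<close>

definition dual :: "'k::field \<times> 'k \<Rightarrow> 'k \<times> 'k" where
  "dual u = (SOME w. fst w * fst u + snd w * snd u = 1)"

lemma dual:
  assumes "u \<noteq> (0, 0)"
  shows "fst (dual u) * fst u + snd (dual u) * snd u = 1"
proof -
  have "\<exists>w. fst w * fst u + snd w * snd u = 1"
  proof (cases "fst u = 0")
    case True
    with assms have "snd u \<noteq> 0" by (cases u) auto
    then show ?thesis by (intro exI[of _ "(0, inverse (snd u))"]) simp
  next
    case False
    then show ?thesis by (intro exI[of _ "(inverse (fst u), 0)"]) simp
  qed
  then show ?thesis unfolding dual_def by (rule someI_ex)
qed

definition x_dual :: "'k::field \<times> 'k \<Rightarrow> 'k bipoly" where
  "x_dual u = const (fst (dual u)) * coord X0 + const (snd (dual u)) * coord X1"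

definition y_dual :: "'k::field \<times> 'k \<Rightarrow> 'k bipoly" where
  "y_dual u = const (fst (dual u)) * coord Y0 + const (snd (dual u)) * coord Y1"

text \<open>The substitution \<open>x_proj u\<close> restricts polynomials to the fibre over \<open>u\<close>, and
  \<open>point_proj u v\<close> restricts them to the point \<open>(u, v)\<close>.\<close>

definition x_proj :: "'k::field \<times> 'k \<Rightarrow> var \<Rightarrow> 'k bipoly" where
  "x_proj u v = (case v of X0 \<Rightarrow> const (fst u) * x_dual u | X1 \<Rightarrow> const (snd u) * x_dual u
     | Y0 \<Rightarrow> coord Y0 | Y1 \<Rightarrow> coord Y1)"

definition point_proj :: "'k::field \<times> 'k \<Rightarrow> 'k \<times> 'k \<Rightarrow> var \<Rightarrow> 'k bipoly" where
  "point_proj u w v = (case v of X0 \<Rightarrow> const (fst u) * x_dual u | X1 \<Rightarrow> const (snd u) * x_dual u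
     | Y0 \<Rightarrow> const (fst w) * y_dual w | Y1 \<Rightarrow> const (snd w) * y_dual w)"

text \<open>Evaluation at \<open>u\<close> gives the value 1.\<close>

lemma dual_nonzero:
  assumes "u \<noteq> (0, 0)"
  shows "x_dual u \<noteq> 0" "y_dual u \<noteq> 0"
proof -
  define f where "f v = const (case v of X0 \<Rightarrow> fst u | X1 \<Rightarrow> snd u | Y0 \<Rightarrow> fst u | Y1 \<Rightarrow> snd u)" for v
  have "subst f (x_dual u) = 1" "subst f (y_dual u) = 1"
    by (simp_all add: x_dual_def y_dual_def f_def subst_add subst_mult dual[OF assms]
        flip: const_mult const_add)
  then show "x_dual u \<noteq> 0" "y_dual u \<noteq> 0" by auto
qed

lemma form_nonzero:
  assumes "u \<noteq> (0, 0)"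
  shows "x_form u \<noteq> 0" "y_form u \<noteq> 0"
proof -
  \<comment> \<open>The vector \<open>(d1, - d0)\<close> for \<open>dual u = (d0, d1)\<close>: there
    the form of \<open>u\<close> takes the value \<open>d0 * u0 + d1 * u1 = 1\<close>.\<close>
  define f where "f v = const (case v of X0 \<Rightarrow> snd (dual u) | X1 \<Rightarrow> - fst (dual u)
    | Y0 \<Rightarrow> snd (dual u) | Y1 \<Rightarrow> - fst (dual u))" for v
  have "subst f (x_form u) = 1" "subst f (y_form u) = 1"
    using dual[OF assms]
    by (simp_all add: x_form_def y_form_def f_def subst_diff subst_mult algebra_simps
        flip: const_mult const_add const_diff)
  then show "x_form u \<noteq> 0" "y_form u \<noteq> 0" by auto
qed

section \<open>Restriction to fibres and points, and its kernel\<close>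

lemma subst_x_proj:
  "subst (x_proj u) (x_form w) = const (fst u * snd w - snd u * fst w) * x_dual u"
  "subst (x_proj u) (y_form w) = y_form w"
  by (simp_all add: x_form_def y_form_def x_proj_def subst_diff subst_mult const_mult const_diff
      algebra_simps)

lemma subst_point_proj:
  "subst (point_proj u v) (x_form w) = const (fst u * snd w - snd u * fst w) * x_dual u"
  "subst (point_proj u v) (y_form w) = const (fst v * snd w - snd v * fst w) * y_dual v"
  by (simp_all add: x_form_def y_form_def point_proj_def subst_diff subst_mult const_mult const_diff
      algebra_simps)

text \<open>Multiply the coordinate by \<open>1 = d0 * u0 + d1 * u1\<close>; after subtraction only
  a multiple of the form of \<open>u\<close> is left. Hence the restriction maps change each
  variable only modulo the ideal of the fibre or point.\<close>

lemma coord_minus_dual: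
  assumes "u \<noteq> (0, 0)"
  shows "coord X0 - const (fst u) * x_dual u = const (snd (dual u)) * x_form u"
    "coord X1 - const (snd u) * x_dual u = const (- fst (dual u)) * x_form u"
    "coord Y0 - const (fst u) * y_dual u = const (snd (dual u)) * y_form u"
    "coord Y1 - const (snd u) * y_dual u = const (- fst (dual u)) * y_form u"
proof -
  define a b where "a = fst (dual u)" and "b = snd (dual u)"
  have "const (a * fst u + b * snd u) = 1"
    using dual[OF assms] by (simp add: a_def b_def)
  then have one: "const a * const (fst u) + const b * const (snd u) = 1"
    by (simp add: const_add const_mult)
  have X0: "X = (const a * const (fst u) + const b * const (snd u)) * X" for X
    by (simp add: one)
  show "coord X0 - const (fst u) * x_dual u = const (snd (dual u)) * x_form u"
    "coord Y0 - const (fst u) * y_dual u = const (snd (dual u)) * y_form u"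
    unfolding x_dual_def y_dual_def x_form_def y_form_def a_def[symmetric] b_def[symmetric]
    using X0[of "coord X0"] X0[of "coord Y0"] by (simp_all add: algebra_simps)
  show "coord X1 - const (snd u) * x_dual u = const (- fst (dual u)) * x_form u"
    "coord Y1 - const (snd u) * y_dual u = const (- fst (dual u)) * y_form u"
    unfolding x_dual_def y_dual_def x_form_def y_form_def a_def[symmetric] b_def[symmetric]
    using X0[of "coord X1"] X0[of "coord Y1"] by (simp_all add: const_uminus algebra_simps)
qed

text \<open>Turns divisibility by a linear form into an equation in a domain. Primality of the form
  and all non-divisibility facts needed for exactness follow from it.\<close>

lemma x_form_dvd_iff:
  assumes "u \<noteq> (0, 0)"
  shows "x_form u dvd p \<longleftrightarrow> subst (x_proj u) p = 0"
proof
  assume "x_form u dvd p"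
  then show "subst (x_proj u) p = 0"
    by (auto elim!: dvdE simp: subst_mult subst_x_proj mult.commute[of "fst u"])
next
  assume 0: "subst (x_proj u) p = 0"
  have "ideal {q. x_form u dvd q} S_ring"
    by (auto simp: ideal_class_ring_iff)
  then have "p - subst (x_proj u) p \<in> {q. x_form u dvd q}"
  proof (rule subst_congruent)
    show "coord v - x_proj u v \<in> {q. x_form u dvd q}" for v
      using coord_minus_dual[OF assms] by (cases v) (simp_all add: x_proj_def)
  qed
  with 0 show "x_form u dvd p" by simp
qed

text \<open>Membership in the ideal of a point becomes an equation in a domain, so factors that do
  not vanish at the point can be cancelled.\<close>

lemma point_ideal_iff:
  assumes "u \<noteq> (0, 0)" and "v \<noteq> (0, 0)"
  shows "p \<in> Idl\<^bsub>S_ring\<^esub> {x_form u, y_form v} \<longleftrightarrow> subst (point_proj u v) p = 0"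
proof
  assume "p \<in> Idl\<^bsub>S_ring\<^esub> {x_form u, y_form v}"
  then show "subst (point_proj u v) p = 0"
    by (auto simp: genideal_pair subst_add subst_mult subst_point_proj mult.commute)
next
  assume 0: "subst (point_proj u v) p = 0"
  let ?I = "Idl\<^bsub>S_ring\<^esub> {x_form u, y_form v}"
  have I: "ideal ?I S_ring" "x_form u \<in> ?I" "y_form v \<in> ?I"
    using genideal_class_ring(1,2)[of "{x_form u, y_form v}"] by auto
  from I(1) have "p - subst (point_proj u v) p \<in> ?I"
  proof (rule subst_congruent)
    show "coord w - point_proj u v w \<in> ?I" for w
      using coord_minus_dual[OF assms(1)] coord_minus_dual[OF assms(2)] ideal_class_ringD(3)[OF I(1)] I(2,3)
      by (cases w) (simp_all add: point_proj_def)
  qed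
  with 0 show "p \<in> ?I" by simp
qed

lemma prime_elem_x_form:
  assumes "u \<noteq> (0, 0)"
  shows "prime_elem (x_form u)"
  unfolding prime_elem_def x_form_dvd_iff[OF assms]
  using form_nonzero[OF assms] by (simp add: subst_mult)

lemma x_form_dvd_x_form:
  assumes "u \<noteq> (0, 0)"
  shows "x_form u dvd x_form w \<longleftrightarrow> \<not> nonprop u w"
  unfolding x_form_dvd_iff[OF assms] subst_x_proj
  using dual_nonzero[OF assms] by (simp add: nonprop_def)

text \<open>\<open>x_proj u\<close> fixes \<open>Y0\<close> and \<open>Y1\<close>, so the product
  restricts to itself, and it is nonzero. The empty product 1 is included; it occurs for the added
  points.\<close>

lemma not_x_form_dvd_prod_y_form:
  assumes "u \<noteq> (0, 0)" and "finite C" and "\<And>c. c \<in> C \<Longrightarrow> c \<noteq> (0, 0)"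
  shows "\<not> x_form u dvd prod y_form C"
proof -
  have "(\<Prod>c\<in>C. y_form c) \<noteq> 0"
    using assms(2,3) by (induction C) (simp_all add: form_nonzero)
  then show ?thesis
    by (simp add: x_form_dvd_iff[OF assms(1)] subst_prod subst_x_proj)
qed

text \<open>For \<open>C = {}\<close> both sides are the unit ideal.\<close>

lemma fibre_ideal:
  assumes u: "u \<noteq> (0, 0)" and "finite C" and "\<And>c. c \<in> C \<Longrightarrow> c \<noteq> (0, 0)"
    and "\<And>c d. c \<in> C \<Longrightarrow> d \<in> C \<Longrightarrow> c \<noteq> d \<Longrightarrow> nonprop c d"
  shows "(\<Inter>c\<in>C. Idl\<^bsub>S_ring\<^esub> {x_form u, y_form c}) = Idl\<^bsub>S_ring\<^esub> {x_form u, prod y_form C}"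
  using assms(2-)
proof (induction C)
  case empty
  have "p \<in> Idl\<^bsub>S_ring\<^esub> {x_form u, 1}" for p
    using genideal_pairI[of 0 "x_form u" p 1] by simp
  then show ?case by auto
next
  case (insert c C)
  let ?g = "prod y_form C"
  have c: "c \<noteq> (0, 0)" using insert by blast
  \<comment> \<open>The forms of the earlier points do not vanish at the new point
    \<open>(u, c)\<close>. Cancelling \<open>?g\<close> there shows below that the coefficient
    \<open>t\<close> of \<open>?g\<close> lies in the ideal of the new point, which produces the
    factor \<open>y_form c\<close>.\<close>
  have g: "subst (point_proj u c) ?g \<noteq> 0"
    unfolding subst_prod subst_point_proj
    using insert.hyps insert.prems(2)[of c] dual_nonzero[OF c]
    by (auto simp: prod_zero_iff nonprop_def)
  have IH: "(\<Inter>d\<in>C. Idl\<^bsub>S_ring\<^esub> {x_form u, y_form d}) = Idl\<^bsub>S_ring\<^esub> {x_form u, ?g}"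
    using insert by blast
  have "p \<in> Idl\<^bsub>S_ring\<^esub> {x_form u, y_form c * ?g}"
    if p: "p \<in> Idl\<^bsub>S_ring\<^esub> {x_form u, y_form c}" "p \<in> Idl\<^bsub>S_ring\<^esub> {x_form u, ?g}" for p
  proof -
    from p(2) obtain s t where st: "p = s * x_form u + t * ?g" by (rule genideal_pairE)
    have "subst (point_proj u c) t * subst (point_proj u c) ?g = 0"
      using p(1) unfolding point_ideal_iff[OF u c] st
      by (simp add: subst_add subst_mult subst_point_proj mult.commute[of "fst u"])
    with g have "t \<in> Idl\<^bsub>S_ring\<^esub> {x_form u, y_form c}"
      by (simp add: point_ideal_iff[OF u c])
    then obtain s' t' where "t = s' * x_form u + t' * y_form c" by (rule genideal_pairE)
    with st have "p = (s + s' * ?g) * x_form u + t' * (y_form c * ?g)"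
      by (simp add: algebra_simps)
    then show ?thesis by (simp only: genideal_pairI)
  qed
  moreover have "p \<in> Idl\<^bsub>S_ring\<^esub> {x_form u, y_form c} \<and> p \<in> Idl\<^bsub>S_ring\<^esub> {x_form u, ?g}"
    if "p \<in> Idl\<^bsub>S_ring\<^esub> {x_form u, y_form c * ?g}" for p
  proof -
    from that obtain s t where st: "p = s * x_form u + t * (y_form c * ?g)" by (rule genideal_pairE)
    then have "p = s * x_form u + (t * ?g) * y_form c" "p = s * x_form u + (t * y_form c) * ?g"
      by (simp_all add: algebra_simps)
    then show ?thesis by (metis genideal_pairI)
  qed
  ultimately have "Idl\<^bsub>S_ring\<^esub> {x_form u, y_form c} \<inter> Idl\<^bsub>S_ring\<^esub> {x_form u, ?g}
    = Idl\<^bsub>S_ring\<^esub> {x_form u, y_form c * ?g}"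
    by blast
  with insert.hyps IH show ?case by simp
qed

text \<open>Cramer's rule with the determinant \<open>?D\<close>.\<close>

lemma x_ideal_subset:
  assumes "nonprop u w"
  shows "x_ideal \<subseteq> Idl\<^bsub>S_ring\<^esub> {x_form u, x_form w}"
  unfolding x_ideal_def
proof (rule genideal_class_ring(3)[OF genideal_class_ring(1)])
  let ?D = "fst u * snd w - snd u * fst w"
  have D: "const (inverse ?D) * (const (fst u) * const (snd w) - const (snd u) * const (fst w)) = 1"
    using assms by (simp add: nonprop_def flip: const_mult const_diff)
  have "coord X0 = (const (inverse ?D) * (const (fst u) * const (snd w) - const (snd u) * const (fst w))) * coord X0"
    by (simp only: D mult_1)
  also have "\<dots> = (- const (inverse ?D) * const (fst w)) * x_form u + (const (inverse ?D) * const (fst u)) * x_form w"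
    by (simp add: x_form_def algebra_simps)
  finally have X0: "coord X0 \<in> Idl\<^bsub>S_ring\<^esub> {x_form u, x_form w}"
    by (simp only: genideal_pairI)
  have "coord X1 = (const (inverse ?D) * (const (fst u) * const (snd w) - const (snd u) * const (fst w))) * coord X1"
    by (simp only: D mult_1)
  also have "\<dots> = (- const (inverse ?D) * const (snd w)) * x_form u + (const (inverse ?D) * const (snd u)) * x_form w"
    by (simp add: x_form_def algebra_simps)
  finally have X1: "coord X1 \<in> Idl\<^bsub>S_ring\<^esub> {x_form u, x_form w}"
    by (simp only: genideal_pairI)
  from X0 X1 show "{coord X0, coord X1} \<subseteq> Idl\<^bsub>S_ring\<^esub> {x_form u, x_form w}" by blast
qed

lemma ideal_x_ideal: "ideal x_ideal S_ring"
  unfolding x_ideal_def by (rule genideal_class_ring)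

lemma x_form_in_x_ideal: "x_form u \<in> x_ideal"
proof -
  have "coord X0 \<in> x_ideal" "coord X1 \<in> x_ideal"
    unfolding x_ideal_def using genideal_class_ring(2)[of "{coord X0, coord X1}"] by auto
  then show ?thesis
    unfolding x_form_def using ideal_class_ringD(3,5)[OF ideal_x_ideal] by blast
qed

text \<open>The products are the Lagrange basis of the forms of degree \<open>a\<close>, up to
  scalars. In the induction the new factor from \<open>x_ideal\<close> is written in terms of the
  forms of \<open>u i\<close> and \<open>u (Suc a)\<close>, with a different pair for every
  \<open>i\<close>: multiplying the old product for \<open>i\<close> by these two gives the new
  products for \<open>Suc a\<close> and for \<open>i\<close>.\<close>

lemma x_ideal_pow_subset:
  fixes u :: "nat \<Rightarrow> 'k::field \<times> 'k"
  assumes "\<And>i j. i \<le> a \<Longrightarrow> j \<le> a \<Longrightarrow> i \<noteq> j \<Longrightarrow> nonprop (u i) (u j)"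
  shows "ideal_pow S_ring x_ideal a
    \<subseteq> Idl\<^bsub>S_ring\<^esub> ((\<lambda>i. \<Prod>j\<in>{..a} - {i}. x_form (u j)) ` {..a})"
  using assms
proof (induction a)
  case 0
  have "p \<in> Idl\<^bsub>S_ring\<^esub> {1}" for p :: "'k bipoly"
    using genideal_pairI[of 0 "1 :: 'k bipoly" p 1] by simp
  then have "Idl\<^bsub>S_ring\<^esub> {1} = (UNIV :: 'k bipoly set)" by blast
  then show ?case by simp
next
  case (Suc a)
  let ?e = "\<lambda>a i. \<Prod>j\<in>{..a} - {i}. x_form (u j)"
  let ?E = "Idl\<^bsub>S_ring\<^esub> (?e (Suc a) ` {..Suc a})"
  have E: "ideal ?E S_ring" by (rule genideal_class_ring)
  have gen: "?e (Suc a) i \<in> ?E" if "i \<le> Suc a" for i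
    using genideal_class_ring(2)[of "?e (Suc a) ` {..Suc a}"] that by blast
  have step: "?e a i * q \<in> ?E" if i: "i \<le> a" and q: "q \<in> x_ideal" for i q
  proof -
    have "q \<in> Idl\<^bsub>S_ring\<^esub> {x_form (u i), x_form (u (Suc a))}"
      using q i x_ideal_subset[of "u i" "u (Suc a)"] Suc.prems[of i "Suc a"] by auto
    then obtain s t where q: "q = s * x_form (u i) + t * x_form (u (Suc a))" by (rule genideal_pairE)
    have "{..Suc a} - {Suc a} = {..a}" "{..Suc a} - {i} = insert (Suc a) ({..a} - {i})"
      using i by auto
    then have "?e (Suc a) (Suc a) = ?e a i * x_form (u i)"
      "?e (Suc a) i = ?e a i * x_form (u (Suc a))"
      using i by (simp_all add: prod.remove[of "{..a}" i] mult.commute)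
    then have "?e a i * q = s * ?e (Suc a) (Suc a) + t * ?e (Suc a) i"
      by (simp add: q algebra_simps)
    also have "\<dots> \<in> ?E"
      using gen i ideal_class_ringD(2,3)[OF E] by simp
    finally show ?thesis .
  qed
  have sub: "ideal_pow S_ring x_ideal a \<subseteq> Idl\<^bsub>S_ring\<^esub> (?e a ` {..a})"
    by (rule Suc.IH) (simp add: Suc.prems)
  show ?case
    unfolding ideal_pow_Suc
  proof
    fix p :: "'k bipoly" assume "p \<in> ideal_prod S_ring (ideal_pow S_ring x_ideal a) x_ideal"
    then show "p \<in> ?E"
    proof induction
      case (prod p q)
      then obtain c where p: "p = (\<Sum>i\<le>a. c i * ?e a i)"
        using sub unfolding genideal_image_finite[OF finite_atMost] by blast
      have "p * q = (\<Sum>i\<le>a. c i * (?e a i * q))"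
        by (simp add: p sum_distrib_right mult.assoc)
      also have "\<dots> \<in> ?E"
        using step prod by (intro ideal_class_ringD(6)[OF E] ideal_class_ringD(3)[OF E, OF step]) auto
      finally show ?case by simp
    next
      case (sum p q)
      then show ?case using ideal_class_ringD(2)[OF E] by simp
    qed
  qed
qed

text \<open>Each coefficient of \<open>p\<close> with respect to the generators of \<open>\<langle>x\<^sub>0, x\<^sub>1\<rangle>\<^sup>a\<close> from
  the preceding lemma can be treated separately, because all but one of these generators
  vanish on any given fibre.\<close>

lemma fibres_inter_x_ideal_pow:
  fixes u :: "nat \<Rightarrow> 'k::field \<times> 'k" and C :: "nat \<Rightarrow> ('k \<times> 'k) set"
  assumes u0: "\<And>i. i \<le> a \<Longrightarrow> u i \<noteq> (0, 0)"
    and u: "\<And>i j. i \<le> a \<Longrightarrow> j \<le> a \<Longrightarrow> i \<noteq> j \<Longrightarrow> nonprop (u i) (u j)"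
    and fin: "\<And>i. i \<le> a \<Longrightarrow> finite (C i)" and c0: "\<And>i c. i \<le> a \<Longrightarrow> c \<in> C i \<Longrightarrow> c \<noteq> (0, 0)"
    and c: "\<And>i c d. i \<le> a \<Longrightarrow> c \<in> C i \<Longrightarrow> d \<in> C i \<Longrightarrow> c \<noteq> d \<Longrightarrow> nonprop c d"
  shows "(\<Inter>i\<in>{..a}. \<Inter>c\<in>C i. Idl\<^bsub>S_ring\<^esub> {x_form (u i), y_form c}) \<inter> ideal_pow S_ring x_ideal a
    = {(\<Sum>i\<le>a. v i * (prod y_form (C i) * (\<Prod>j\<in>{..a} - {i}. x_form (u j))))
         + w * (\<Prod>j\<le>a. x_form (u j)) | v w. True}" (is "?L = ?R")
proof
  let ?e = "\<lambda>i. \<Prod>j\<in>{..a} - {i}. x_form (u j)"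
  let ?H = "\<Prod>j\<le>a. x_form (u j)"
  let ?g = "\<lambda>i. prod y_form (C i)"
  have H: "?H = x_form (u i) * ?e i" if "i \<le> a" for i
    using that by (simp add: prod.remove[of "{..a}" i])
  have fibre: "(\<Inter>c\<in>C i. Idl\<^bsub>S_ring\<^esub> {x_form (u i), y_form c}) = Idl\<^bsub>S_ring\<^esub> {x_form (u i), ?g i}"
    if "i \<le> a" for i
    by (rule fibre_ideal[OF u0[OF that] fin[OF that] c0[OF that] c[OF that]])
  show "?L \<subseteq> ?R"
  proof
    fix p assume p: "p \<in> ?L"
    have "p \<in> Idl\<^bsub>S_ring\<^esub> (?e ` {..a})"
      by (rule subsetD[OF x_ideal_pow_subset[OF u] IntD2[OF p]])
    then obtain q where q: "p = (\<Sum>i\<le>a. q i * ?e i)"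
      unfolding genideal_image_finite[OF finite_atMost] by blast
    have "\<exists>s t. q i = s * x_form (u i) + t * ?g i" if i: "i \<le> a" for i
    proof -
      have "q i \<in> Idl\<^bsub>S_ring\<^esub> {x_form (u i), y_form c}" if c: "c \<in> C i" for c
      proof -
        let ?\<tau> = "subst (point_proj (u i) c)"
        have 0: "?\<tau> (?e j) = 0" if "j \<in> {..a} - {i}" for j
        proof -
          have "i \<in> {..a} - {j}" using i that by auto
          then show ?thesis
            by (auto simp: subst_prod subst_point_proj intro!: bexI[of _ i])
        qed
        have 1: "?\<tau> (?e i) \<noteq> 0"
          using i u[OF i] dual_nonzero[OF u0[OF i]]
          by (auto simp: subst_prod subst_point_proj nonprop_def)
        have "?\<tau> p = (\<Sum>j\<le>a. ?\<tau> (q j) * ?\<tau> (?e j))"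
          by (simp add: q subst_sum subst_mult)
        also have "\<dots> = ?\<tau> (q i) * ?\<tau> (?e i)"
          using i 0 by (simp add: sum.remove[of "{..a}" i])
        also have "?\<tau> p = 0"
          unfolding point_ideal_iff[OF u0[OF i] c0[OF i c], symmetric]
          using IntD1[OF p] i c by blast
        finally show ?thesis
          using 1 by (simp add: point_ideal_iff[OF u0[OF i] c0[OF i c]])
      qed
      \<comment> \<open>If \<open>C i\<close> is empty, the intersection is the whole ring and
        \<open>?g i = 1\<close>, so both sides are still equal.\<close>
      then have "q i \<in> Idl\<^bsub>S_ring\<^esub> {x_form (u i), ?g i}"
        unfolding fibre[OF i, symmetric] by (rule INT_I)
      then show ?thesis by (blast elim: genideal_pairE)
    qed
    then obtain s t where st: "\<And>i. i \<le> a \<Longrightarrow> q i = s i * x_form (u i) + t i * ?g i"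
      by metis
    \<comment> \<open>As \<open>x_form (u i) * ?e i = ?H\<close> for each \<open>i\<close>, the
      parts of all \<open>q i\<close> along the linear forms merge into multiples of the single
      generator \<open>?H\<close>.\<close>
    have "p = (\<Sum>i\<le>a. t i * (?g i * ?e i) + s i * ?H)"
      unfolding q by (intro sum.cong) (simp_all add: st H algebra_simps)
    then have "p = (\<Sum>i\<le>a. t i * (?g i * ?e i)) + (\<Sum>i\<le>a. s i) * ?H"
      by (simp add: sum.distrib sum_distrib_right)
    then show "p \<in> ?R" by blast
  qed
  show "?R \<subseteq> ?L"
  proof
    fix p assume "p \<in> ?R"
    then obtain v w where p: "p = (\<Sum>i\<le>a. v i * (?g i * ?e i)) + w * ?H" by blast
    have e: "?e i \<in> ideal_pow S_ring x_ideal a" if "i \<le> a" for i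
      using prod_in_ideal_pow[of "{..a} - {i}" "\<lambda>j. x_form (u j)" x_ideal, OF _ x_form_in_x_ideal] that
      by (simp add: card_Diff_singleton)
    note X = ideal_class_ringD[OF ideal_ideal_pow[OF ideal_x_ideal, of a]]
    have Hx: "?H \<in> ideal_pow S_ring x_ideal a"
      \<comment> \<open>\<open>?H\<close> is a multiple of \<open>?e 0\<close>; the index 0 is
        available even for \<open>a = 0\<close>.\<close>
      using X(3)[OF e[of 0], of "x_form (u 0)"] H[of 0] by simp
    have "p \<in> ideal_pow S_ring x_ideal a"
      unfolding p using e Hx by (intro X(2) X(3)[of "?H"] X(6)[OF X(3)[OF X(3)]]) auto
    moreover have "p \<in> Idl\<^bsub>S_ring\<^esub> {x_form (u i), ?g i}" if i: "i \<le> a" for i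
    proof -
      note I = ideal_class_ringD[OF genideal_class_ring(1)[of "{x_form (u i), ?g i}"]]
      have gens: "x_form (u i) \<in> Idl\<^bsub>S_ring\<^esub> {x_form (u i), ?g i}"
        "?g i \<in> Idl\<^bsub>S_ring\<^esub> {x_form (u i), ?g i}"
        using genideal_class_ring(2)[of "{x_form (u i), ?g i}"] by auto
      have "?e j \<in> Idl\<^bsub>S_ring\<^esub> {x_form (u i), ?g i}" if "j \<noteq> i" for j
        using I(3)[OF gens(1)] that i
        by (simp add: prod.remove[of _ i] mult.commute[of "x_form (u i)"])
      then have ge: "?g j * ?e j \<in> Idl\<^bsub>S_ring\<^esub> {x_form (u i), ?g i}" for j
        using I(3) gens(2) by (cases "j = i") (simp_all add: mult.commute[of "?g i"])
      have He: "?H \<in> Idl\<^bsub>S_ring\<^esub> {x_form (u i), ?g i}"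
        using I(3)[OF gens(1)] H[OF i] by (simp add: mult.commute[of "x_form (u i)"])
      show ?thesis
        unfolding p by (intro I(2) I(3)[OF He] I(6)[OF I(3)[OF ge]])
    qed
    then have "p \<in> (\<Inter>c\<in>C i. Idl\<^bsub>S_ring\<^esub> {x_form (u i), y_form c})" if "i \<le> a" for i
      using that unfolding fibre[OF that] .
    ultimately show "p \<in> ?L"
      by blast
  qed
qed


section \<open>Quotient modules\<close>

text \<open>\<open>quot_module\<close> is a record built from cosets without any assumption; for a
  submodule \<open>N\<close> its operations turn out to be the expected ones on
  representatives.\<close>

locale quotient_module = Module.module R M
  for R (structure) and M (structure) +
  fixes N
  assumes submodule: "LinearCombinations.submodule R N M"
begin

lemma abelian_subgroup: "abelian_subgroup N M"
proof (rule abelian_subgroupI3[OF _ M.abelian_group_axioms], rule additive_subgroup.intro)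
  interpret N: LinearCombinations.submodule R N M by (rule submodule)
  have "\<ominus>\<^bsub>M\<^esub> x \<in> N" if x: "x \<in> N" for x
  proof -
    have "\<ominus>\<^bsub>M\<^esub> x = (\<ominus> \<one>) \<odot>\<^bsub>M\<^esub> x"
      by (rule smult_minus_1[symmetric]) (use N.subset x in blast)
    also have "\<dots> \<in> N"
      using x by (intro N.smult_closed) simp_all
    finally show ?thesis .
  qed
  then show "subgroup N (add_monoid M)"
    using N.subset by (auto simp: subgroup_def a_inv_def)
qed

sublocale N: abelian_subgroup N M
  by (rule abelian_subgroup)

lemma subset: "N \<subseteq> carrier M"
  using submodule by (rule LinearCombinations.submodule.subset)

lemma coset_eq_iff:
  assumes "x \<in> carrier M" "y \<in> carrier M"
  shows "N +>\<^bsub>M\<^esub> x = N +>\<^bsub>M\<^esub> y \<longleftrightarrow> x \<ominus>\<^bsub>M\<^esub> y \<in> N"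
proof
  assume "N +>\<^bsub>M\<^esub> x = N +>\<^bsub>M\<^esub> y"
  then have "x \<in> N +>\<^bsub>M\<^esub> y" using N.a_rcos_self[OF assms(1)] by simp
  then show "x \<ominus>\<^bsub>M\<^esub> y \<in> N"
    using N.a_rcos_module_imp[OF assms(2)] by (simp add: a_minus_def)
next
  assume "x \<ominus>\<^bsub>M\<^esub> y \<in> N"
  then have "x \<in> N +>\<^bsub>M\<^esub> y"
    using N.a_rcos_module_rev[OF assms(2,1)] by (simp add: a_minus_def)
  then show "N +>\<^bsub>M\<^esub> x = N +>\<^bsub>M\<^esub> y"
    using M.a_repr_independence[OF _ assms(2) N.a_subgroup] by simp
qed

lemma coset_eq_self_iff:
  assumes "x \<in> carrier M"
  shows "N +>\<^bsub>M\<^esub> x = N \<longleftrightarrow> x \<in> N"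
  using coset_eq_iff[OF assms M.zero_closed] assms subset
  by (simp add: a_minus_def M.add.inv_one[folded a_inv_def])

lemma quot_carrier: "carrier (quot_module M N) = (\<lambda>x. N +>\<^bsub>M\<^esub> x) ` carrier M"
  by (auto simp: quot_module_def A_RCOSETS_def')

lemma quot_zero: "\<zero>\<^bsub>quot_module M N\<^esub> = N"
  by (simp add: quot_module_def)

lemma quot_add:
  assumes "x \<in> carrier M" "y \<in> carrier M"
  shows "(N +>\<^bsub>M\<^esub> x) \<oplus>\<^bsub>quot_module M N\<^esub> (N +>\<^bsub>M\<^esub> y) = N +>\<^bsub>M\<^esub> (x \<oplus>\<^bsub>M\<^esub> y)"
  by (simp add: quot_module_def N.a_rcos_sum assms)

text \<open>The scalar action is defined as a union over all representatives \<open>c\<close> of the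
  coset. All sets in this union agree because \<open>N\<close> is closed under scalars.\<close>

lemma quot_smult:
  assumes r: "r \<in> carrier R" and x: "x \<in> carrier M"
  shows "r \<odot>\<^bsub>quot_module M N\<^esub> (N +>\<^bsub>M\<^esub> x) = N +>\<^bsub>M\<^esub> (r \<odot>\<^bsub>M\<^esub> x)"
proof -
  have "N +>\<^bsub>M\<^esub> (r \<odot>\<^bsub>M\<^esub> c) = N +>\<^bsub>M\<^esub> (r \<odot>\<^bsub>M\<^esub> x)" if c: "c \<in> N +>\<^bsub>M\<^esub> x" for c
  proof -
    have cM: "c \<in> carrier M"
      using M.a_r_coset_subset_G[OF subset x] c by blast
    have "N +>\<^bsub>M\<^esub> c = N +>\<^bsub>M\<^esub> x"
      using M.a_repr_independence[OF c x N.a_subgroup] by simp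
    then have "c \<ominus>\<^bsub>M\<^esub> x \<in> N"
      using coset_eq_iff[OF cM x] by simp
    then have "r \<odot>\<^bsub>M\<^esub> (c \<ominus>\<^bsub>M\<^esub> x) \<in> N"
      using LinearCombinations.submodule.smult_closed[OF submodule r] by simp
    moreover have "r \<odot>\<^bsub>M\<^esub> (c \<ominus>\<^bsub>M\<^esub> x) = (r \<odot>\<^bsub>M\<^esub> c) \<ominus>\<^bsub>M\<^esub> (r \<odot>\<^bsub>M\<^esub> x)"
      using r x cM by (simp add: a_minus_def smult_r_distr smult_r_minus)
    ultimately show ?thesis
      using r x cM by (simp add: coset_eq_iff)
  qed
  then have "(\<Union>c\<in>N +>\<^bsub>M\<^esub> x. N +>\<^bsub>M\<^esub> (r \<odot>\<^bsub>M\<^esub> c)) = (\<Union>c\<in>N +>\<^bsub>M\<^esub> x. N +>\<^bsub>M\<^esub> (r \<odot>\<^bsub>M\<^esub> x))"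
    by (intro SUP_cong) simp_all
  also have "\<dots> = N +>\<^bsub>M\<^esub> (r \<odot>\<^bsub>M\<^esub> x)"
    using N.a_rcos_self[OF x] by (intro SUP_const) blast
  finally show ?thesis by (simp add: quot_module_def)
qed

lemma module_quot: "Module.module R (quot_module M N)"
proof (rule module_criteria)
  let ?Q = "quot_module M N"
  show "cring R" by (rule R.is_cring)
  have "N = N +>\<^bsub>M\<^esub> \<zero>\<^bsub>M\<^esub>"
    using subset by simp
  then show "\<zero>\<^bsub>?Q\<^esub> \<in> carrier ?Q"
    unfolding quot_zero quot_carrier by blast
  show "\<forall>v\<in>carrier ?Q. \<exists>w\<in>carrier ?Q. v \<oplus>\<^bsub>?Q\<^esub> w = \<zero>\<^bsub>?Q\<^esub>"
  proof
    fix v assume "v \<in> carrier ?Q"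
    then obtain x where x: "x \<in> carrier M" "v = N +>\<^bsub>M\<^esub> x" by (auto simp: quot_carrier)
    then have "v \<oplus>\<^bsub>?Q\<^esub> (N +>\<^bsub>M\<^esub> (\<ominus>\<^bsub>M\<^esub> x)) = \<zero>\<^bsub>?Q\<^esub>"
      using subset by (simp add: quot_add quot_zero M.r_neg)
    then show "\<exists>w\<in>carrier ?Q. v \<oplus>\<^bsub>?Q\<^esub> w = \<zero>\<^bsub>?Q\<^esub>"
      using x by (auto simp: quot_carrier)
  qed
  show "\<forall>v\<in>carrier ?Q. v \<oplus>\<^bsub>?Q\<^esub> \<zero>\<^bsub>?Q\<^esub> = v"
  proof
    fix v assume "v \<in> carrier ?Q"
    then obtain x where "x \<in> carrier M" "v = N +>\<^bsub>M\<^esub> x" by (auto simp: quot_carrier)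
    then show "v \<oplus>\<^bsub>?Q\<^esub> \<zero>\<^bsub>?Q\<^esub> = v"
      using quot_add[of x "\<zero>\<^bsub>M\<^esub>"] subset by (simp add: quot_zero)
  qed
qed (auto simp: quot_carrier quot_add quot_smult M.a_ac smult_assoc1 smult_l_distr smult_r_distr)

lemma quot_hom: "(\<lambda>x. N +>\<^bsub>M\<^esub> x) \<in> LinearCombinations.module_hom R M (quot_module M N)"
  by (auto simp: LinearCombinations.module_hom_def quot_carrier quot_add quot_smult)

lemma quot_lift:
  assumes P: "Module.module R P" and f: "f \<in> LinearCombinations.module_hom R M P"
    and N: "\<And>x. x \<in> N \<Longrightarrow> f x = \<zero>\<^bsub>P\<^esub>"
  obtains g where "g \<in> LinearCombinations.module_hom R (quot_module M N) P"
    and "\<And>x. x \<in> carrier M \<Longrightarrow> g (N +>\<^bsub>M\<^esub> x) = f x"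
proof
  interpret f: mod_hom R M P f
    using P f by (simp add: mod_hom_def mod_hom_axioms_def module_axioms)
  \<comment> \<open>An arbitrary representative may be used: two of them differ by an element of
    \<open>N\<close>, where \<open>f\<close> vanishes.\<close>
  define g where "g C = f (SOME x. x \<in> C)" for C
  show g: "g (N +>\<^bsub>M\<^esub> x) = f x" if x: "x \<in> carrier M" for x
  proof -
    define c where "c = (SOME x'. x' \<in> N +>\<^bsub>M\<^esub> x)"
    have c: "c \<in> N +>\<^bsub>M\<^esub> x"
      unfolding c_def by (rule someI, rule N.a_rcos_self[OF x])
    then have cM: "c \<in> carrier M"
      using M.a_r_coset_subset_G[OF subset x] by blast
    have "c \<ominus>\<^bsub>M\<^esub> x \<in> N"
      using coset_eq_iff[OF cM x] M.a_repr_independence[OF c x N.a_subgroup] by simp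
    from N[OF this] have "f c \<ominus>\<^bsub>P\<^esub> f x = \<zero>\<^bsub>P\<^esub>"
      using cM x by simp
    then have "\<ominus>\<^bsub>P\<^esub> (\<ominus>\<^bsub>P\<^esub> f x) = f c"
      using cM x by (intro f.N.M.minus_equality) (simp_all add: a_minus_def)
    then have "f c = f x"
      using cM x by simp
    then show ?thesis by (simp add: g_def c_def)
  qed
  show "g \<in> LinearCombinations.module_hom R (quot_module M N) P"
    unfolding LinearCombinations.module_hom_def by (auto simp: quot_carrier quot_add quot_smult g)
qed

text \<open>First isomorphism theorem. It is applied with \<open>H_0\<close> as \<open>M\<close> and
  the torsion of \<open>H_0\<close> as \<open>N\<close>.\<close>

lemma quot_isomorphic:
  assumes P: "Module.module R P" and f: "f \<in> LinearCombinations.module_hom R M P"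
    and surj: "f ` carrier M = carrier P" and ker: "{x \<in> carrier M. f x = \<zero>\<^bsub>P\<^esub>} = N"
  shows "module_isomorphic R (quot_module M N) P"
proof -
  interpret f: mod_hom R M P f
    using P f by (simp add: mod_hom_def mod_hom_axioms_def module_axioms)
  obtain g where g: "g \<in> LinearCombinations.module_hom R (quot_module M N) P"
    "\<And>x. x \<in> carrier M \<Longrightarrow> g (N +>\<^bsub>M\<^esub> x) = f x"
    by (rule quot_lift[OF P f]) (use ker in auto)
  have "inj_on g (carrier (quot_module M N))"
  proof (rule inj_onI)
    fix C D assume "C \<in> carrier (quot_module M N)" "D \<in> carrier (quot_module M N)" and eq: "g C = g D"
    then obtain x y where xy: "x \<in> carrier M" "C = N +>\<^bsub>M\<^esub> x" "y \<in> carrier M" "D = N +>\<^bsub>M\<^esub> y"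
      by (auto simp: quot_carrier)
    with eq g(2) have "f x = f y" by simp
    then have "f (x \<ominus>\<^bsub>M\<^esub> y) = \<zero>\<^bsub>P\<^esub>"
      using xy by simp
    then have "x \<ominus>\<^bsub>M\<^esub> y \<in> N"
      unfolding ker[symmetric] using xy by simp
    with xy show "C = D" by (simp add: coset_eq_iff)
  qed
  moreover have "g ` carrier (quot_module M N) = carrier P"
    unfolding quot_carrier surj[symmetric] image_image by (rule image_cong) (simp_all add: g)
  ultimately show ?thesis
    using g(1) unfolding module_isomorphic_def bij_betw_def by blast
qed

text \<open>Moves torsion of the quotient back to representatives, where it is the saturation of
  \<open>N\<close> with respect to \<open>I\<close>.\<close>

lemma torsion_quot:
  assumes "\<And>t. ideal_pow R I t \<subseteq> carrier R"
  shows "torsion R I (quot_module M N) =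
    {N +>\<^bsub>M\<^esub> x | x. x \<in> carrier M \<and> (\<exists>t. \<forall>b\<in>ideal_pow R I t. b \<odot>\<^bsub>M\<^esub> x \<in> N)}"
proof -
  have "b \<odot>\<^bsub>quot_module M N\<^esub> (N +>\<^bsub>M\<^esub> x) = \<zero>\<^bsub>quot_module M N\<^esub> \<longleftrightarrow> b \<odot>\<^bsub>M\<^esub> x \<in> N"
    if "b \<in> ideal_pow R I t" "x \<in> carrier M" for b x t
  proof -
    have "b \<in> carrier R" using that(1) assms by blast
    then show ?thesis using that(2) by (simp add: quot_smult quot_zero coset_eq_self_iff)
  qed
  then show ?thesis unfolding torsion_def quot_carrier by blast
qed

end

section \<open>Free modules, the ring as a module, and torsion submodules\<close>

lemma module_module_vec: "Module.module class_ring (module_vec TYPE('a::comm_ring_1) n)"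
proof -
  interpret vec_module "TYPE('a)" n .
  show ?thesis by (rule module_axioms)
qed

lemma module_ring_module: "Module.module (class_ring :: 'a::comm_ring_1 ring) (ring_module class_ring)"
proof (rule module_criteria)
  show "\<forall>v\<in>carrier (ring_module (class_ring :: 'a ring)). \<exists>w\<in>carrier (ring_module class_ring).
      v \<oplus>\<^bsub>ring_module class_ring\<^esub> w = \<zero>\<^bsub>ring_module class_ring\<^esub>"
  proof
    fix v :: 'a
    show "\<exists>w\<in>carrier (ring_module class_ring). v \<oplus>\<^bsub>ring_module class_ring\<^esub> w = \<zero>\<^bsub>ring_module class_ring\<^esub>"
      by (rule bexI[of _ "- v"]) (simp_all add: ring_module_def)
  qed
qed (auto simp: ring_module_def class_cring.is_cring algebra_simps)

text \<open>For a sum the exponents are added: the resulting power of \<open>I\<close> lies in both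
  given powers.\<close>

lemma torsion_submodule:
  assumes "Module.module (class_ring :: 'a::comm_ring_1 ring) M" and I: "ideal I class_ring"
  shows "LinearCombinations.submodule class_ring (torsion class_ring I M) M"
proof -
  interpret Module.module "class_ring :: 'a ring" M by fact
  show ?thesis
  proof (rule LinearCombinations.submodule.intro[OF assms(1)])
    show "torsion class_ring I M \<subseteq> carrier M" by (auto simp: torsion_def)
    show "\<zero>\<^bsub>M\<^esub> \<in> torsion class_ring I M" by (auto simp: torsion_def)
  next
    fix v w assume "v \<in> torsion class_ring I M" "w \<in> torsion class_ring I M"
    then obtain s t where v: "v \<in> carrier M" "\<forall>b\<in>ideal_pow class_ring I s. b \<odot>\<^bsub>M\<^esub> v = \<zero>\<^bsub>M\<^esub>"
      and w: "w \<in> carrier M" "\<forall>b\<in>ideal_pow class_ring I t. b \<odot>\<^bsub>M\<^esub> w = \<zero>\<^bsub>M\<^esub>"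
      by (auto simp: torsion_def)
    have "\<forall>b\<in>ideal_pow class_ring I (s + t). b \<odot>\<^bsub>M\<^esub> (v \<oplus>\<^bsub>M\<^esub> w) = \<zero>\<^bsub>M\<^esub>"
    proof
      fix b assume b: "b \<in> ideal_pow class_ring I (s + t)"
      then have "b \<in> ideal_pow class_ring I s" "b \<in> ideal_pow class_ring I t"
        using ideal_pow_add_subset[OF I, of s t] ideal_pow_add_subset[OF I, of t s]
        by (auto simp: add.commute)
      with v w show "b \<odot>\<^bsub>M\<^esub> (v \<oplus>\<^bsub>M\<^esub> w) = \<zero>\<^bsub>M\<^esub>"
        by (simp add: smult_r_distr)
    qed
    with v w show "v \<oplus>\<^bsub>M\<^esub> w \<in> torsion class_ring I M"
      unfolding torsion_def by blast
  next
    fix r v assume r: "r \<in> carrier (class_ring :: 'a ring)" and "v \<in> torsion class_ring I M"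
    then obtain s where v: "v \<in> carrier M" "\<forall>b\<in>ideal_pow class_ring I s. b \<odot>\<^bsub>M\<^esub> v = \<zero>\<^bsub>M\<^esub>"
      by (auto simp: torsion_def)
    have "\<forall>b\<in>ideal_pow class_ring I s. b \<odot>\<^bsub>M\<^esub> (r \<odot>\<^bsub>M\<^esub> v) = \<zero>\<^bsub>M\<^esub>"
    proof
      fix b assume "b \<in> ideal_pow class_ring I s"
      with v have "r \<odot>\<^bsub>M\<^esub> (b \<odot>\<^bsub>M\<^esub> v) = \<zero>\<^bsub>M\<^esub>"
        by (simp add: smult_r_null)
      moreover have "b \<odot>\<^bsub>M\<^esub> (r \<odot>\<^bsub>M\<^esub> v) = r \<odot>\<^bsub>M\<^esub> (b \<odot>\<^bsub>M\<^esub> v)"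
        using smult_assoc1[of b r v] smult_assoc1[of r b v] v by (simp add: mult.commute)
      ultimately show "b \<odot>\<^bsub>M\<^esub> (r \<odot>\<^bsub>M\<^esub> v) = \<zero>\<^bsub>M\<^esub>" by simp
    qed
    with v r show "r \<odot>\<^bsub>M\<^esub> v \<in> torsion class_ring I M"
      unfolding torsion_def by auto
  qed
qed

lemma ideal_submodule:
  fixes I :: "'a::comm_ring_1 set"
  assumes "ideal I class_ring"
  shows "LinearCombinations.submodule class_ring I (ring_module class_ring)"
  by (rule LinearCombinations.submodule.intro[OF module_ring_module])
    (simp_all add: ring_module_def ideal_class_ringD[OF assms])

lemma span_subset_submodule:
  assumes "LinearCombinations.submodule R N M" and "S \<subseteq> N"
  shows "LinearCombinations.module.span R M S \<subseteq> N"
  by (rule LinearCombinations.module.span_is_subset[OF LinearCombinations.submodule.module[OF assms(1)] assms(2,1)])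


section \<open>Matrices over a commutative ring\<close>

text \<open>The \<open>unit\<close> case concerns only the entries that \<open>v\<close> really has.
  This matters in \<open>ideal_times_module_vec\<close>, where just these entries are known to lie
  in the ideal. The proof restores \<open>v\<close> entry by entry from its truncations.\<close>

lemma vec_unit_induct [consumes 1, case_names zero add unit]:
  fixes v :: "'a::comm_ring_1 vec"
  assumes v: "v \<in> carrier_vec n" and zero: "P (0\<^sub>v n)"
    and add: "\<And>x y. x \<in> carrier_vec n \<Longrightarrow> y \<in> carrier_vec n \<Longrightarrow> P x \<Longrightarrow> P y \<Longrightarrow> P (x + y)"
    and unit: "\<And>j. j < n \<Longrightarrow> P (v $ j \<cdot>\<^sub>v unit_vec n j)"
  shows "P v"
proof -
  have "P (vec n (\<lambda>i. if i < k then v $ i else 0))" if "k \<le> n" for k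
    using that
  proof (induction k)
    case 0
    have "vec n (\<lambda>i. if i < 0 then v $ i else 0) = 0\<^sub>v n" by (intro eq_vecI) auto
    then show ?case using zero by simp
  next
    case (Suc k)
    have "vec n (\<lambda>i. if i < Suc k then v $ i else 0)
      = vec n (\<lambda>i. if i < k then v $ i else 0) + v $ k \<cdot>\<^sub>v unit_vec n k"
      by (intro eq_vecI) (auto simp: unit_vec_def less_Suc_eq)
    moreover have "P \<dots>"
      using Suc by (intro add unit) auto
    ultimately show ?case by simp
  qed
  from this[of n] have "P (vec n (\<lambda>i. if i < n then v $ i else 0))" by simp
  also have "vec n (\<lambda>i. if i < n then v $ i else 0) = v"
    using v by (intro eq_vecI) auto
  finally show ?thesis .
qed

lemma module_hom_unit_vec_cong:
  fixes M :: "('a::comm_ring_1, 'm, 'c) module_scheme"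
  assumes M: "Module.module class_ring M"
    and f: "f \<in> LinearCombinations.module_hom class_ring (module_vec TYPE('a) n) M"
    and g: "g \<in> LinearCombinations.module_hom class_ring (module_vec TYPE('a) n) M"
    and unit: "\<And>j. j < n \<Longrightarrow> f (unit_vec n j) = g (unit_vec n j)"
    and v: "v \<in> carrier_vec n"
  shows "f v = g v"
  using v
proof (induction v rule: vec_unit_induct)
  case zero
  interpret f: mod_hom "class_ring :: 'a ring" "module_vec TYPE('a) n" M f
    using M f module_module_vec by (simp add: mod_hom_def mod_hom_axioms_def)
  interpret g: mod_hom "class_ring :: 'a ring" "module_vec TYPE('a) n" M g
    using M g module_module_vec by (simp add: mod_hom_def mod_hom_axioms_def)
  show ?case using f.f0_is_0 g.f0_is_0 by (simp add: module_vec_simps)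
next
  case (add x y)
  then show ?case
    using LinearCombinations.module_hom_add[OF f, of x y] LinearCombinations.module_hom_add[OF g, of x y]
    by (simp add: module_vec_simps)
next
  case (unit j)
  then show ?case
    using LinearCombinations.module_hom_smult[OF f, of "v $ j" "unit_vec n j"]
      LinearCombinations.module_hom_smult[OF g, of "v $ j" "unit_vec n j"] assms(4)[of j]
    by (simp add: module_vec_simps)
qed

lemma mat_columns:
  fixes A :: "'a::comm_ring_1 mat"
  assumes "A \<in> carrier_mat r n" and "j < n"
  shows "A *\<^sub>v unit_vec n j = col A j"
  using assms by (intro eq_vecI) (auto simp: scalar_prod_right_unit)

text \<open>Free modules are projective: choose a preimage under \<open>D\<close> for each column of
  \<open>A\<close> and take these as the columns of \<open>B\<close>.\<close>

lemma mat_lift: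
  fixes A D :: "'a::comm_ring_1 mat"
  assumes D: "D \<in> carrier_mat r n" and A: "A \<in> carrier_mat r c"
    and im: "\<And>v. v \<in> carrier_vec c \<Longrightarrow> A *\<^sub>v v \<in> (\<lambda>w. D *\<^sub>v w) ` carrier_vec n"
  obtains B where "B \<in> carrier_mat n c" and "A = D * B"
proof -
  have "\<exists>w. w \<in> carrier_vec n \<and> col A j = D *\<^sub>v w" if "j < c" for j
    using im[of "unit_vec c j"] mat_columns[OF A that] by auto
  then obtain w where w: "\<And>j. j < c \<Longrightarrow> w j \<in> carrier_vec n" "\<And>j. j < c \<Longrightarrow> col A j = D *\<^sub>v w j"
    by metis
  define B where "B = mat n c (\<lambda>(i, j). w j $ i)"
  have B: "B \<in> carrier_mat n c" by (simp add: B_def)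
  have col: "col B j = w j" if "j < c" for j
    using w(1)[OF that] that by (intro eq_vecI) (auto simp: B_def)
  have "A = D * B"
  proof (rule eq_matI)
    fix i j assume "i < dim_row (D * B)" "j < dim_col (D * B)"
    then have ij: "i < r" "j < c" using D B by auto
    have "(D * B) $$ (i, j) = (D *\<^sub>v w j) $ i"
      using ij D B col by (simp add: scalar_prod_def)
    also have "\<dots> = A $$ (i, j)"
      using w(2)[OF ij(2), symmetric] ij A by simp
    finally show "A $$ (i, j) = (D * B) $$ (i, j)" by simp
  qed (use A B D in auto)
  with B show thesis by (rule that)
qed

lemma mat_mult_entries_left:
  fixes A B :: "'a::comm_ring_1 mat"
  assumes "ideal K class_ring" and "A \<in> carrier_mat r n" "B \<in> carrier_mat n c"
    and "\<And>i j. i < r \<Longrightarrow> j < n \<Longrightarrow> A $$ (i, j) \<in> K" and "i < r" "j < c"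
  shows "(A * B) $$ (i, j) \<in> K"
proof -
  have "(A * B) $$ (i, j) = (\<Sum>k = 0..<n. B $$ (k, j) * A $$ (i, k))"
    using assms by (simp add: scalar_prod_def mult.commute)
  also have "\<dots> \<in> K"
    using assms by (intro ideal_class_ringD(3,6)[OF assms(1)]) auto
  finally show ?thesis .
qed

lemma mat_mult_entries_right:
  fixes A B :: "'a::comm_ring_1 mat"
  assumes "ideal K class_ring" and "A \<in> carrier_mat r n" "B \<in> carrier_mat n c"
    and "\<And>i j. i < n \<Longrightarrow> j < c \<Longrightarrow> B $$ (i, j) \<in> K" and "i < r" "j < c"
  shows "(A * B) $$ (i, j) \<in> K"
proof -
  have "(A * B) $$ (i, j) = (\<Sum>k = 0..<n. A $$ (i, k) * B $$ (k, j))"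
    using assms by (simp add: scalar_prod_def)
  also have "\<dots> \<in> K"
    using assms by (intro ideal_class_ringD(3,6)[OF assms(1)]) auto
  finally show ?thesis .
qed

text \<open>Makes the minimality clause of a resolution a condition on the entries of the
  differentials.\<close>

lemma ideal_times_module_vec:
  fixes I :: "'a::comm_ring_1 set"
  assumes I: "ideal I class_ring"
  shows "ideal_times_module class_ring I (module_vec TYPE('a) n)
    = {v \<in> carrier_vec n. \<forall>j<n. v $ j \<in> I}" (is "?L = ?R")
proof
  let ?V = "module_vec TYPE('a) n"
  let ?G = "{a \<odot>\<^bsub>?V\<^esub> v | a v. a \<in> I \<and> v \<in> carrier ?V}"
  interpret V: Module.module "class_ring :: 'a ring" ?V by (rule module_module_vec)
  have "LinearCombinations.submodule class_ring ?R ?V"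
    by (rule LinearCombinations.submodule.intro[OF module_module_vec])
      (auto simp: module_vec_simps ideal_class_ringD[OF I])
  moreover have "?G \<subseteq> ?R"
    using ideal_class_ringD(3)[OF I] by (auto simp: module_vec_simps mult.commute)
  ultimately show "?L \<subseteq> ?R"
    unfolding ideal_times_module_def by (rule span_subset_submodule)
  have G: "?G \<subseteq> carrier ?V" by (auto simp: module_vec_simps)
  have sub: "LinearCombinations.submodule class_ring ?L ?V"
    unfolding ideal_times_module_def by (rule V.span_is_submodule[OF G])
  have in_L: "x \<in> ?L" if "x \<in> ?G" for x
    using V.in_own_span[OF G] that unfolding ideal_times_module_def by blast
  show "?R \<subseteq> ?L"
  proof
    fix v assume "v \<in> ?R"
    then have v: "v \<in> carrier_vec n" "\<And>j. j < n \<Longrightarrow> v $ j \<in> I" by auto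
    from v(1) show "v \<in> ?L"
    proof (induction v rule: vec_unit_induct)
      case zero
      then show ?case
        using LinearCombinations.submodule.zero_closed[OF sub] by (simp add: module_vec_simps)
    next
      case (add x y)
      then show ?case
        using LinearCombinations.submodule.m_closed[OF sub] by (simp add: module_vec_simps)
    next
      case (unit j)
      have "v $ j \<odot>\<^bsub>?V\<^esub> unit_vec n j \<in> ?L"
        using v(2)[OF unit]
        by (intro in_L CollectI exI[of _ "v $ j"] exI[of _ "unit_vec n j"] conjI refl)
          (simp_all add: module_vec_simps)
      then show ?case by (simp add: module_vec_simps)
    qed
  qed
qed


section \<open>Comparison of free resolutions\<close>

lemma is_complexD:
  assumes "is_complex F"
  shows "diff F (Suc i) \<in> carrier_mat (rk F i) (rk F (Suc i))"
    "diff F (Suc i) * diff F (Suc (Suc i)) = 0\<^sub>m (rk F i) (rk F (Suc (Suc i)))"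
  using assms by (auto simp: is_complex_def)

lemma boundaries_submodule:
  fixes F :: "'a::comm_ring_1 free_complex"
  assumes "is_complex F"
  shows "LinearCombinations.submodule class_ring (boundaries F i) (free_mod F i)"
proof -
  note D = is_complexD(1)[OF assms, of i]
  show ?thesis
  proof (rule LinearCombinations.submodule.intro)
    show "Module.module class_ring (free_mod F i)"
      unfolding free_mod_def by (rule module_module_vec)
    show "boundaries F i \<subseteq> carrier (free_mod F i)"
      using D by (auto simp: boundaries_def free_mod_def module_vec_simps)
    have "0\<^sub>v (rk F i) = diff F (Suc i) *\<^sub>v 0\<^sub>v (rk F (Suc i))"
      using D by auto
    then show "\<zero>\<^bsub>free_mod F i\<^esub> \<in> boundaries F i"
      unfolding boundaries_def free_mod_def module_vec_simps by (rule image_eqI) simp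
  next
    fix v w assume "v \<in> boundaries F i" "w \<in> boundaries F i"
    then obtain x y where "v = diff F (Suc i) *\<^sub>v x" "w = diff F (Suc i) *\<^sub>v y"
      and xy: "x \<in> carrier_vec (rk F (Suc i))" "y \<in> carrier_vec (rk F (Suc i))"
      by (auto simp: boundaries_def free_mod_def module_vec_simps)
    then have "v + w = diff F (Suc i) *\<^sub>v (x + y)"
      using mult_add_distrib_mat_vec[OF D] by simp
    with xy show "v \<oplus>\<^bsub>free_mod F i\<^esub> w \<in> boundaries F i"
      by (auto simp: boundaries_def free_mod_def module_vec_simps)
  next
    fix c v assume "v \<in> boundaries F i"
    then obtain x where "v = diff F (Suc i) *\<^sub>v x" and x: "x \<in> carrier_vec (rk F (Suc i))"
      by (auto simp: boundaries_def free_mod_def module_vec_simps)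
    then have "c \<cdot>\<^sub>v v = diff F (Suc i) *\<^sub>v (c \<cdot>\<^sub>v x)"
      using D by (intro eq_vecI) (auto simp: scalar_prod_smult_distrib)
    with x show "c \<odot>\<^bsub>free_mod F i\<^esub> v \<in> boundaries F i"
      by (auto simp: boundaries_def free_mod_def module_vec_simps)
  qed
qed

lemma boundaries_eq:
  "boundaries F i = (\<lambda>v. diff F (Suc i) *\<^sub>v v) ` carrier_vec (rk F (Suc i))"
  by (simp add: boundaries_def free_mod_def module_vec_simps)

lemma in_boundaries_SucI:
  assumes F: "is_complex F" and ex: "cycles F (Suc i) = boundaries F (Suc i)"
    and "v \<in> carrier_vec (rk F (Suc i))" and "diff F (Suc i) *\<^sub>v v = 0\<^sub>v (rk F i)"
  shows "v \<in> boundaries F (Suc i)"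
  using assms is_complexD(1)[OF F, of i]
  unfolding ex[symmetric] by (auto simp: cycles_def mat_kernel_def)

text \<open>Comparison theorem: \<open>F\<close> is free and \<open>G\<close> is exact, so the map
  can be lifted degree by degree. The invariant \<open>P\<close> includes that boundaries go to
  boundaries, which is what the next lift requires.\<close>

lemma comparison_map:
  fixes F G :: "'a::comm_ring_1 free_complex"
  assumes F: "is_complex F" and G: "is_complex G" and ex: "\<And>i. i > 0 \<Longrightarrow> cycles G i = boundaries G i"
    and f0: "f0 \<in> carrier_mat (rk G 0) (rk F 0)"
    and im: "\<And>v. v \<in> boundaries F 0 \<Longrightarrow> f0 *\<^sub>v v \<in> boundaries G 0"
  obtains f where "f 0 = f0" and "\<And>i. f i \<in> carrier_mat (rk G i) (rk F i)"
    and "\<And>i. f i * diff F (Suc i) = diff G (Suc i) * f (Suc i)"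
proof -
  define P where "P i A \<longleftrightarrow> A \<in> carrier_mat (rk G i) (rk F i) \<and> (i = 0 \<longrightarrow> A = f0) \<and>
    (\<forall>v\<in>boundaries F i. A *\<^sub>v v \<in> boundaries G i)" for i A
  have "\<exists>B. P (Suc i) B \<and> A * diff F (Suc i) = diff G (Suc i) * B" if A: "P i A" for i A
  proof -
    note d = is_complexD[OF F, of i] and d' = is_complexD(1)[OF F, of "Suc i"]
      and e = is_complexD(1)[OF G, of i]
    have A': "A \<in> carrier_mat (rk G i) (rk F i)" using A by (simp add: P_def)
    have "(A * diff F (Suc i)) *\<^sub>v v \<in> (\<lambda>w. diff G (Suc i) *\<^sub>v w) ` carrier_vec (rk G (Suc i))"
      if "v \<in> carrier_vec (rk F (Suc i))" for v
      using A that unfolding P_def boundaries_eq by (simp add: assoc_mult_mat_vec[OF A' d(1)])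
    then obtain B where B: "B \<in> carrier_mat (rk G (Suc i)) (rk F (Suc i))"
      and eq: "A * diff F (Suc i) = diff G (Suc i) * B"
      using mat_lift[OF e, of "A * diff F (Suc i)" "rk F (Suc i)"] A' d(1) by auto
    \<comment> \<open>\<open>B\<close> sends a boundary to a cycle because the square commutes and
      \<open>A\<close> maps 0 to 0; exactness of \<open>G\<close> makes this cycle a
      boundary.\<close>
    have "B *\<^sub>v v \<in> boundaries G (Suc i)" if v: "v \<in> boundaries F (Suc i)" for v
    proof (rule in_boundaries_SucI[OF G ex])
      from v obtain w where w: "w \<in> carrier_vec (rk F (Suc (Suc i)))" "v = diff F (Suc (Suc i)) *\<^sub>v w"
        by (auto simp: boundaries_eq)
      then have vc: "v \<in> carrier_vec (rk F (Suc i))" using d' by simp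
      then show "B *\<^sub>v v \<in> carrier_vec (rk G (Suc i))" using B by simp
      have "diff F (Suc i) *\<^sub>v v = 0\<^sub>m (rk F i) (rk F (Suc (Suc i))) *\<^sub>v w"
        unfolding w(2) d(2)[symmetric] by (rule assoc_mult_mat_vec[OF d(1) d' w(1), symmetric])
      also have "\<dots> = 0\<^sub>v (rk F i)" using w(1) by auto
      finally have 0: "diff F (Suc i) *\<^sub>v v = 0\<^sub>v (rk F i)" .
      have "diff G (Suc i) *\<^sub>v (B *\<^sub>v v) = (A * diff F (Suc i)) *\<^sub>v v"
        unfolding eq by (rule assoc_mult_mat_vec[OF e B vc, symmetric])
      also have "\<dots> = A *\<^sub>v 0\<^sub>v (rk F i)"
        unfolding 0[symmetric] by (rule assoc_mult_mat_vec[OF A' d(1) vc])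
      also have "\<dots> = 0\<^sub>v (rk G i)" using A' by auto
      finally show "diff G (Suc i) *\<^sub>v (B *\<^sub>v v) = 0\<^sub>v (rk G i)" .
    qed simp
    with B eq show ?thesis unfolding P_def by auto
  qed
  moreover have "P 0 f0"
    using f0 im by (simp add: P_def)
  ultimately obtain f where "\<And>i. P i (f i) \<and> f i * diff F (Suc i) = diff G (Suc i) * f (Suc i)"
    using dependent_nat_choice[of P "\<lambda>i A B. A * diff F (Suc i) = diff G (Suc i) * B"] by metis
  then show thesis
    by (intro that[of f]) (auto simp: P_def)
qed

lemma homotopy_to_identity:
  fixes F :: "'a::comm_ring_1 free_complex"
  assumes F: "is_complex F" and ex: "\<And>i. i > 0 \<Longrightarrow> cycles F i = boundaries F i"
    and u: "\<And>i. u i \<in> carrier_mat (rk F i) (rk F i)"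
      "\<And>i. u i * diff F (Suc i) = diff F (Suc i) * u (Suc i)"
    and im: "\<And>v. v \<in> carrier_vec (rk F 0) \<Longrightarrow> (u 0 - 1\<^sub>m (rk F 0)) *\<^sub>v v \<in> boundaries F 0"
  obtains h where "\<And>i. h i \<in> carrier_mat (rk F (Suc i)) (rk F i)"
    and "\<And>i. u (Suc i) - 1\<^sub>m (rk F (Suc i)) - h i * diff F (Suc i) = diff F (Suc (Suc i)) * h (Suc i)"
proof -
  \<comment> \<open>The homotopy equation in degree \<open>i\<close> equates
    \<open>u i - 1 - d * h\<close> with the previous homotopy followed by a differential. Only its
    composite with the next differential is recorded, which is zero: in this form the invariant
    mentions a single \<open>h\<close>, and dependent choice applies.\<close>
  define P where "P i h \<longleftrightarrow> h \<in> carrier_mat (rk F (Suc i)) (rk F i) \<and>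
    (u i - 1\<^sub>m (rk F i) - diff F (Suc i) * h) * diff F (Suc i) = 0\<^sub>m (rk F i) (rk F (Suc i))" for i h
  obtain h0 where h0: "h0 \<in> carrier_mat (rk F (Suc 0)) (rk F 0)" "u 0 - 1\<^sub>m (rk F 0) = diff F (Suc 0) * h0"
    by (rule mat_lift[OF is_complexD(1)[OF F, of 0] minus_carrier_mat[OF one_carrier_mat] im[unfolded boundaries_eq]])
  have "P 0 h0"
  proof -
    have 0: "diff F (Suc 0) * h0 - diff F (Suc 0) * h0 = 0\<^sub>m (rk F 0) (rk F 0)"
      using h0(1) is_complexD(1)[OF F, of 0] by (intro minus_r_inv_mat) auto
    show ?thesis
      using h0(1) is_complexD(1)[OF F, of 0] unfolding P_def h0(2) 0 by simp
  qed
  moreover have "\<exists>h'. P (Suc i) h' \<and>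
      u (Suc i) - 1\<^sub>m (rk F (Suc i)) - h * diff F (Suc i) = diff F (Suc (Suc i)) * h'"
    if h: "P i h" for i h
  proof -
    let ?r = "rk F i" and ?s = "rk F (Suc i)" and ?t = "rk F (Suc (Suc i))"
    let ?d = "diff F (Suc i)" and ?e = "diff F (Suc (Suc i))"
    let ?A = "u (Suc i) - 1\<^sub>m ?s - h * ?d"
    have d: "?d \<in> carrier_mat ?r ?s" and e: "?e \<in> carrier_mat ?s ?t" and de: "?d * ?e = 0\<^sub>m ?r ?t"
      using is_complexD[OF F] by auto
    have h': "h \<in> carrier_mat ?s ?r"
      and h0: "(u i - 1\<^sub>m ?r - ?d * h) * ?d = 0\<^sub>m ?r ?s"
      using h by (auto simp: P_def)
    note u' = u(1)[of i] u(1)[of "Suc i"]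
    have A: "?A \<in> carrier_mat ?s ?s" using u' h' d by auto
    have dist: "?d * (u (Suc i) - 1\<^sub>m ?s) = ?d * u (Suc i) - ?d * 1\<^sub>m ?s"
      "(u i - 1\<^sub>m ?r) * ?d = u i * ?d - 1\<^sub>m ?r * ?d"
      by (rule mult_minus_distrib_mat[OF d u'(2) one_carrier_mat], rule minus_mult_distrib_mat[OF u'(1) one_carrier_mat d])
    have "?d * ?A = ?d * (u (Suc i) - 1\<^sub>m ?s) - ?d * (h * ?d)"
      by (rule mult_minus_distrib_mat[of _ ?r ?s _ ?s]) (use u' h' d in auto)
    also have "\<dots> = (u i - 1\<^sub>m ?r) * ?d - (?d * h) * ?d"
      using u' h' d u(2)[of i] by (simp add: dist)
    also have "\<dots> = (u i - 1\<^sub>m ?r - ?d * h) * ?d"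
      by (rule minus_mult_distrib_mat[of _ ?r ?r _ _ ?s, symmetric]) (use u' h' d in auto)
    finally have dA: "?d * ?A = 0\<^sub>m ?r ?s" using h0 by simp
    have "?A *\<^sub>v v \<in> (\<lambda>w. ?e *\<^sub>v w) ` carrier_vec ?t" if v: "v \<in> carrier_vec ?s" for v
    proof -
      have "?A *\<^sub>v v \<in> boundaries F (Suc i)"
      proof (rule in_boundaries_SucI[OF F ex])
        show "?A *\<^sub>v v \<in> carrier_vec ?s" using A v by simp
        have "?d *\<^sub>v (?A *\<^sub>v v) = 0\<^sub>m ?r ?s *\<^sub>v v"
          unfolding dA[symmetric] by (rule assoc_mult_mat_vec[OF d A v, symmetric])
        then show "?d *\<^sub>v (?A *\<^sub>v v) = 0\<^sub>v ?r" using v by auto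
      qed simp
      then show ?thesis by (simp add: boundaries_eq)
    qed
    then obtain k where k: "k \<in> carrier_mat ?t ?s" and eq: "?A = ?e * k"
      using mat_lift[OF e A] by blast
    have "u (Suc i) - 1\<^sub>m ?s - ?e * k = h * ?d"
    proof -
      have "u (Suc i) - 1\<^sub>m ?s - ?A = h * ?d"
        using u' h' d by (intro eq_matI) auto
      then show ?thesis by (simp add: eq)
    qed
    moreover have "(h * ?d) * ?e = 0\<^sub>m ?s ?t"
      using de h' d e by simp
    ultimately have "P (Suc i) k"
      using k by (simp add: P_def)
    with eq show ?thesis by blast
  qed
  ultimately obtain h where "\<And>i. P i (h i) \<and>
      u (Suc i) - 1\<^sub>m (rk F (Suc i)) - h i * diff F (Suc i) = diff F (Suc (Suc i)) * h (Suc i)"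
    using dependent_nat_choice[of P "\<lambda>i h h'. u (Suc i) - 1\<^sub>m (rk F (Suc i)) - h * diff F (Suc i)
      = diff F (Suc (Suc i)) * h'"] by metis
  then show thesis
    by (intro that[of h]) (auto simp: P_def)
qed

text \<open>Modulo the ideal \<open>K\<close> a homotopy between the composite of two comparison maps and the
  identity vanishes, so that \<open>F\<^sub>i\<close> is a direct summand of \<open>G\<^sub>i\<close> there.\<close>

lemma minimal_rk_eq_0:
  fixes F G :: "'a::comm_ring_1 free_complex"
  assumes F: "is_complex F" and exF: "\<And>i. i > 0 \<Longrightarrow> cycles F i = boundaries F i"
    and G: "is_complex G" and exG: "\<And>i. i > 0 \<Longrightarrow> cycles G i = boundaries G i"
    and K: "ideal K class_ring" "1 \<notin> K"
    and min: "\<And>i j k. j < rk F i \<Longrightarrow> k < rk F (Suc i) \<Longrightarrow> diff F (Suc i) $$ (j, k) \<in> K"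
    and f0: "f0 \<in> carrier_mat (rk G 0) (rk F 0)" "\<And>v. v \<in> boundaries F 0 \<Longrightarrow> f0 *\<^sub>v v \<in> boundaries G 0"
    and g0: "g0 \<in> carrier_mat (rk F 0) (rk G 0)" "\<And>v. v \<in> boundaries G 0 \<Longrightarrow> g0 *\<^sub>v v \<in> boundaries F 0"
    and gf: "\<And>v. v \<in> carrier_vec (rk F 0) \<Longrightarrow> (g0 * f0 - 1\<^sub>m (rk F 0)) *\<^sub>v v \<in> boundaries F 0"
    and rk: "rk G (Suc n) = 0"
  shows "rk F (Suc n) = 0"
proof (rule ccontr)
  assume "rk F (Suc n) \<noteq> 0"
  then have pos: "0 < rk F (Suc n)" by simp
  obtain f where f: "f 0 = f0" "\<And>i. f i \<in> carrier_mat (rk G i) (rk F i)"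
    "\<And>i. f i * diff F (Suc i) = diff G (Suc i) * f (Suc i)"
    by (rule comparison_map[OF F G exG f0]) auto
  obtain g where g: "g 0 = g0" "\<And>i. g i \<in> carrier_mat (rk F i) (rk G i)"
    "\<And>i. g i * diff G (Suc i) = diff F (Suc i) * g (Suc i)"
    by (rule comparison_map[OF G F exF g0]) auto
  have "(g i * f i) * diff F (Suc i) = diff F (Suc i) * (g (Suc i) * f (Suc i))" for i
  proof -
    note d = is_complexD(1)[OF F, of i] and e = is_complexD(1)[OF G, of i]
    have "(g i * f i) * diff F (Suc i) = g i * (diff G (Suc i) * f (Suc i))"
      unfolding f(3)[symmetric] by (rule assoc_mult_mat[OF g(2) f(2) d])
    also have "\<dots> = diff F (Suc i) * g (Suc i) * f (Suc i)"
      unfolding g(3)[symmetric] by (rule assoc_mult_mat[OF g(2) e f(2), symmetric])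
    also have "\<dots> = diff F (Suc i) * (g (Suc i) * f (Suc i))"
      by (rule assoc_mult_mat[OF d g(2) f(2)])
    finally show ?thesis .
  qed
  moreover have "g i * f i \<in> carrier_mat (rk F i) (rk F i)" for i
    using f(2)[of i] g(2)[of i] by auto
  moreover have "(g 0 * f 0 - 1\<^sub>m (rk F 0)) *\<^sub>v v \<in> boundaries F 0" if "v \<in> carrier_vec (rk F 0)" for v
    using gf[OF that] by (simp add: f g)
  ultimately obtain h where h: "\<And>i. h i \<in> carrier_mat (rk F (Suc i)) (rk F i)"
    "\<And>i. g (Suc i) * f (Suc i) - 1\<^sub>m (rk F (Suc i)) - h i * diff F (Suc i) = diff F (Suc (Suc i)) * h (Suc i)"
    using homotopy_to_identity[OF F exF, of "\<lambda>i. g i * f i"] by metis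
  \<comment> \<open>The homotopy equation at the entry \<open>(0, 0)\<close>, which exists by
    \<open>pos\<close>. The entry \<open>?a\<close> is an empty sum because the product passes
    through the zero module \<open>G\<close> in degree \<open>Suc n\<close>, while \<open>?b\<close>
    and \<open>?c\<close> contain a differential of \<open>F\<close> as a factor and so lie in
    \<open>K\<close>. This puts 1 into \<open>K\<close>.\<close>
  let ?a = "(g (Suc n) * f (Suc n)) $$ (0, 0)" and ?b = "(h n * diff F (Suc n)) $$ (0, 0)"
    and ?c = "(diff F (Suc (Suc n)) * h (Suc n)) $$ (0, 0)"
  have "?a = 0"
    using pos f(2)[of "Suc n"] g(2)[of "Suc n"] rk by (simp add: scalar_prod_def)
  have "?a - 1 - ?b = ?c"
    unfolding h(2)[symmetric] using pos f(2)[of "Suc n"] g(2)[of "Suc n"] h(1)[of n] is_complexD(1)[OF F, of n]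
    by simp
  have "?b \<in> K"
    by (rule mat_mult_entries_right[OF K(1) h(1) is_complexD(1)[OF F] min pos pos])
  moreover have "?c \<in> K"
    by (rule mat_mult_entries_left[OF K(1) is_complexD(1)[OF F] h(1) min pos pos])
  ultimately have "- (?b + ?c) \<in> K"
    by (intro ideal_class_ringD(2,4)[OF K(1)])
  moreover have "1 = - (?b + ?c)"
    unfolding \<open>?a - 1 - ?b = ?c\<close>[symmetric] \<open>?a = 0\<close> by simp
  ultimately show False using K(2) by simp
qed


section \<open>Minimal free resolutions and virtual resolutions\<close>

text \<open>The start of the comparison: \<open>\<delta>\<close> is surjective and the source is
  free.\<close>

lemma augmentation_lift:
  fixes F G :: "'a::comm_ring_1 free_complex" and M :: "('a, 'm, 'c) module_scheme"
  assumes M: "Module.module class_ring M"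
    and \<epsilon>: "\<epsilon> \<in> LinearCombinations.module_hom class_ring (free_mod F 0) M"
    and \<delta>: "\<delta> \<in> LinearCombinations.module_hom class_ring (free_mod G 0) M"
    and surj: "\<delta> ` carrier (free_mod G 0) = carrier M"
  obtains A where "A \<in> carrier_mat (rk G 0) (rk F 0)"
    and "\<And>v. v \<in> carrier_vec (rk F 0) \<Longrightarrow> \<delta> (A *\<^sub>v v) = \<epsilon> v"
proof -
  let ?n = "rk F 0" and ?m = "rk G 0"
  \<comment> \<open>For \<open>j\<close> outside the range \<open>unit_vec ?n j\<close> is the zero
    vector and still in the carrier, so preimages can be chosen for all \<open>j\<close> at
    once.\<close>
  have "\<exists>w. w \<in> carrier_vec ?m \<and> \<delta> w = \<epsilon> (unit_vec ?n j)" for j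
  proof -
    have "\<epsilon> (unit_vec ?n j) \<in> carrier M"
      using LinearCombinations.module_hom_closed[OF \<epsilon>] by (auto simp: free_mod_def module_vec_simps)
    then show ?thesis
      unfolding surj[symmetric] by (auto simp: free_mod_def module_vec_simps)
  qed
  then obtain w where w: "\<And>j. w j \<in> carrier_vec ?m" "\<And>j. \<delta> (w j) = \<epsilon> (unit_vec ?n j)"
    by metis
  define A where "A = mat ?m ?n (\<lambda>(i, j). w j $ i)"
  have A: "A \<in> carrier_mat ?m ?n" by (simp add: A_def)
  have "\<delta> (A *\<^sub>v v) = \<epsilon> v" if v: "v \<in> carrier_vec ?n" for v
  proof (rule module_hom_unit_vec_cong[OF M _ _ _ v])
    show "\<epsilon> \<in> LinearCombinations.module_hom class_ring (module_vec TYPE('a) ?n) M"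
      using \<epsilon> by (simp add: free_mod_def)
    have smult: "A *\<^sub>v (c \<cdot>\<^sub>v x) = c \<cdot>\<^sub>v (A *\<^sub>v x)" if "x \<in> carrier_vec ?n" for c x
      using A that by (intro eq_vecI) (auto simp: scalar_prod_smult_distrib)
    show "(\<lambda>v. \<delta> (A *\<^sub>v v)) \<in> LinearCombinations.module_hom class_ring (module_vec TYPE('a) ?n) M"
      unfolding LinearCombinations.module_hom_def
    proof (intro CollectI conjI allI impI)
      show "(\<lambda>v. \<delta> (A *\<^sub>v v)) \<in> carrier (module_vec TYPE('a) ?n) \<rightarrow> carrier M"
        using LinearCombinations.module_hom_closed[OF \<delta>] A
        by (auto simp: free_mod_def module_vec_simps)
    next
      fix x y assume "x \<in> carrier (module_vec TYPE('a) ?n) \<and> y \<in> carrier (module_vec TYPE('a) ?n)"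
      then have xy: "x \<in> carrier_vec ?n" "y \<in> carrier_vec ?n" by (auto simp: module_vec_simps)
      then have "A *\<^sub>v x \<in> carrier_vec ?m" "A *\<^sub>v y \<in> carrier_vec ?m" using A by auto
      then show "\<delta> (A *\<^sub>v (x \<oplus>\<^bsub>module_vec TYPE('a) ?n\<^esub> y)) = \<delta> (A *\<^sub>v x) \<oplus>\<^bsub>M\<^esub> \<delta> (A *\<^sub>v y)"
        using LinearCombinations.module_hom_add[OF \<delta>, of "A *\<^sub>v x" "A *\<^sub>v y"]
        by (simp add: free_mod_def module_vec_simps mult_add_distrib_mat_vec[OF A xy])
    next
      fix c x assume "c \<in> carrier (class_ring :: 'a ring) \<and> x \<in> carrier (module_vec TYPE('a) ?n)"
      then have x: "x \<in> carrier_vec ?n" by (auto simp: module_vec_simps)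
      then have "A *\<^sub>v x \<in> carrier_vec ?m" using A by auto
      then show "\<delta> (A *\<^sub>v (c \<odot>\<^bsub>module_vec TYPE('a) ?n\<^esub> x)) = c \<odot>\<^bsub>M\<^esub> \<delta> (A *\<^sub>v x)"
        using LinearCombinations.module_hom_smult[OF \<delta>, of c "A *\<^sub>v x"]
        by (simp add: free_mod_def module_vec_simps smult[OF x])
    qed
    show "\<delta> (A *\<^sub>v unit_vec ?n j) = \<epsilon> (unit_vec ?n j)" if "j < ?n" for j
    proof -
      have "col A j = w j"
        using that w(1)[of j] by (intro eq_vecI) (auto simp: A_def)
      then show ?thesis by (simp add: mat_columns[OF A that] w(2))
    qed
  qed
  with A show thesis by (rule that)
qed

text \<open>The right-hand side is the kernel of taking the constant term. It does not contain 1,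
  and it serves as the ideal \<open>K\<close> of \<open>minimal_rk_eq_0\<close>.\<close>

lemma max_ideal_proper: "max_ideal \<subseteq> {p. subst (\<lambda>_. 0) p = 0}"
  unfolding max_ideal_def
  by (rule genideal_class_ring(3)) (auto simp: ideal_class_ring_iff subst_add subst_mult)

lemma ideal_max_ideal: "ideal max_ideal S_ring"
  unfolding max_ideal_def by (rule genideal_class_ring)

lemma minimal_free_resolutionE:
  assumes "minimal_free_resolution F M P"
  obtains \<epsilon> where "\<epsilon> \<in> LinearCombinations.module_hom S_ring (free_mod F 0) M"
    and "\<epsilon> ` carrier (free_mod F 0) = carrier M"
    and "{v \<in> carrier (free_mod F 0). \<epsilon> v = \<zero>\<^bsub>M\<^esub>} = boundaries F 0"
  using assms unfolding minimal_free_resolution_def by (elim conjE bexE exE) (rule that)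

text \<open>Lifting the identity of \<open>M\<close> both ways gives the comparison maps. Exchanging
  \<open>F\<close> and \<open>G\<close> turns an upper bound for the length into a lower
  one.\<close>

lemma minimal_free_resolution_rk_eq_0:
  fixes M :: "('k::field bipoly, 'm) module"
  assumes M: "Module.module S_ring M"
    and F: "minimal_free_resolution F M PF" and G: "minimal_free_resolution G M PG"
    and rk: "rk G (Suc n) = 0"
  shows "rk F (Suc n) = 0"
proof -
  interpret M: Module.module "S_ring :: 'k bipoly ring" M by (rule M)
  let ?K = "{p :: 'k bipoly. subst (\<lambda>_. 0) p = 0}"
  have cF: "is_complex F" and exF: "\<And>i. i > 0 \<Longrightarrow> cycles F i = boundaries F i"
    and minF: "\<And>i. boundaries F i \<subseteq> ideal_times_module S_ring max_ideal (free_mod F i)"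
    and cG: "is_complex G" and exG: "\<And>i. i > 0 \<Longrightarrow> cycles G i = boundaries G i"
    using F G unfolding minimal_free_resolution_def by auto
  obtain \<epsilon> where \<epsilon>: "\<epsilon> \<in> LinearCombinations.module_hom S_ring (free_mod F 0) M"
    "\<epsilon> ` carrier (free_mod F 0) = carrier M"
    "{v \<in> carrier (free_mod F 0). \<epsilon> v = \<zero>\<^bsub>M\<^esub>} = boundaries F 0"
    by (rule minimal_free_resolutionE[OF F])
  obtain \<delta> where \<delta>: "\<delta> \<in> LinearCombinations.module_hom S_ring (free_mod G 0) M"
    "\<delta> ` carrier (free_mod G 0) = carrier M"
    "{v \<in> carrier (free_mod G 0). \<delta> v = \<zero>\<^bsub>M\<^esub>} = boundaries G 0"
    by (rule minimal_free_resolutionE[OF G])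
  have kerF: "v \<in> boundaries F 0 \<longleftrightarrow> v \<in> carrier_vec (rk F 0) \<and> \<epsilon> v = \<zero>\<^bsub>M\<^esub>" for v
    unfolding \<epsilon>(3)[symmetric] by (simp add: free_mod_def module_vec_simps)
  have kerG: "v \<in> boundaries G 0 \<longleftrightarrow> v \<in> carrier_vec (rk G 0) \<and> \<delta> v = \<zero>\<^bsub>M\<^esub>" for v
    unfolding \<delta>(3)[symmetric] by (simp add: free_mod_def module_vec_simps)
  obtain f where f: "f \<in> carrier_mat (rk G 0) (rk F 0)"
    "\<And>v. v \<in> carrier_vec (rk F 0) \<Longrightarrow> \<delta> (f *\<^sub>v v) = \<epsilon> v"
    by (rule augmentation_lift[OF M \<epsilon>(1) \<delta>(1,2)]) (rule that)
  obtain g where g: "g \<in> carrier_mat (rk F 0) (rk G 0)"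
    "\<And>v. v \<in> carrier_vec (rk G 0) \<Longrightarrow> \<epsilon> (g *\<^sub>v v) = \<delta> v"
    by (rule augmentation_lift[OF M \<delta>(1) \<epsilon>(1,2)]) (rule that)
  show ?thesis
  proof (rule minimal_rk_eq_0[OF cF exF cG exG _ _ _ f(1) _ g(1) _ _ rk, of ?K])
    show "ideal ?K class_ring" by (auto simp: ideal_class_ring_iff subst_add subst_mult)
    show "1 \<notin> ?K" by simp
    show "diff F (Suc i) $$ (j, k) \<in> ?K" if "j < rk F i" "k < rk F (Suc i)" for i j k
    proof -
      note d = is_complexD(1)[OF cF, of i]
      have "diff F (Suc i) *\<^sub>v unit_vec (rk F (Suc i)) k \<in> boundaries F i"
        by (auto simp: boundaries_eq)
      then have "col (diff F (Suc i)) k \<in> ideal_times_module S_ring max_ideal (free_mod F i)"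
        using minF mat_columns[OF d that(2)] by auto
      then have "\<forall>j<rk F i. col (diff F (Suc i)) k $ j \<in> max_ideal"
        unfolding free_mod_def ideal_times_module_vec[OF ideal_max_ideal] by (rule CollectE) simp
      then have "diff F (Suc i) $$ (j, k) \<in> max_ideal"
        using d that by auto
      then show ?thesis
        by (rule subsetD[OF max_ideal_proper])
    qed
    show "f *\<^sub>v v \<in> boundaries G 0" if "v \<in> boundaries F 0" for v
      using that f unfolding kerF kerG by auto
    show "g *\<^sub>v v \<in> boundaries F 0" if "v \<in> boundaries G 0" for v
      using that g unfolding kerF kerG by auto
    \<comment> \<open>Both \<open>g * f\<close> and the identity lift the identity of
      \<open>M\<close>, so \<open>\<epsilon>\<close> kills their difference. The difference is
      rewritten as a sum with a multiple by \<open>- 1\<close>, since homomorphisms are given by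
      their behaviour on sums and multiples.\<close>
    show "(g * f - 1\<^sub>m (rk F 0)) *\<^sub>v v \<in> boundaries F 0" if v: "v \<in> carrier_vec (rk F 0)" for v
    proof -
      have fv: "f *\<^sub>v v \<in> carrier_vec (rk G 0)" using f v by simp
      have gfv: "g *\<^sub>v (f *\<^sub>v v) \<in> carrier_vec (rk F 0)" using g fv by simp
      have "(g * f - 1\<^sub>m (rk F 0)) *\<^sub>v v = (g * f) *\<^sub>v v - 1\<^sub>m (rk F 0) *\<^sub>v v"
        by (rule minus_mult_distrib_mat_vec[OF mult_carrier_mat[OF g(1) f(1)] one_carrier_mat v])
      also have "\<dots> = g *\<^sub>v (f *\<^sub>v v) + (- 1) \<cdot>\<^sub>v v"
        using assoc_mult_mat_vec[OF g(1) f(1) v] gfv v by (intro eq_vecI) auto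
      finally have eq: "(g * f - 1\<^sub>m (rk F 0)) *\<^sub>v v = g *\<^sub>v (f *\<^sub>v v) + (- 1) \<cdot>\<^sub>v v" .
      have \<epsilon>v: "\<epsilon> v \<in> carrier M"
        using LinearCombinations.module_hom_closed[OF \<epsilon>(1)] v
        by (auto simp: free_mod_def module_vec_simps)
      have "\<epsilon> (g *\<^sub>v (f *\<^sub>v v) + (- 1) \<cdot>\<^sub>v v) = \<epsilon> (g *\<^sub>v (f *\<^sub>v v)) \<oplus>\<^bsub>M\<^esub> (- 1) \<odot>\<^bsub>M\<^esub> \<epsilon> v"
        using LinearCombinations.module_hom_add[OF \<epsilon>(1), of "g *\<^sub>v (f *\<^sub>v v)" "(- 1) \<cdot>\<^sub>v v"]
          LinearCombinations.module_hom_smult[OF \<epsilon>(1), of "- 1" v] gfv v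
        by (simp add: free_mod_def module_vec_simps)
      also have "\<dots> = 1 \<odot>\<^bsub>M\<^esub> \<epsilon> v \<oplus>\<^bsub>M\<^esub> (- 1) \<odot>\<^bsub>M\<^esub> \<epsilon> v"
        using M.smult_one[OF \<epsilon>v] by (simp add: g(2)[OF fv] f(2)[OF v])
      also have "\<dots> = (1 + - 1) \<odot>\<^bsub>M\<^esub> \<epsilon> v"
        using M.smult_l_distr[of 1 "- 1" "\<epsilon> v"] \<epsilon>v by simp
      also have "\<dots> = \<zero>\<^bsub>M\<^esub>"
        using M.lmult_0[OF \<epsilon>v] by simp
      finally show ?thesis
        unfolding eq kerF using gfv v by simp
    qed
  qed
qed

text \<open>As 0 and 1 differ, a free module of positive rank contains a nonzero unit
  vector.\<close>

lemma has_length_iff: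
  fixes F :: "'a::comm_ring_1 free_complex"
  shows "has_length F l \<longleftrightarrow> rk F l \<noteq> 0 \<and> (\<forall>i>l. rk F i = 0)"
proof -
  have "carrier (free_mod F i) = {\<zero>\<^bsub>free_mod F i\<^esub>} \<longleftrightarrow> rk F i = 0" for i
  proof
    assume *: "carrier (free_mod F i) = {\<zero>\<^bsub>free_mod F i\<^esub>}"
    show "rk F i = 0"
    proof (rule ccontr)
      assume "rk F i \<noteq> 0"
      moreover have "unit_vec (rk F i) 0 = (0\<^sub>v (rk F i) :: 'a vec)"
      proof -
        have "unit_vec (rk F i) 0 \<in> carrier (free_mod F i)"
          by (simp add: free_mod_def module_vec_simps)
        then show ?thesis
          unfolding * by (simp add: free_mod_def module_vec_simps)
      qed
      ultimately have "unit_vec (rk F i) 0 $ 0 = (0 :: 'a)" by simp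
      with \<open>rk F i \<noteq> 0\<close> show False by simp
    qed
  qed (auto simp: free_mod_def module_vec_simps)
  then show ?thesis by (simp add: has_length_def)
qed

section \<open>Quotients of the coordinate ring, homology and virtual resolutions\<close>

lemma module_hom_comp:
  assumes "f \<in> LinearCombinations.module_hom R M N" and "g \<in> LinearCombinations.module_hom R N P"
  shows "(\<lambda>x. g (f x)) \<in> LinearCombinations.module_hom R M P"
  using assms by (auto simp: LinearCombinations.module_hom_def Pi_iff)

lemma quotient_module_S_mod_ideal:
  assumes "ideal J S_ring"
  shows "quotient_module S_ring (ring_module S_ring) J"
  using assms
  by (simp add: quotient_module_def quotient_module_axioms_def module_ring_module ideal_submodule)

lemma ring_module_simps [simp]:
  "carrier (ring_module R) = carrier R" "smult (ring_module R) = mult R"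
  by (simp_all add: ring_module_def)

lemma S_mod_ideal_simps:
  fixes J :: "'k::field bipoly set"
  assumes "ideal J S_ring"
  shows "carrier (S_mod_ideal J) = range (\<lambda>p. J +>\<^bsub>ring_module S_ring\<^esub> p)"
    "b \<odot>\<^bsub>S_mod_ideal J\<^esub> (J +>\<^bsub>ring_module S_ring\<^esub> p) = J +>\<^bsub>ring_module S_ring\<^esub> (b * p)"
    "J +>\<^bsub>ring_module S_ring\<^esub> p = \<zero>\<^bsub>S_mod_ideal J\<^esub> \<longleftrightarrow> p \<in> J"
proof -
  interpret Q: quotient_module "S_ring :: 'k bipoly ring" "ring_module S_ring" J
    by (rule quotient_module_S_mod_ideal[OF assms])
  show "carrier (S_mod_ideal J) = range (\<lambda>p. J +>\<^bsub>ring_module S_ring\<^esub> p)"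
    "b \<odot>\<^bsub>S_mod_ideal J\<^esub> (J +>\<^bsub>ring_module S_ring\<^esub> p) = J +>\<^bsub>ring_module S_ring\<^esub> (b * p)"
    "J +>\<^bsub>ring_module S_ring\<^esub> p = \<zero>\<^bsub>S_mod_ideal J\<^esub> \<longleftrightarrow> p \<in> J"
    unfolding S_mod_ideal_def
    using Q.quot_carrier Q.quot_smult[of b p] Q.quot_zero Q.coset_eq_self_iff[of p] by simp_all
qed

lemma fin_gen_S_mod_ideal:
  fixes J :: "'k::field bipoly set"
  assumes "ideal J S_ring"
  shows "fin_gen_module S_ring (S_mod_ideal J)"
proof -
  interpret Q: quotient_module "S_ring :: 'k bipoly ring" "ring_module S_ring" J
    by (rule quotient_module_S_mod_ideal[OF assms])
  let ?Q = "S_mod_ideal J" and ?R = "ring_module (S_ring :: 'k bipoly ring)"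
  let ?A = "{J +>\<^bsub>?R\<^esub> 1}"
  have M: "Module.module S_ring ?Q"
    unfolding S_mod_ideal_def by (rule Q.module_quot)
  have A: "?A \<subseteq> carrier ?Q"
    by (simp add: S_mod_ideal_simps[OF assms])
  note sub = LinearCombinations.module.span_is_submodule[OF M A]
  have "LinearCombinations.module.span S_ring ?Q ?A = carrier ?Q"
  proof
    show "LinearCombinations.module.span S_ring ?Q ?A \<subseteq> carrier ?Q"
      by (rule LinearCombinations.submodule.subset[OF sub])
    show "carrier ?Q \<subseteq> LinearCombinations.module.span S_ring ?Q ?A"
    proof
      fix x assume "x \<in> carrier ?Q"
      then obtain p where "x = J +>\<^bsub>?R\<^esub> p"
        unfolding S_mod_ideal_simps[OF assms] by blast
      then have "x = p \<odot>\<^bsub>?Q\<^esub> (J +>\<^bsub>?R\<^esub> 1)"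
        by (simp add: S_mod_ideal_simps[OF assms])
      moreover have "J +>\<^bsub>?R\<^esub> 1 \<in> LinearCombinations.module.span S_ring ?Q ?A"
        using LinearCombinations.module.in_own_span[OF M A] by blast
      ultimately show "x \<in> LinearCombinations.module.span S_ring ?Q ?A"
        using LinearCombinations.submodule.smult_closed[OF sub, of p] by simp
    qed
  qed
  with M A show ?thesis
    unfolding fin_gen_module_def by blast
qed

text \<open>The homology is here the quotient of a module by itself.\<close>

lemma homology_exact:
  fixes F :: "'a::comm_ring_1 free_complex"
  assumes cF: "is_complex F" and ex: "cycles F i = boundaries F i" and h: "h \<in> carrier (homology F i)"
  shows "b \<odot>\<^bsub>homology F i\<^esub> h = \<zero>\<^bsub>homology F i\<^esub>"
proof -
  note bd = boundaries_submodule[OF cF, of i]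
  let ?M = "(free_mod F i)\<lparr>carrier := cycles F i\<rparr>"
  have modM: "Module.module class_ring ?M"
    unfolding ex by (rule LinearCombinations.module.submodule_is_module[OF LinearCombinations.submodule.module[OF bd] bd])
  have "LinearCombinations.submodule class_ring (boundaries F i) ?M"
    by (rule LinearCombinations.submodule.intro[OF modM])
      (use LinearCombinations.submodule.m_closed[OF bd] LinearCombinations.submodule.zero_closed[OF bd]
        LinearCombinations.submodule.smult_closed[OF bd] in \<open>simp_all add: ex\<close>)
  then interpret H: quotient_module "class_ring :: 'a ring" ?M "boundaries F i"
    using modM by (simp add: quotient_module_def quotient_module_axioms_def)
  from h obtain x where x: "x \<in> carrier ?M" "h = boundaries F i +>\<^bsub>?M\<^esub> x"
    unfolding homology_def H.quot_carrier by blast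
  have bx: "b \<odot>\<^bsub>?M\<^esub> x \<in> carrier ?M" using H.smult_closed[OF _ x(1)] by simp
  have "b \<odot>\<^bsub>homology F i\<^esub> h = boundaries F i +>\<^bsub>?M\<^esub> (b \<odot>\<^bsub>?M\<^esub> x)"
    unfolding homology_def x(2) by (rule H.quot_smult[OF _ x(1)]) simp
  also have "\<dots> = boundaries F i"
    using bx H.coset_eq_self_iff[OF bx] by (simp add: ex)
  also have "\<dots> = \<zero>\<^bsub>homology F i\<^esub>"
    unfolding homology_def H.quot_zero ..
  finally show ?thesis .
qed

text \<open>The composite \<open>\<pi>\<close> from \<open>F_0\<close> over \<open>S/J\<close> and
  \<open>S/I\<close> to the quotient of \<open>S/I\<close> by its torsion is surjective. It factors
  through \<open>H_0\<close>, and the induced map has exactly the torsion of \<open>H_0\<close> as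
  kernel, because a multiple that lies in \<open>I\<close> is brought into \<open>J\<close> by a
  bounded power of the irrelevant ideal.\<close>

lemma minimal_free_resolution_virtual:
  fixes I J N :: "'k::field bipoly set"
  assumes F: "minimal_free_resolution F (S_mod_ideal J) P"
    and I: "ideal I S_ring" and N: "ideal N S_ring" and J_eq: "J = I \<inter> N"
    and pow: "ideal_pow S_ring irrelevant_ideal a \<subseteq> N"
  shows "virtual_resolution F (S_mod_ideal I)"
  unfolding virtual_resolution_def
proof (intro conjI allI impI)
  show "fin_gen_module S_ring (S_mod_ideal I)" by (rule fin_gen_S_mod_ideal[OF I])
  show cF: "is_complex F" using F by (simp add: minimal_free_resolution_def)
  fix i :: nat assume "i > 0"
  then have "cycles F i = boundaries F i" using F by (simp add: minimal_free_resolution_def)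
  from homology_exact[OF cF this]
  show "\<exists>t. \<forall>b\<in>ideal_pow S_ring irrelevant_ideal t. \<forall>h\<in>carrier (homology F i).
      b \<odot>\<^bsub>homology F i\<^esub> h = \<zero>\<^bsub>homology F i\<^esub>"
    by blast
next
  let ?S = "S_ring :: 'k bipoly ring" and ?R = "ring_module (S_ring :: 'k bipoly ring)"
  let ?B = "irrelevant_ideal :: 'k bipoly set"
  have cF: "is_complex F" using F by (simp add: minimal_free_resolution_def)
  have J: "ideal J S_ring" and sub: "J \<subseteq> I"
    unfolding J_eq using I N by (simp_all add: ring.i_intersect class_ring.ring_axioms)
  have B: "ideal ?B S_ring"
    unfolding irrelevant_ideal_def x_ideal_def y_ideal_def
    by (intro ring.i_intersect class_ring.ring_axioms genideal_class_ring(1))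
  interpret SI: quotient_module ?S ?R I by (rule quotient_module_S_mod_ideal[OF I])
  interpret SJ: quotient_module ?S ?R J by (rule quotient_module_S_mod_ideal[OF J])
  let ?Q = "S_mod_ideal I" and ?Q' = "S_mod_ideal J"
  let ?T = "torsion S_ring ?B ?Q"
  have modQ: "Module.module ?S ?Q"
    unfolding S_mod_ideal_def by (rule SI.module_quot)
  interpret T: quotient_module ?S ?Q ?T
    using modQ torsion_submodule[OF modQ B] by (simp add: quotient_module_def quotient_module_axioms_def)
  note bd = boundaries_submodule[OF cF, of 0]
  interpret H: quotient_module ?S "free_mod F 0" "boundaries F 0"
    using bd LinearCombinations.submodule.module[OF bd]
    by (simp add: quotient_module_def quotient_module_axioms_def)
  have H0: "homology F 0 = quot_module (free_mod F 0) (boundaries F 0)"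
    by (simp add: homology_def cycles_def)
  obtain \<epsilon> where \<epsilon>: "\<epsilon> \<in> LinearCombinations.module_hom S_ring (free_mod F 0) ?Q'"
    "\<epsilon> ` carrier (free_mod F 0) = carrier ?Q'"
    "{v \<in> carrier (free_mod F 0). \<epsilon> v = \<zero>\<^bsub>?Q'\<^esub>} = boundaries F 0"
    by (rule minimal_free_resolutionE[OF F])
  have zeroI: "I +>\<^bsub>?R\<^esub> p = \<zero>\<^bsub>?Q\<^esub>" if "p \<in> J" for p
    using that sub by (simp add: S_mod_ideal_simps[OF I] subset_iff)
  obtain \<theta> where \<theta>: "\<theta> \<in> LinearCombinations.module_hom ?S ?Q' ?Q"
    "\<And>p. p \<in> carrier ?R \<Longrightarrow> \<theta> (J +>\<^bsub>?R\<^esub> p) = I +>\<^bsub>?R\<^esub> p"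
    by (rule SJ.quot_lift[OF modQ SI.quot_hom[folded S_mod_ideal_def] zeroI, folded S_mod_ideal_def]) (auto intro: that)
  have T_iff: "?T +>\<^bsub>?Q\<^esub> (I +>\<^bsub>?R\<^esub> p) = ?T \<longleftrightarrow> (\<exists>t. \<forall>b\<in>ideal_pow ?S ?B t. b * p \<in> J)" for p
  proof -
    have pQ: "I +>\<^bsub>?R\<^esub> p \<in> carrier ?Q"
      by (simp add: S_mod_ideal_simps[OF I])
    have "?T +>\<^bsub>?Q\<^esub> (I +>\<^bsub>?R\<^esub> p) = ?T \<longleftrightarrow> I +>\<^bsub>?R\<^esub> p \<in> ?T"
      by (rule T.coset_eq_self_iff[OF pQ])
    also have "\<dots> \<longleftrightarrow> (\<exists>t. \<forall>b\<in>ideal_pow ?S ?B t. b \<odot>\<^bsub>?Q\<^esub> (I +>\<^bsub>?R\<^esub> p) = \<zero>\<^bsub>?Q\<^esub>)"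
      unfolding torsion_def using pQ by blast
    also have "\<dots> \<longleftrightarrow> (\<exists>t. \<forall>b\<in>ideal_pow ?S ?B t. b * p \<in> I)"
      by (simp add: S_mod_ideal_simps[OF I])
    also have "\<dots> \<longleftrightarrow> (\<exists>t. \<forall>b\<in>ideal_pow ?S ?B t. b * p \<in> J)"
    proof
      assume "\<exists>t. \<forall>b\<in>ideal_pow ?S ?B t. b * p \<in> I"
      then obtain t where t: "\<forall>b\<in>ideal_pow ?S ?B t. b * p \<in> I" by blast
      \<comment> \<open>The power with exponent \<open>t + a\<close> is contained in the one with
        exponent \<open>t\<close>, which multiplies \<open>p\<close> into \<open>I\<close>, and in
        the one with exponent \<open>a\<close>, which lies in \<open>N\<close> by
        \<open>pow\<close>.\<close>
      have "b * p \<in> J" if b: "b \<in> ideal_pow ?S ?B (t + a)" for b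
      proof -
        have "b \<in> ideal_pow ?S ?B t" "b \<in> ideal_pow ?S ?B a"
          using b ideal_pow_add_subset[OF B, of t a] ideal_pow_add_subset[OF B, of a t]
          by (auto simp: add.commute)
        then show ?thesis
          using t pow ideal_class_ringD(3)[OF N, of b p] by (auto simp: J_eq mult.commute)
      qed
      then show "\<exists>t. \<forall>b\<in>ideal_pow ?S ?B t. b * p \<in> J"
        by blast
    qed (use sub in blast)
    finally show ?thesis .
  qed
  let ?Q2 = "quot_module ?Q ?T" and ?H = "homology F 0"
  define \<pi> where "\<pi> v = ?T +>\<^bsub>?Q\<^esub> \<theta> (\<epsilon> v)" for v
  have \<pi>: "\<pi> \<in> LinearCombinations.module_hom ?S (free_mod F 0) ?Q2"
    unfolding \<pi>_def by (rule module_hom_comp[OF module_hom_comp[OF \<epsilon>(1) \<theta>(1)] T.quot_hom])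
  have repr: "\<exists>p. \<epsilon> v = J +>\<^bsub>?R\<^esub> p" if "v \<in> carrier (free_mod F 0)" for v
    using funcset_mem[OF LinearCombinations.module_hom_closed[OF \<epsilon>(1)] that]
    unfolding S_mod_ideal_simps[OF J] by blast
  have \<pi>_eq: "\<pi> v = ?T +>\<^bsub>?Q\<^esub> (I +>\<^bsub>?R\<^esub> p)" if "\<epsilon> v = J +>\<^bsub>?R\<^esub> p" for v p
    using \<theta>(2)[of p] by (simp add: \<pi>_def that)
  \<comment> \<open>The kernel of \<open>\<pi>\<close> in terms of \<open>F_0\<close> alone. It is
    the same condition by which \<open>torsion_quot\<close> describes the torsion of
    \<open>H_0\<close>.\<close>
  have \<pi>_0: "\<pi> v = ?T \<longleftrightarrow> (\<exists>t. \<forall>b\<in>ideal_pow ?S ?B t. b \<odot>\<^bsub>free_mod F 0\<^esub> v \<in> boundaries F 0)"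
    if v: "v \<in> carrier (free_mod F 0)" for v
  proof -
    obtain p where p: "\<epsilon> v = J +>\<^bsub>?R\<^esub> p" using repr[OF v] by blast
    have "b \<odot>\<^bsub>free_mod F 0\<^esub> v \<in> boundaries F 0 \<longleftrightarrow> b * p \<in> J" for b
    proof -
      have "b \<odot>\<^bsub>free_mod F 0\<^esub> v \<in> carrier (free_mod F 0)"
        using H.smult_closed[of b v] v by simp
      then have "b \<odot>\<^bsub>free_mod F 0\<^esub> v \<in> boundaries F 0 \<longleftrightarrow> \<epsilon> (b \<odot>\<^bsub>free_mod F 0\<^esub> v) = \<zero>\<^bsub>?Q'\<^esub>"
        unfolding \<epsilon>(3)[symmetric] by blast
      also have "\<epsilon> (b \<odot>\<^bsub>free_mod F 0\<^esub> v) = b \<odot>\<^bsub>?Q'\<^esub> \<epsilon> v"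
        using LinearCombinations.module_hom_smult[OF \<epsilon>(1), of b v] v by simp
      also have "\<dots> = J +>\<^bsub>?R\<^esub> (b * p)"
        by (simp add: p S_mod_ideal_simps[OF J])
      also have "\<dots> = \<zero>\<^bsub>?Q'\<^esub> \<longleftrightarrow> b * p \<in> J"
        by (rule S_mod_ideal_simps[OF J])
      finally show ?thesis .
    qed
    then show ?thesis unfolding \<pi>_eq[OF p] T_iff by simp
  qed
  have \<pi>_bd: "\<pi> v = \<zero>\<^bsub>?Q2\<^esub>" if v: "v \<in> boundaries F 0" for v
  proof -
    have "v \<in> carrier (free_mod F 0)" using H.subset v by blast
    moreover have "b \<odot>\<^bsub>free_mod F 0\<^esub> v \<in> boundaries F 0" for b
      using LinearCombinations.submodule.smult_closed[OF bd, of b v] v by simp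
    ultimately show ?thesis by (simp add: \<pi>_0 T.quot_zero)
  qed
  obtain \<rho> where \<rho>: "\<rho> \<in> LinearCombinations.module_hom ?S ?H ?Q2"
    "\<And>v. v \<in> carrier (free_mod F 0) \<Longrightarrow> \<rho> (boundaries F 0 +>\<^bsub>free_mod F 0\<^esub> v) = \<pi> v"
    by (rule H.quot_lift[OF T.module_quot \<pi> \<pi>_bd, folded H0]) (auto intro: that)
  have carH: "carrier ?H = (\<lambda>v. boundaries F 0 +>\<^bsub>free_mod F 0\<^esub> v) ` carrier (free_mod F 0)"
    unfolding H0 by (rule H.quot_carrier)
  have surj: "\<rho> ` carrier ?H = carrier ?Q2"
  proof
    show "\<rho> ` carrier ?H \<subseteq> carrier ?Q2"
      using LinearCombinations.module_hom_closed[OF \<rho>(1)] by blast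
    show "carrier ?Q2 \<subseteq> \<rho> ` carrier ?H"
    proof
      fix x assume "x \<in> carrier ?Q2"
      then obtain p where p: "x = ?T +>\<^bsub>?Q\<^esub> (I +>\<^bsub>?R\<^esub> p)"
        unfolding T.quot_carrier S_mod_ideal_simps[OF I] by auto
      have "J +>\<^bsub>?R\<^esub> p \<in> carrier ?Q'"
        by (simp add: S_mod_ideal_simps[OF J])
      then obtain v where v: "v \<in> carrier (free_mod F 0)" "\<epsilon> v = J +>\<^bsub>?R\<^esub> p"
        unfolding \<epsilon>(2)[symmetric] by auto
      then have "x = \<rho> (boundaries F 0 +>\<^bsub>free_mod F 0\<^esub> v)"
        by (simp add: p \<rho>(2) \<pi>_eq)
      then show "x \<in> \<rho> ` carrier ?H"
        using v(1) unfolding carH by blast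
    qed
  qed
  have ker: "{c \<in> carrier ?H. \<rho> c = \<zero>\<^bsub>?Q2\<^esub>} = torsion ?S ?B ?H"
  proof -
    have tors: "torsion ?S ?B ?H = {boundaries F 0 +>\<^bsub>free_mod F 0\<^esub> v | v. v \<in> carrier (free_mod F 0) \<and>
        (\<exists>t. \<forall>b\<in>ideal_pow ?S ?B t. b \<odot>\<^bsub>free_mod F 0\<^esub> v \<in> boundaries F 0)}"
      unfolding H0 by (rule H.torsion_quot) simp
    have image: "{c \<in> f ` A. Q c} = {f v | v. v \<in> A \<and> P v}" if "\<And>v. v \<in> A \<Longrightarrow> Q (f v) \<longleftrightarrow> P v"
      for f :: "'k bipoly vec \<Rightarrow> 'k bipoly vec set" and A P Q
      using that by auto
    show ?thesis
      unfolding tors carH T.quot_zero by (rule image) (simp only: \<rho>(2) \<pi>_0)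
  qed
  have modH: "Module.module ?S ?H"
    unfolding H0 by (rule H.module_quot)
  interpret TH: quotient_module ?S ?H "torsion ?S ?B ?H"
    using modH torsion_submodule[OF modH B] by (simp add: quotient_module_def quotient_module_axioms_def)
  show "module_isomorphic S_ring
      (quot_module (homology F 0) (torsion S_ring irrelevant_ideal (homology F 0)))
      (quot_module (S_mod_ideal I) (torsion S_ring irrelevant_ideal (S_mod_ideal I)))"
    by (rule TH.quot_isomorphic[OF T.module_quot \<rho>(1) surj ker])
qed


section \<open>An explicit resolution of length two\<close>

definition hb_gen :: "nat \<Rightarrow> (nat \<Rightarrow> 'a::comm_ring_1) \<Rightarrow> (nat \<Rightarrow> 'a) \<Rightarrow> nat \<Rightarrow> 'a" where
  "hb_gen n l b i = (if i < n then b i * (\<Prod>j\<in>{..<n} - {i}. l j) else (\<Prod>j<n. l j))"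

text \<open>The generators \<open>hb_gen n l b i\<close> are, up to sign, the maximal minors of the matrix of the
  second differential (Hilbert--Burch).\<close>

definition hb_complex :: "nat \<Rightarrow> (nat \<Rightarrow> 'a::comm_ring_1) \<Rightarrow> (nat \<Rightarrow> 'a) \<Rightarrow> 'a free_complex" where
  "hb_complex n l b =
    (let r = (\<lambda>i. if i = 0 then 1 else if i = 1 then Suc n else if i = 2 then n else 0) in
     \<lparr>rk = r,
      diff = (\<lambda>i. if i = 1 then mat 1 (Suc n) (\<lambda>(_, j). hb_gen n l b j)
        else if i = 2 then mat (Suc n) n (\<lambda>(i, j). if i = n then - b j else if i = j then l j else 0)
        else 0\<^sub>m (r (i - 1)) (r i))\<rparr>)"

lemma hb_complex_rk [simp]:
  "rk (hb_complex n l b) 0 = 1" "rk (hb_complex n l b) (Suc 0) = Suc n"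
  "rk (hb_complex n l b) (Suc (Suc 0)) = n" "rk (hb_complex n l b) (Suc (Suc (Suc i))) = 0"
  by (simp_all add: hb_complex_def Let_def)

lemma hb_complex_carrier:
  "diff (hb_complex n l b) (Suc i) \<in> carrier_mat (rk (hb_complex n l b) i) (rk (hb_complex n l b) (Suc i))"
  by (auto simp: hb_complex_def Let_def)

lemma hb_complex_diff_1:
  assumes "v \<in> carrier_vec (Suc n)"
  shows "diff (hb_complex n l b) (Suc 0) *\<^sub>v v = vec 1 (\<lambda>_. \<Sum>i\<le>n. hb_gen n l b i * v $ i)"
  using assms
  by (intro eq_vecI) (auto simp: hb_complex_def Let_def scalar_prod_def atLeast0LessThan lessThan_Suc_atMost)

text \<open>Column \<open>j\<close> of the matrix is the relation between the generators with index
  \<open>j\<close> and \<open>n\<close>: \<open>l j\<close> times the former equals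
  \<open>b j\<close> times the latter.\<close>

lemma hb_complex_diff_2:
  fixes l b :: "nat \<Rightarrow> 'a::comm_ring_1"
  assumes "v \<in> carrier_vec n"
  shows "diff (hb_complex n l b) (Suc (Suc 0)) *\<^sub>v v
    = vec (Suc n) (\<lambda>i. if i = n then - (\<Sum>j<n. b j * v $ j) else l i * v $ i)"
proof (rule eq_vecI)
  fix i assume "i < dim_vec (vec (Suc n) (\<lambda>i. if i = n then - (\<Sum>j<n. b j * v $ j) else l i * v $ i))"
  then have i: "i < Suc n" by simp
  have "(diff (hb_complex n l b) (Suc (Suc 0)) *\<^sub>v v) $ i
    = (\<Sum>j<n. (if i = n then - b j else if i = j then l j else 0) * v $ j)"
    using assms i by (simp add: hb_complex_def Let_def scalar_prod_def atLeast0LessThan)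
  also have "\<dots> = (if i = n then - (\<Sum>j<n. b j * v $ j) else l i * v $ i)"
    using i by (simp add: sum_negf if_distrib[of "\<lambda>x. x * _"] sum.delta' cong: if_cong)
  finally show "(diff (hb_complex n l b) (Suc (Suc 0)) *\<^sub>v v) $ i
    = vec (Suc n) (\<lambda>i. if i = n then - (\<Sum>j<n. b j * v $ j) else l i * v $ i) $ i"
    using i by simp
qed (simp add: hb_complex_def Let_def)

lemma sum_hb_gen:
  "(\<Sum>i\<le>n. hb_gen n l b i * c i)
    = (\<Sum>i<n. (b i * (\<Prod>j\<in>{..<n} - {i}. l j)) * c i) + (\<Prod>j<n. l j) * c n"
  by (simp add: hb_gen_def lessThan_Suc_atMost[symmetric])

lemma is_complex_hb_complex: "is_complex (hb_complex n l b)" (is "is_complex ?F")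
  unfolding is_complex_def
proof (intro conjI allI)
  show "diff ?F (Suc i) \<in> carrier_mat (rk ?F i) (rk ?F (Suc i))" for i
    by (rule hb_complex_carrier)
  show "diff ?F (Suc i) * diff ?F (Suc (Suc i)) = 0\<^sub>m (rk ?F i) (rk ?F (Suc (Suc i)))" for i
  proof (cases i)
    case 0
    have "diff ?F (Suc 0) * diff ?F (Suc (Suc 0)) = 0\<^sub>m 1 n"
    proof (rule eq_matI)
      fix k j assume "k < dim_row (0\<^sub>m 1 n :: 'a mat)" "j < dim_col (0\<^sub>m 1 n :: 'a mat)"
      then have k: "k = 0" and j: "j < n" by auto
      have "(diff ?F (Suc 0) * diff ?F (Suc (Suc 0))) $$ (0, j)
        = (\<Sum>i\<le>n. hb_gen n l b i * (if i = n then - b j else if i = j then l j else 0))"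
        using j by (simp add: hb_complex_def Let_def scalar_prod_def atLeast0LessThan lessThan_Suc_atMost)
      also have "\<dots> = b j * (\<Prod>i\<in>{..<n} - {j}. l i) * l j - (\<Prod>i<n. l i) * b j"
        using j unfolding sum_hb_gen
        by (simp add: if_distrib[of "\<lambda>x. _ * x"] sum.delta cong: if_cong)
      also have "\<dots> = 0"
        using j by (simp add: prod.remove[of "{..<n}" j] algebra_simps)
      finally show "(diff ?F (Suc 0) * diff ?F (Suc (Suc 0))) $$ (k, j) = 0\<^sub>m 1 n $$ (k, j)"
        using k j by simp
    qed (use hb_complex_carrier[of n l b 0] hb_complex_carrier[of n l b 1] in auto)
    then show ?thesis by (simp add: 0)
  next
    case (Suc j)
    then show ?thesis
      using hb_complex_carrier[of n l b i] hb_complex_carrier[of n l b "Suc i"]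
      by (intro eq_matI) auto
  qed
qed

lemma boundaries_0_hb_complex:
  "boundaries (hb_complex n l b) 0
    = {v \<in> carrier_vec 1. \<exists>c. v $ 0 = (\<Sum>i\<le>n. hb_gen n l b i * c i)}" (is "?L = ?R")
proof
  show "?L \<subseteq> ?R"
    by (auto simp: boundaries_eq hb_complex_diff_1)
  show "?R \<subseteq> ?L"
  proof
    fix v assume "v \<in> ?R"
    then obtain c where v: "v \<in> carrier_vec 1" "v $ 0 = (\<Sum>i\<le>n. hb_gen n l b i * c i)" by blast
    have "v = diff (hb_complex n l b) (Suc 0) *\<^sub>v vec (Suc n) c"
      using v by (intro eq_vecI) (auto simp: hb_complex_diff_1)
    then show "v \<in> ?L"
      unfolding boundaries_eq by (rule image_eqI) simp
  qed
qed

lemma boundaries_hb_complex_trivial: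
  fixes l b :: "nat \<Rightarrow> 'a::comm_ring_1"
  shows "boundaries (hb_complex n l b) (Suc (Suc i)) = {0\<^sub>v (rk (hb_complex n l b) (Suc (Suc i)))}"
proof -
  let ?z = "0\<^sub>v (rk (hb_complex n l b) (Suc (Suc i)))"
  have "(\<lambda>v. diff (hb_complex n l b) (Suc (Suc (Suc i))) *\<^sub>v v) ` carrier_vec 0
      = (\<lambda>_. ?z) ` (carrier_vec 0 :: 'a vec set)"
    using hb_complex_carrier[of n l b "Suc (Suc i)"]
    by (intro image_cong eq_vecI) (auto simp: scalar_prod_def)
  also have "\<dots> = {?z}"
    by (rule image_constant) (rule zero_carrier_vec)
  finally show ?thesis
    unfolding boundaries_eq hb_complex_rk(4) .
qed

lemma prime_elem_dvd_prod:
  assumes "prime_elem p" and "finite A" and "p dvd prod f A"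
  shows "\<exists>i\<in>A. p dvd f i"
  using assms(2,3)
proof (induction A)
  case empty
  then show ?case using assms(1) by (simp add: prime_elem_def)
next
  case (insert i A)
  then show ?case using prime_elem_dvd_multD[OF assms(1), of "f i" "prod f A"] by auto
qed

text \<open>In degree 1, a syzygy taken modulo \<open>l k\<close> retains only the summand with
  index \<open>k\<close>. The prime \<open>l k\<close> divides neither \<open>b k\<close> nor any
  other \<open>l j\<close>, so it divides \<open>v $ k\<close>. The quotients form a vector
  \<open>u\<close>, and cancelling the product of all \<open>l j\<close> shows that the last entry
  of \<open>v\<close> is the one prescribed by \<open>u\<close>. In degree 2 the matrix is injective
  because of its nonzero diagonal.\<close>

lemma hb_complex_exact:
  fixes l b :: "nat \<Rightarrow> 'a::idom"
  assumes prime: "\<And>i. i < n \<Longrightarrow> prime_elem (l i)"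
    and l: "\<And>i j. i < n \<Longrightarrow> j < n \<Longrightarrow> i \<noteq> j \<Longrightarrow> \<not> l i dvd l j"
    and b: "\<And>i. i < n \<Longrightarrow> \<not> l i dvd b i"
    and i: "i > 0"
  shows "cycles (hb_complex n l b) i = boundaries (hb_complex n l b) i"
proof -
  let ?F = "hb_complex n l b"
  have sub: "boundaries ?F i \<subseteq> cycles ?F i"
  proof
    fix v assume "v \<in> boundaries ?F i"
    then obtain w where w: "w \<in> carrier_vec (rk ?F (Suc i))" "v = diff ?F (Suc i) *\<^sub>v w"
      by (auto simp: boundaries_eq)
    obtain k where k: "i = Suc k" using i by (cases i) auto
    note d = is_complexD(1)[OF is_complex_hb_complex, of n l b]
    have "diff ?F i *\<^sub>v v = (diff ?F i * diff ?F (Suc i)) *\<^sub>v w"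
      unfolding w(2) k by (rule assoc_mult_mat_vec[OF d d w(1)[unfolded k], symmetric])
    also have "\<dots> = 0\<^sub>v (rk ?F k)"
      unfolding k is_complexD(2)[OF is_complex_hb_complex] using w(1) k by (intro eq_vecI) auto
    finally show "v \<in> cycles ?F i"
      using d[of k] d[of i] w k by (auto simp: cycles_def mat_kernel_def)
  qed
  have cyc: "v \<in> carrier_vec (rk ?F i)" "diff ?F i *\<^sub>v v = 0\<^sub>v (rk ?F (i - 1))" if "v \<in> cycles ?F i" for v
    using that i hb_complex_carrier[of n l b "i - 1"] by (auto simp: cycles_def mat_kernel_def)
  have nz: "l j \<noteq> 0" if "j < n" for j
    using prime[OF that] by (simp add: prime_elem_def)
  consider "i = Suc 0" | "i = Suc (Suc 0)" | k where "i = Suc (Suc (Suc k))"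
    using i by (metis gr0_implies_Suc not0_implies_Suc)
  then have "cycles ?F i \<subseteq> boundaries ?F i"
  proof cases
    case 1
    show ?thesis
    proof
      fix v assume "v \<in> cycles ?F i"
      from cyc[OF this] have v: "v \<in> carrier_vec (Suc n)" and "diff ?F (Suc 0) *\<^sub>v v = 0\<^sub>v 1"
        using 1 by simp_all
      then have "(diff ?F (Suc 0) *\<^sub>v v) $ 0 = 0" by simp
      then have "(\<Sum>i\<le>n. hb_gen n l b i * v $ i) = 0"
        by (simp add: hb_complex_diff_1[OF v])
      then have eq: "(\<Sum>i<n. (b i * (\<Prod>j\<in>{..<n} - {i}. l j)) * v $ i) + (\<Prod>j<n. l j) * v $ n = 0"
        unfolding sum_hb_gen .
      have "l k dvd v $ k" if k: "k < n" for k
      proof -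
        have "l k dvd (\<Sum>i\<in>{..<n} - {k}. (b i * (\<Prod>j\<in>{..<n} - {i}. l j)) * v $ i)"
          using k by (intro dvd_sum dvd_mult dvd_mult2 dvd_prodI) auto
        moreover have "l k dvd (\<Prod>j<n. l j) * v $ n"
          using k by (intro dvd_mult2 dvd_prodI) auto
        moreover have "(b k * (\<Prod>j\<in>{..<n} - {k}. l j)) * v $ k
          = - ((\<Sum>i\<in>{..<n} - {k}. (b i * (\<Prod>j\<in>{..<n} - {i}. l j)) * v $ i) + (\<Prod>j<n. l j) * v $ n)"
          using eq k by (subst eq_neg_iff_add_eq_0) (simp add: sum.remove[of "{..<n}" k] add.assoc)
        ultimately have "l k dvd (b k * (\<Prod>j\<in>{..<n} - {k}. l j)) * v $ k"
          by simp
        moreover have "\<not> l k dvd (\<Prod>j\<in>{..<n} - {k}. l j)"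
          using prime_elem_dvd_prod[OF prime[OF k], of "{..<n} - {k}" l] l[OF k] by auto
        ultimately show ?thesis
          using prime_elem_dvd_multD[OF prime[OF k]] b[OF k] by blast
      qed
      then obtain u where u: "\<And>k. k < n \<Longrightarrow> v $ k = l k * u k"
        unfolding dvd_def by metis
      have "(\<Prod>j<n. l j) * ((\<Sum>i<n. b i * u i) + v $ n) = 0"
      proof -
        have "(\<Sum>i<n. (b i * (\<Prod>j\<in>{..<n} - {i}. l j)) * v $ i) = (\<Sum>i<n. (\<Prod>j<n. l j) * (b i * u i))"
          by (intro sum.cong) (simp_all add: u prod.remove[of "{..<n}"])
        with eq show ?thesis by (simp add: distrib_left sum_distrib_left)
      qed
      moreover have "(\<Prod>j<n. l j) \<noteq> 0" using nz by simp
      ultimately have "v $ n = - (\<Sum>i<n. b i * u i)"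
        by (simp add: eq_neg_iff_add_eq_0 add.commute)
      then have "v = diff ?F (Suc (Suc 0)) *\<^sub>v vec n u"
        using v u by (intro eq_vecI) (auto simp: hb_complex_diff_2)
      then show "v \<in> boundaries ?F i"
        unfolding boundaries_eq 1 by (rule image_eqI) simp
    qed
  next
    case 2
    show ?thesis
    proof
      fix v assume "v \<in> cycles ?F i"
      from cyc[OF this] have v: "v \<in> carrier_vec n" and "diff ?F (Suc (Suc 0)) *\<^sub>v v = 0\<^sub>v (Suc n)"
        using 2 by simp_all
      then have 0: "(diff ?F (Suc (Suc 0)) *\<^sub>v v) $ k = 0" if "k < n" for k
        using that by simp
      have "v $ k = 0" if "k < n" for k
        using 0[OF that] that nz[OF that] by (simp add: hb_complex_diff_2[OF v])
      then have "v = 0\<^sub>v n" using v by (intro eq_vecI) auto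
      then show "v \<in> boundaries ?F i"
        by (simp add: 2 boundaries_hb_complex_trivial)
    qed
  next
    case (3 k)
    show ?thesis
    proof
      fix v assume "v \<in> cycles ?F i"
      from cyc(1)[OF this] have "v = 0\<^sub>v 0"
        using 3 by (intro eq_vecI) auto
      then show "v \<in> boundaries ?F i"
        by (simp add: 3 boundaries_hb_complex_trivial)
    qed
  qed
  with sub show ?thesis by blast
qed

section \<open>Bidegrees and the graded minimal resolution\<close>

lemma S_piece_0: "0 \<in> S_piece d"
  by (simp add: S_piece_def)

lemma S_piece_add: "p \<in> S_piece d \<Longrightarrow> q \<in> S_piece d \<Longrightarrow> p + q \<in> S_piece d"
  using keys_add[of p q] by (auto simp: S_piece_def)

lemma S_piece_uminus: "p \<in> S_piece d \<Longrightarrow> - p \<in> S_piece d"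
  by (simp add: S_piece_def in_keys_iff)

lemma S_piece_diff: "p \<in> S_piece d \<Longrightarrow> q \<in> S_piece d \<Longrightarrow> p - q \<in> S_piece d"
  using S_piece_add[OF _ S_piece_uminus, of p d q] by simp

lemma S_piece_sum: "(\<And>i. i \<in> A \<Longrightarrow> f i \<in> S_piece d) \<Longrightarrow> sum f A \<in> S_piece d"
  by (induction A rule: infinite_finite_induct) (auto intro: S_piece_0 S_piece_add)

lemma S_piece_mult: "p \<in> S_piece d \<Longrightarrow> q \<in> S_piece e \<Longrightarrow> p * q \<in> S_piece (d + e)"
  using keys_mult[of p q] by (fastforce simp: S_piece_def bidegree_def lookup_add)

lemma S_piece_const: "const c \<in> S_piece 0"
  by (simp add: S_piece_def const_def bidegree_def zero_prod_def)

lemma S_piece_prod: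
  assumes "finite A" and "\<And>i. i \<in> A \<Longrightarrow> f i \<in> S_piece d"
  shows "prod f A \<in> S_piece (int (card A) * fst d, int (card A) * snd d)"
  using assms
proof (induction A)
  case empty
  then show ?case using S_piece_const[of 1] by (simp add: zero_prod_def)
next
  case (insert i A)
  then have "f i * prod f A \<in> S_piece (d + (int (card A) * fst d, int (card A) * snd d))"
    by (intro S_piece_mult) auto
  also have "d + (int (card A) * fst d, int (card A) * snd d)
    = (int (card (insert i A)) * fst d, int (card (insert i A)) * snd d)"
    using insert.hyps by (cases d) (simp add: algebra_simps)
  finally show ?case using insert.hyps by simp
qed

lemma S_piece_form: "x_form u \<in> S_piece (1, 0)" "y_form u \<in> S_piece (0, 1)"
proof -
  have "coord X0 \<in> S_piece (1, 0)" "coord X1 \<in> S_piece (1, 0)" "coord Y0 \<in> S_piece (0, 1)" "coord Y1 \<in> S_piece (0, 1)"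
    by (simp_all add: S_piece_def coord_def bidegree_def lookup_single)
  moreover have "const c * p \<in> S_piece d" if "p \<in> S_piece d" for c p d
    using S_piece_mult[OF S_piece_const that, of c] by simp
  ultimately show "x_form u \<in> S_piece (1, 0)" "y_form u \<in> S_piece (0, 1)"
    unfolding x_form_def y_form_def by (auto intro!: S_piece_diff)
qed

lemma hb_gen_in_S_piece:
  assumes l: "\<And>i. i < n \<Longrightarrow> l i \<in> S_piece (1, 0)" and b: "\<And>i. i < n \<Longrightarrow> b i \<in> S_piece (\<beta> i)"
    and "i \<le> n"
  shows "hb_gen n l b i \<in> S_piece (if i < n then \<beta> i + (int n - 1, 0) else (int n, 0))"
proof (cases "i < n")
  case True
  have "(\<Prod>j\<in>{..<n} - {i}. l j) \<in> S_piece (int (card ({..<n} - {i})) * 1, int (card ({..<n} - {i})) * 0)"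
    using S_piece_prod[of "{..<n} - {i}" l "(1, 0)"] l by auto
  moreover have "int (card ({..<n} - {i})) = int n - 1"
    using True by (simp add: of_nat_diff)
  ultimately show ?thesis
    using S_piece_mult[OF b[OF True]] True by (simp add: hb_gen_def)
next
  case False
  then show ?thesis
    using S_piece_prod[of "{..<n}" l "(1, 0)"] l by (simp add: hb_gen_def)
qed

lemma coset_ring_module: "J +>\<^bsub>ring_module R\<^esub> p = J +>\<^bsub>R\<^esub> p"
  by (simp add: a_r_coset_def' ring_module_def)

lemma hb_complex_minimal_free_resolution:
  fixes l b :: "nat \<Rightarrow> 'k::field bipoly"
  assumes n: "n > 0" and prime: "\<And>i. i < n \<Longrightarrow> prime_elem (l i)"
    and l: "\<And>i j. i < n \<Longrightarrow> j < n \<Longrightarrow> i \<noteq> j \<Longrightarrow> \<not> l i dvd l j"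
    and b: "\<And>i. i < n \<Longrightarrow> \<not> l i dvd b i"
    and degs: "\<And>i. i < n \<Longrightarrow> l i \<in> S_piece (1, 0)" "\<And>i. i < n \<Longrightarrow> b i \<in> S_piece (\<beta> i)"
    and max: "\<And>i. i < n \<Longrightarrow> l i \<in> max_ideal" "\<And>i. i < n \<Longrightarrow> b i \<in> max_ideal"
    and J: "ideal J S_ring" "J = {p. \<exists>c. p = (\<Sum>i\<le>n. hb_gen n l b i * c i)}"
  shows "minimal_free_resolution (hb_complex n l b) (S_mod_ideal J) (S_mod_ideal_piece J)"
proof -
  let ?F = "hb_complex n l b" and ?R = "ring_module (S_ring :: 'k bipoly ring)"
  \<comment> \<open>In degree 1 these are the degrees of the generators. A relation has the degree
    of \<open>l j\<close> times generator \<open>j\<close>, that is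
    \<open>(1, 0) + \<beta> j + (int n - 1, 0)\<close>. The higher modules are zero, so they may
    share this value.\<close>
  define s :: "nat \<Rightarrow> nat \<Rightarrow> int \<times> int" where "s = (\<lambda>i j. if i = 0 then (0, 0) else if i = 1 then
    (if j < n then \<beta> j + (int n - 1, 0) else (int n, 0)) else \<beta> j + (int n, 0))"
  define \<epsilon> where "\<epsilon> v = J +>\<^bsub>?R\<^esub> (v $ 0)" for v
  interpret Q: quotient_module "S_ring :: 'k bipoly ring" ?R J
    by (rule quotient_module_S_mod_ideal[OF J(1)])
  have hom: "\<epsilon> \<in> LinearCombinations.module_hom S_ring (free_mod ?F 0) (S_mod_ideal J)"
    unfolding \<epsilon>_def S_mod_ideal_def
    by (rule module_hom_comp[OF _ Q.quot_hom])
      (auto simp: LinearCombinations.module_hom_def free_mod_def module_vec_simps ring_module_def)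
  have surj: "\<epsilon> ` carrier (free_mod ?F 0) = carrier (S_mod_ideal J)"
    unfolding S_mod_ideal_simps[OF J(1)]
  proof (intro equalityI subsetI)
    fix x assume "x \<in> range (\<lambda>p. J +>\<^bsub>?R\<^esub> p)"
    then obtain p where "x = J +>\<^bsub>?R\<^esub> p" by blast
    then have "x = \<epsilon> (vec 1 (\<lambda>_. p))" by (simp add: \<epsilon>_def)
    then show "x \<in> \<epsilon> ` carrier (free_mod ?F 0)"
      by (rule image_eqI) (simp add: free_mod_def module_vec_simps)
  qed (auto simp: \<epsilon>_def)
  have ker: "{v \<in> carrier (free_mod ?F 0). \<epsilon> v = \<zero>\<^bsub>S_mod_ideal J\<^esub>} = boundaries ?F 0"
    unfolding boundaries_0_hb_complex \<epsilon>_def S_mod_ideal_simps[OF J(1)]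
    by (simp add: J(2) free_mod_def module_vec_simps)
  have gr0: "\<epsilon> ` free_piece (rk ?F 0) (s 0) d \<subseteq> S_mod_ideal_piece J d" for d
    by (auto simp: \<epsilon>_def free_piece_def s_def S_mod_ideal_piece_def coset_ring_module zero_prod_def[symmetric])
  have gr: "(\<lambda>v. diff ?F (Suc i) *\<^sub>v v) ` free_piece (rk ?F (Suc i)) (s (Suc i)) d
      \<subseteq> free_piece (rk ?F i) (s i) d" for i d
  proof
    fix w assume "w \<in> (\<lambda>v. diff ?F (Suc i) *\<^sub>v v) ` free_piece (rk ?F (Suc i)) (s (Suc i)) d"
    then obtain v where v: "v \<in> carrier_vec (rk ?F (Suc i))" "w = diff ?F (Suc i) *\<^sub>v v"
      "\<And>j. j < rk ?F (Suc i) \<Longrightarrow> v $ j \<in> S_piece (d - s (Suc i) j)"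
      by (auto simp: free_piece_def)
    have w: "w \<in> carrier_vec (rk ?F i)"
      unfolding v(2) using hb_complex_carrier v(1) by (rule mult_mat_vec_carrier)
    consider "i = 0" | "i = Suc 0" | k where "i = Suc (Suc k)"
      by (metis not0_implies_Suc)
    then show "w \<in> free_piece (rk ?F i) (s i) d"
    proof cases
      case 1
      have "hb_gen n l b j * v $ j \<in> S_piece d" if "j \<le> n" for j
        using S_piece_mult[OF hb_gen_in_S_piece[where l = l and b = b and \<beta> = \<beta>, OF degs that] v(3)[of j]] that 1
        by (simp add: s_def)
      then have "(\<Sum>j\<le>n. hb_gen n l b j * v $ j) \<in> S_piece d"
        by (intro S_piece_sum) simp
      then show ?thesis
        using w v(1) 1 by (simp add: free_piece_def v(2) hb_complex_diff_1 s_def zero_prod_def[symmetric])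
    next
      case 2
      have u: "v \<in> carrier_vec n" using v(1) 2 by simp
      have vj: "v $ j \<in> S_piece (d - (\<beta> j + (int n, 0)))" if "j < n" for j
        using v(3)[of j] that 2 by (simp add: s_def)
      have "b j * v $ j \<in> S_piece (d - (int n, 0))" if "j < n" for j
        using S_piece_mult[OF degs(2)[OF that] vj[OF that]] by (simp add: algebra_simps)
      then have last: "- (\<Sum>j<n. b j * v $ j) \<in> S_piece (d - (int n, 0))"
        by (intro S_piece_uminus S_piece_sum) simp
      have "l j * v $ j \<in> S_piece (d - (\<beta> j + (int n - 1, 0)))" if "j < n" for j
      proof -
        have "(1, 0) + (d - (\<beta> j + (int n, 0))) = d - (\<beta> j + (int n - 1, 0))"
          by (cases d; cases "\<beta> j") simp
        then show ?thesis
          using S_piece_mult[OF degs(1)[OF that] vj[OF that]] by (simp only:)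
      qed
      with last show ?thesis
        using w 2 by (auto simp: free_piece_def v(2) hb_complex_diff_2[OF u] s_def)
    next
      case (3 k)
      have "w \<in> boundaries ?F i" using v(1,2) by (auto simp: boundaries_eq)
      then have "w = 0\<^sub>v (rk ?F i)" by (simp add: 3 boundaries_hb_complex_trivial)
      then show ?thesis by (simp add: free_piece_def S_piece_0)
    qed
  qed
  have "ideal (max_ideal :: 'k bipoly set) S_ring" by (rule ideal_max_ideal)
  note M = ideal_class_ringD[OF this]
  have gen: "hb_gen n l b i \<in> max_ideal" if "i \<le> n" for i
  proof (cases "i < n")
    case True
    then show ?thesis
      using M(3)[OF max(2)[OF True], of "\<Prod>j\<in>{..<n} - {i}. l j"] by (simp add: hb_gen_def mult.commute)
  next
    \<comment> \<open>The last generator is the product of all \<open>l j\<close>; since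
      \<open>n > 0\<close> it has the factor \<open>l 0\<close>.\<close>
    case False
    then show ?thesis
      using M(3)[OF max(1)[OF n], of "\<Prod>j\<in>{..<n} - {0}. l j"] n
      by (simp add: hb_gen_def prod.remove[of "{..<n}" 0] mult.commute)
  qed
  have min: "boundaries ?F i \<subseteq> ideal_times_module S_ring max_ideal (free_mod ?F i)" for i
    unfolding free_mod_def ideal_times_module_vec[OF ideal_max_ideal]
  proof
    fix w assume w: "w \<in> boundaries ?F i"
    then obtain v where v: "v \<in> carrier_vec (rk ?F (Suc i))" "w = diff ?F (Suc i) *\<^sub>v v"
      by (auto simp: boundaries_eq)
    have wc: "w \<in> carrier_vec (rk ?F i)"
      unfolding v(2) using hb_complex_carrier v(1) by (rule mult_mat_vec_carrier)
    consider "i = 0" | "i = Suc 0" | k where "i = Suc (Suc k)"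
      by (metis not0_implies_Suc)
    then have "\<forall>j<rk ?F i. w $ j \<in> max_ideal"
    proof cases
      case 1
      have "(\<Sum>j\<le>n. v $ j * hb_gen n l b j) \<in> max_ideal"
        using gen by (intro M(3,6)) auto
      then show ?thesis
        using v(1) 1 by (simp add: v(2) hb_complex_diff_1 mult.commute)
    next
      case 2
      have u: "v \<in> carrier_vec n" using v(1) 2 by simp
      have "- (\<Sum>j<n. v $ j * b j) \<in> max_ideal"
        using max(2) by (intro M(3,4,6)) auto
      moreover have "v $ j * l j \<in> max_ideal" if "j < n" for j
        using max(1)[OF that] by (rule M(3))
      ultimately show ?thesis
        using 2 by (auto simp: v(2) hb_complex_diff_2[OF u] mult.commute)
    next
      case (3 k)
      then show ?thesis
        using w M(1) by (simp add: boundaries_hb_complex_trivial)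
    qed
    with wc show "w \<in> {v \<in> carrier_vec (rk ?F i). \<forall>j<rk ?F i. v $ j \<in> max_ideal}" by blast
  qed
  show ?thesis
    unfolding minimal_free_resolution_def
    by (intro conjI allI impI bexI[OF _ hom] exI[of _ s])
      (rule is_complex_hb_complex hb_complex_exact[OF prime l b] surj ker gr0 gr min | assumption)+
qed


section \<open>Sets of points\<close>

definition rep :: "('k \<times> 'k) set \<Rightarrow> 'k \<times> 'k" where
  "rep p = (SOME u. u \<in> p)"

lemma rep_P1:
  fixes p :: "('k::field \<times> 'k) set"
  assumes "p \<in> P1"
  shows "rep p \<noteq> (0, 0)" "p = proj_rel `` {rep p}"
proof -
  from assms obtain u where u: "u \<noteq> (0, 0)" "p = proj_rel `` {u}"
    unfolding P1_def by (auto elim!: quotientE)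
  have "u \<in> p"
    unfolding u(2) by (rule equiv_class_self[OF equiv_proj_rel]) (use u(1) in simp)
  then have "rep p \<in> p"
    unfolding rep_def by (rule someI)
  then have "rep p \<in> proj_rel `` {u}"
    by (rule subst[OF u(2)])
  then have rel: "(u, rep p) \<in> proj_rel" by simp
  then show "rep p \<noteq> (0, 0)" by (simp add: proj_rel_def)
  show "p = proj_rel `` {rep p}"
    by (rule trans[OF u(2) equiv_class_eq[OF equiv_proj_rel rel]])
qed

lemma proj_rel_iff:
  assumes "u \<noteq> (0, 0)" and "w \<noteq> (0, 0)"
  shows "(u, w) \<in> proj_rel \<longleftrightarrow> \<not> nonprop u w"
proof
  assume "\<not> nonprop u w"
  then have eq: "fst u * snd w = snd u * fst w" by (simp add: nonprop_def)
  have "\<exists>c. c \<noteq> 0 \<and> fst w = c * fst u \<and> snd w = c * snd u"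
  proof (cases "fst u = 0")
    case True
    with assms(1) have "snd u \<noteq> 0" by (simp add: prod_eq_iff)
    with True eq have "fst w = 0" by simp
    with assms(2) have "snd w \<noteq> 0" by (simp add: prod_eq_iff)
    with True \<open>snd u \<noteq> 0\<close> \<open>fst w = 0\<close> show ?thesis
      \<comment> \<open>The scalar is the quotient of two coordinates that are known to be
        nonzero.\<close>
      by (intro exI[of _ "snd w / snd u"]) simp
  next
    case False
    with eq have snd: "snd w = fst w / fst u * snd u" by (simp add: field_simps)
    with assms(2) have "fst w \<noteq> 0" by (auto simp: prod_eq_iff)
    with False snd show ?thesis
      by (intro exI[of _ "fst w / fst u"]) simp
  qed
  with assms show "(u, w) \<in> proj_rel" by (simp add: proj_rel_def)
qed (auto simp: proj_rel_def nonprop_def)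

lemma nonprop_rep:
  assumes "p \<in> P1" "q \<in> P1" "p \<noteq> q"
  shows "nonprop (rep p) (rep q)"
proof (rule ccontr)
  assume "\<not> nonprop (rep p) (rep q)"
  then have "(rep p, rep q) \<in> proj_rel"
    using proj_rel_iff[OF rep_P1(1)[OF assms(1)] rep_P1(1)[OF assms(2)]] by simp
  then have "proj_rel `` {rep p} = proj_rel `` {rep q}"
    by (rule equiv_class_eq[OF equiv_proj_rel])
  then have "p = q"
    unfolding rep_P1(2)[OF assms(1), symmetric] rep_P1(2)[OF assms(2), symmetric] .
  with assms(3) show False ..
qed

text \<open>The new points are \<open>(1, t)\<close> for values \<open>t\<close> different from the
  finitely many ratios of the given vectors; characteristic 0 leaves infinitely many
  choices.\<close>

lemma ex_nonprop_sequence: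
  fixes u :: "nat \<Rightarrow> 'k::field_char_0 \<times> 'k"
  assumes u0: "\<And>i. i < r \<Longrightarrow> u i \<noteq> (0, 0)"
    and u: "\<And>i j. i < r \<Longrightarrow> j < r \<Longrightarrow> i \<noteq> j \<Longrightarrow> nonprop (u i) (u j)"
  obtains w where "\<And>i. i < r \<Longrightarrow> w i = u i" and "\<And>i. w i \<noteq> (0, 0)"
    and "\<And>i j. i \<noteq> j \<Longrightarrow> nonprop (w i) (w j)"
proof -
  \<comment> \<open>A vector with first coordinate 0 contributes the ratio 0, which merely excludes
    one more value; it is not proportional to any \<open>(1, t)\<close> in any case.\<close>
  let ?bad = "(\<lambda>i. snd (u i) / fst (u i)) ` {..<r}"
  have "infinite (UNIV - ?bad)"
    by (intro Diff_infinite_finite) (simp_all add: infinite_UNIV_char_0)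
  then obtain f :: "nat \<Rightarrow> 'k" where f: "inj f" "range f \<subseteq> UNIV - ?bad"
    using infinite_countable_subset by blast
  define w where "w i = (if i < r then u i else (1, f i))" for i
  have new: "nonprop (u i) (1, f j)" if "i < r" for i j
    unfolding nonprop_def
  proof
    assume eq: "fst (u i) * snd (1, f j) = snd (u i) * fst (1, f j)"
    with u0[OF that] have "fst (u i) \<noteq> 0" by (cases "u i") auto
    with eq have "f j = snd (u i) / fst (u i)" by (simp add: field_simps)
    with f(2) that show False by blast
  qed
  have "nonprop (w i) (w j)" if "i \<noteq> j" for i j
    using that u[of i j] new[of i j] nonprop_sym[OF new[of j i]] injD[OF f(1), of i j]
    by (auto simp: w_def nonprop_def)
  moreover have "w i \<noteq> (0, 0)" for i
    using u0 by (simp add: w_def)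
  ultimately show thesis
    by (intro that[of w]) (auto simp: w_def)
qed

text \<open>Sorts \<open>X\<close> by first coordinates. The sequence \<open>u\<close> runs on
  beyond index \<open>a\<close>, so that distinctness holds without bounds on the indices. The added
  points come after the genuine ones, hence if there are any up to \<open>a\<close>, then
  \<open>a\<close> is one of them. This is the final alternative, which selects the version of the
  resolution.\<close>

lemma points_configuration:
  fixes X :: "(('k::field_char_0 \<times> 'k) set \<times> ('k \<times> 'k) set) set"
  assumes X: "X \<subseteq> P1 \<times> P1" and fin: "finite X" and ne: "X \<noteq> {}" and a: "card (fst ` X) \<le> Suc a"
  obtains u C where "\<And>i. u i \<noteq> (0, 0)" and "\<And>i j. i \<noteq> j \<Longrightarrow> nonprop (u i) (u j)"
    and "\<And>i. finite (C i)" and "\<And>i c. c \<in> C i \<Longrightarrow> c \<noteq> (0, 0)"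
    and "\<And>i c d. c \<in> C i \<Longrightarrow> d \<in> C i \<Longrightarrow> c \<noteq> d \<Longrightarrow> nonprop c d"
    and "points_ideal X = (\<Inter>i\<in>{..a}. \<Inter>c\<in>C i. Idl\<^bsub>S_ring\<^esub> {x_form (u i), y_form c})"
    and "(\<forall>i\<le>a. C i \<noteq> {}) \<or> (0 < a \<and> C a = {})"
proof -
  define r where "r = card (fst ` X)"
  have r: "0 < r" "r \<le> Suc a" using a fin ne by (auto simp: r_def card_gt_0_iff)
  obtain e where e: "bij_betw e {..<r} (fst ` X)"
    using ex_bij_betw_nat_finite[of "fst ` X"] fin by (auto simp: r_def atLeast0LessThan)
  have eP: "e i \<in> P1" if "i < r" for i
  proof -
    have "fst ` X \<subseteq> P1" using X by auto
    then show ?thesis using bij_betwE[OF e] that by auto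
  qed
  have e_inj: "e i \<noteq> e j" if "i < r" "j < r" "i \<noteq> j" for i j
    using bij_betw_imp_inj_on[OF e] that by (auto simp: inj_on_def)
  obtain u where u: "\<And>i. i < r \<Longrightarrow> u i = rep (e i)" "\<And>i. u i \<noteq> (0, 0)"
    "\<And>i j. i \<noteq> j \<Longrightarrow> nonprop (u i) (u j)"
  proof (rule ex_nonprop_sequence[of r "\<lambda>i. rep (e i)"])
    show "rep (e i) \<noteq> (0, 0)" if "i < r" for i
      by (rule rep_P1(1)[OF eP[OF that]])
    show "nonprop (rep (e i)) (rep (e j))" if "i < r" "j < r" "i \<noteq> j" for i j
      by (rule nonprop_rep[OF eP[OF that(1)] eP[OF that(2)] e_inj[OF that]])
  qed (rule that)
  define Y where "Y i = {q. (e i, q) \<in> X}" for i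
  define C where "C i = (if i < r then rep ` Y i else {})" for i
  have "Y i \<subseteq> snd ` X" for i by (force simp: Y_def)
  then have "finite (Y i)" for i using fin finite_subset by blast
  then have C1: "finite (C i)" for i by (simp add: C_def)
  have YP: "q \<in> P1" if "q \<in> Y i" for i q using that X by (auto simp: Y_def)
  have C2: "c \<noteq> (0, 0)" if "c \<in> C i" for i c
    using that rep_P1(1) YP by (auto simp: C_def split: if_splits)
  have C3: "nonprop c d" if "c \<in> C i" "d \<in> C i" "c \<noteq> d" for i c d
    using that nonprop_rep YP unfolding C_def by (auto split: if_splits)
  have pt: "point_ideal (p, q) = Idl\<^bsub>S_ring\<^esub> {x_form (rep p), y_form (rep q)}" if "(p, q) \<in> X" for p q
  proof -
    have p: "p \<in> P1" and q: "q \<in> P1" using that X by auto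
    show ?thesis
      using point_ideal_eq[OF rep_P1(1)[OF p] rep_P1(1)[OF q]]
      unfolding rep_P1(2)[OF p, symmetric] rep_P1(2)[OF q, symmetric] .
  qed
  have points: "points_ideal X = (\<Inter>i\<in>{..a}. \<Inter>c\<in>C i. Idl\<^bsub>S_ring\<^esub> {x_form (u i), y_form c})"
  proof (intro equalityI subsetI INT_I)
    fix s i c assume s: "s \<in> points_ideal X" and c: "c \<in> C i"
    then obtain q where q: "i < r" "c = rep q" "(e i, q) \<in> X"
      by (auto simp: C_def Y_def split: if_splits)
    then have "s \<in> point_ideal (e i, q)" using s by (auto simp: points_ideal_def)
    then show "s \<in> Idl\<^bsub>S_ring\<^esub> {x_form (u i), y_form c}"
      unfolding pt[OF q(3)] using q u(1) by simp
  next
    fix s assume s: "s \<in> (\<Inter>i\<in>{..a}. \<Inter>c\<in>C i. Idl\<^bsub>S_ring\<^esub> {x_form (u i), y_form c})"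
    have "s \<in> point_ideal (p, q)" if pq: "(p, q) \<in> X" for p q
    proof -
      have "p \<in> e ` {..<r}"
        unfolding bij_betw_imp_surj_on[OF e] using pq by force
      then obtain i where i: "i < r" "p = e i" by blast
      then have "rep q \<in> C i" using pq by (auto simp: C_def Y_def)
      moreover have "i \<in> {..a}" using i r by simp
      ultimately have "s \<in> Idl\<^bsub>S_ring\<^esub> {x_form (u i), y_form (rep q)}" using s by blast
      then show ?thesis unfolding pt[OF pq] using i u(1) by simp
    qed
    then show "s \<in> points_ideal X" by (auto simp: points_ideal_def)
  qed
  have nonempty: "(\<forall>i\<le>a. C i \<noteq> {}) \<or> (0 < a \<and> C a = {})"
  proof (cases "r = Suc a")
    case True
    have "Y i \<noteq> {}" if "i < r" for i
      using bij_betwE[OF e] that by (force simp: Y_def)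
    with True show ?thesis by (simp add: C_def)
  next
    \<comment> \<open>Now \<open>r <= a\<close>, and \<open>r\<close> is positive because
      \<open>X\<close> is nonempty; so \<open>0 < a\<close>, and the fibre with index
      \<open>a\<close> is empty.\<close>
    case False
    with r show ?thesis by (simp add: C_def)
  qed
  show thesis
    by (rule that[of u C]) (fact u C1 C2 C3 points nonempty)+
qed

section \<open>The explicit resolution for a set of points, and the theorem\<close>

lemma ideal_points_ideal: "ideal (points_ideal X) S_ring"
proof -
  have I: "ideal (point_ideal P) S_ring" for P :: "('a \<times> 'a) set \<times> ('a \<times> 'a) set"
    unfolding point_ideal_def by (rule genideal_class_ring)
  show ?thesis
    unfolding ideal_class_ring_iff points_ideal_def
    by (intro conjI ballI allI INT_I) (auto intro: ideal_class_ringD(1-3)[OF I])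
qed

lemma coord_in_max_ideal: "coord v \<in> max_ideal"
  unfolding max_ideal_def
  by (cases v) (rule subsetD[OF genideal_class_ring(2)], simp)+

lemma form_in_max_ideal: "x_form u \<in> max_ideal" "y_form u \<in> max_ideal"
  unfolding x_form_def y_form_def
  by (intro ideal_class_ringD(3,5)[OF ideal_max_ideal] coord_in_max_ideal)+

text \<open>Takes \<open>n = a + 1\<close> with coefficients \<open>?g i\<close> if all fibres are
  nonempty, so that each \<open>?g i\<close> is a nonunit, and \<open>n = a\<close> otherwise. The
  conclusion \<open>0 < n\<close> makes the module in degree 2 nonzero.\<close>

lemma points_resolution:
  fixes u :: "nat \<Rightarrow> 'k::field \<times> 'k" and C :: "nat \<Rightarrow> ('k \<times> 'k) set"
  assumes u0: "\<And>i. u i \<noteq> (0, 0)" and u: "\<And>i j. i \<noteq> j \<Longrightarrow> nonprop (u i) (u j)"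
    and fin: "\<And>i. finite (C i)" and c0: "\<And>i c. c \<in> C i \<Longrightarrow> c \<noteq> (0, 0)"
    and c: "\<And>i c d. c \<in> C i \<Longrightarrow> d \<in> C i \<Longrightarrow> c \<noteq> d \<Longrightarrow> nonprop c d"
    and C: "(\<forall>i\<le>a. C i \<noteq> {}) \<or> (0 < a \<and> C a = {})"
    and J: "ideal J S_ring"
    and J_eq: "J = (\<Inter>i\<in>{..a}. \<Inter>c\<in>C i. Idl\<^bsub>S_ring\<^esub> {x_form (u i), y_form c}) \<inter> ideal_pow S_ring x_ideal a"
  shows "\<exists>n l b. 0 < n \<and>
    minimal_free_resolution (hb_complex n l b) (S_mod_ideal J) (S_mod_ideal_piece J)"
proof -
  let ?l = "\<lambda>i. x_form (u i)" and ?g = "\<lambda>i. prod y_form (C i)"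
  have J_gens: "J = {(\<Sum>i\<le>a. v i * (?g i * (\<Prod>j\<in>{..a} - {i}. ?l j))) + w * (\<Prod>j\<le>a. ?l j) | v w. True}"
    unfolding J_eq by (rule fibres_inter_x_ideal_pow) (rule u0 u fin c0 c | assumption)+
  have l_prime: "prime_elem (?l i)" for i
    by (rule prime_elem_x_form[OF u0])
  have l_dvd: "\<not> ?l i dvd ?l j" if "i \<noteq> j" for i j
    using u[OF that] by (simp add: x_form_dvd_x_form[OF u0])
  have g_dvd: "\<not> ?l i dvd ?g j" for i j
    by (rule not_x_form_dvd_prod_y_form[OF u0 fin c0])
  have g_deg: "?g i \<in> S_piece (0, int (card (C i)))" for i
    using S_piece_prod[of "C i" y_form "(0, 1)", OF fin S_piece_form(2)] by simp
  note M = ideal_class_ringD(3)[OF ideal_max_ideal]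
  from C show ?thesis
  proof
    assume ne: "\<forall>i\<le>a. C i \<noteq> {}"
    have g_max: "?g i \<in> max_ideal" if i: "i < Suc a" for i
    proof -
      obtain d where d: "d \<in> C i" using ne i by (meson ex_in_conv less_Suc_eq_le)
      then have "?g i = prod y_form (C i - {d}) * y_form d"
        using fin by (simp add: prod.remove mult.commute)
      then show ?thesis using M[OF form_in_max_ideal(2)] by simp
    qed
    have "minimal_free_resolution (hb_complex (Suc a) ?l ?g) (S_mod_ideal J) (S_mod_ideal_piece J)"
    proof (rule hb_complex_minimal_free_resolution[where \<beta> = "\<lambda>i. (0, int (card (C i)))"])
      show "J = {p. \<exists>d. p = (\<Sum>i\<le>Suc a. hb_gen (Suc a) ?l ?g i * d i)}"
      proof (intro equalityI subsetI)
        fix p assume "p \<in> J"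
        then obtain v w where "p = (\<Sum>i\<le>a. v i * (?g i * (\<Prod>j\<in>{..a} - {i}. ?l j))) + w * (\<Prod>j\<le>a. ?l j)"
          unfolding J_gens by blast
        then have "p = (\<Sum>i\<le>Suc a. hb_gen (Suc a) ?l ?g i * (if i = Suc a then w else v i))"
          unfolding sum_hb_gen by (simp add: lessThan_Suc_atMost mult.commute)
        then show "p \<in> {p. \<exists>d. p = (\<Sum>i\<le>Suc a. hb_gen (Suc a) ?l ?g i * d i)}"
          by (intro CollectI exI[of _ "\<lambda>i. if i = Suc a then w else v i"])
      next
        fix p assume "p \<in> {p. \<exists>d. p = (\<Sum>i\<le>Suc a. hb_gen (Suc a) ?l ?g i * d i)}"
        then obtain d where "p = (\<Sum>i\<le>Suc a. hb_gen (Suc a) ?l ?g i * d i)" by blast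
        then have "p = (\<Sum>i\<le>a. d i * (?g i * (\<Prod>j\<in>{..a} - {i}. ?l j))) + d (Suc a) * (\<Prod>j\<le>a. ?l j)"
          unfolding sum_hb_gen by (simp add: lessThan_Suc_atMost mult.commute)
        then show "p \<in> J" unfolding J_gens by blast
      qed
    qed (use l_prime l_dvd g_dvd S_piece_form(1) g_deg form_in_max_ideal(1) g_max J in simp_all)
    then show ?thesis by blast
  next
    assume *: "0 < a \<and> C a = {}"
    \<comment> \<open>As \<open>?g a = 1\<close>, the product of the \<open>?l j\<close> with
      \<open>j < a\<close> is itself a generator and takes the place of the product of all forms. In
      the other generators the factor \<open>?l a\<close> joins the coefficient. Thus
      \<open>?b i\<close> lies in \<open>max_ideal\<close> also for other indices \<open>i\<close>
      with empty fibre.\<close>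
    let ?b = "\<lambda>i. ?l a * ?g i"
    have part: "{..a} = insert a {..<a}" by auto
    have e: "?g i * (\<Prod>j\<in>{..a} - {i}. ?l j) = ?b i * (\<Prod>j\<in>{..<a} - {i}. ?l j)" if "i < a" for i
    proof -
      have "{..a} - {i} = insert a ({..<a} - {i})" using that by auto
      then show ?thesis by (simp add: mult.assoc mult.left_commute)
    qed
    have ea: "?g a * (\<Prod>j\<in>{..a} - {a}. ?l j) = (\<Prod>j<a. ?l j)"
    proof -
      have "{..a} - {a} = {..<a}" by auto
      then show ?thesis using * by simp
    qed
    have H: "(\<Prod>j\<le>a. ?l j) = ?l a * (\<Prod>j<a. ?l j)"
      by (simp add: part)
    \<comment> \<open>The redundant generator is \<open>?l a\<close> times the new last one, so its
      coefficient \<open>w\<close> is absorbed into \<open>v a + w * ?l a\<close>. Conversely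
      \<open>w = 0\<close> recovers every combination.\<close>
    have sum: "(\<Sum>i\<le>a. v i * (?g i * (\<Prod>j\<in>{..a} - {i}. ?l j))) + w * (\<Prod>j\<le>a. ?l j)
      = (\<Sum>i<a. (?b i * (\<Prod>j\<in>{..<a} - {i}. ?l j)) * v i) + (\<Prod>j<a. ?l j) * (v a + w * ?l a)" for v w
    proof -
      have "(\<Sum>i\<le>a. v i * (?g i * (\<Prod>j\<in>{..a} - {i}. ?l j)))
        = (\<Sum>i<a. v i * (?g i * (\<Prod>j\<in>{..a} - {i}. ?l j))) + v a * (?g a * (\<Prod>j\<in>{..a} - {a}. ?l j))"
        unfolding lessThan_Suc_atMost[symmetric] by simp
      also have "(\<Sum>i<a. v i * (?g i * (\<Prod>j\<in>{..a} - {i}. ?l j)))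
        = (\<Sum>i<a. (?b i * (\<Prod>j\<in>{..<a} - {i}. ?l j)) * v i)"
        by (intro sum.cong refl) (simp only: e lessThan_iff mult.commute)
      finally show ?thesis
        unfolding H ea by (simp only: distrib_left mult_ac add.assoc)
    qed
    have "minimal_free_resolution (hb_complex a ?l ?b) (S_mod_ideal J) (S_mod_ideal_piece J)"
    proof (rule hb_complex_minimal_free_resolution[where \<beta> = "\<lambda>i. (1, int (card (C i)))"])
      show "J = {p. \<exists>d. p = (\<Sum>i\<le>a. hb_gen a ?l ?b i * d i)}"
      proof (intro equalityI subsetI)
        fix p assume "p \<in> J"
        then obtain v w where "p = (\<Sum>i\<le>a. v i * (?g i * (\<Prod>j\<in>{..a} - {i}. ?l j))) + w * (\<Prod>j\<le>a. ?l j)"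
          unfolding J_gens by blast
        then have "p = (\<Sum>i\<le>a. hb_gen a ?l ?b i * (if i = a then v a + w * ?l a else v i))"
          unfolding sum sum_hb_gen by simp
        then show "p \<in> {p. \<exists>d. p = (\<Sum>i\<le>a. hb_gen a ?l ?b i * d i)}"
          by (intro CollectI exI[of _ "\<lambda>i. if i = a then v a + w * ?l a else v i"])
      next
        fix p assume "p \<in> {p. \<exists>d. p = (\<Sum>i\<le>a. hb_gen a ?l ?b i * d i)}"
        then obtain d where d: "p = (\<Sum>i\<le>a. hb_gen a ?l ?b i * d i)" by blast
        have "p = (\<Sum>i\<le>a. d i * (?g i * (\<Prod>j\<in>{..a} - {i}. ?l j))) + 0 * (\<Prod>j\<le>a. ?l j)"
          unfolding d sum sum_hb_gen by simp
        then show "p \<in> J" unfolding J_gens by blast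
      qed
      show "\<not> ?l i dvd ?b i" if "i < a" for i
        using prime_elem_dvd_multD[OF l_prime] l_dvd[of i a] g_dvd[of i i] that by blast
      show "?b i \<in> S_piece (1, int (card (C i)))" for i
        using S_piece_mult[OF S_piece_form(1) g_deg, of "u a" i] by simp
      show "?b i \<in> max_ideal" for i
        using M[OF form_in_max_ideal(1)[of "u a"], of "?g i"] by (simp add: mult.commute)
    qed (use l_prime l_dvd S_piece_form(1) form_in_max_ideal(1) J * in simp_all)
    with * show ?thesis by blast
  qed
qed

theorem theorem1p2:
  fixes X :: "(('k::field_char_0 \<times> 'k) set \<times> ('k \<times> 'k) set) set" and a :: int
  assumes "X \<subseteq> P1 \<times> P1" and "finite X" and "X \<noteq> {}"
    and "a \<ge> int (card (fst ` X)) - 1"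
  defines "J \<equiv> points_ideal X \<inter> ideal_pow S_ring x_ideal (nat a)"
  shows "(\<exists>F. minimal_free_resolution F (S_mod_ideal J) (S_mod_ideal_piece J)) \<and>
    (\<forall>F. minimal_free_resolution F (S_mod_ideal J) (S_mod_ideal_piece J) \<longrightarrow>
      virtual_resolution F (S_mod_ideal (points_ideal X)) \<and> has_length F 2)"
proof -
  have N: "ideal (ideal_pow S_ring x_ideal (nat a)) (S_ring :: 'k bipoly ring)"
    by (rule ideal_ideal_pow[OF ideal_x_ideal])
  have I: "ideal (points_ideal X) S_ring" by (rule ideal_points_ideal)
  have J: "ideal J S_ring"
    unfolding J_def by (rule ring.i_intersect[OF class_ring.ring_axioms I N])
  \<comment> \<open>For nonempty finite \<open>X\<close> the bound implies \<open>a >= 0\<close>, so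
    \<open>nat a\<close> is the exponent \<open>a\<close> itself.\<close>
  have "card (fst ` X) \<le> Suc (nat a)" using assms(4) by linarith
  then obtain u C where uC:
    "\<And>i. u i \<noteq> (0, 0)" "\<And>i j. i \<noteq> j \<Longrightarrow> nonprop (u i) (u j)"
    "\<And>i. finite (C i)" "\<And>i c. c \<in> C i \<Longrightarrow> c \<noteq> (0, 0)"
    "\<And>i c d. c \<in> C i \<Longrightarrow> d \<in> C i \<Longrightarrow> c \<noteq> d \<Longrightarrow> nonprop c d"
    and points: "points_ideal X = (\<Inter>i\<in>{..nat a}. \<Inter>c\<in>C i. Idl\<^bsub>S_ring\<^esub> {x_form (u i), y_form c})"
    and C: "(\<forall>i\<le>nat a. C i \<noteq> {}) \<or> (0 < nat a \<and> C (nat a) = {})"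
    by (rule points_configuration[OF assms(1-3)]) (rule that)
  have J_eq: "J = (\<Inter>i\<in>{..nat a}. \<Inter>c\<in>C i. Idl\<^bsub>S_ring\<^esub> {x_form (u i), y_form c})
      \<inter> ideal_pow S_ring x_ideal (nat a)"
    unfolding J_def points ..
  have "\<exists>n l b. 0 < n \<and>
      minimal_free_resolution (hb_complex n l b) (S_mod_ideal J) (S_mod_ideal_piece J)"
    by (rule points_resolution[of u C "nat a" J]) (fact uC C J J_eq)+
  then obtain n l b where n: "0 < n"
    and G: "minimal_free_resolution (hb_complex n l b) (S_mod_ideal J) (S_mod_ideal_piece J)"
    by blast
  have M: "Module.module S_ring (S_mod_ideal J)"
    unfolding S_mod_ideal_def by (rule quotient_module.module_quot[OF quotient_module_S_mod_ideal[OF J]])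
  have "virtual_resolution F (S_mod_ideal (points_ideal X)) \<and> has_length F 2"
    if F: "minimal_free_resolution F (S_mod_ideal J) (S_mod_ideal_piece J)" for F
  proof
    have "ideal_pow S_ring irrelevant_ideal (nat a) \<subseteq> (ideal_pow S_ring x_ideal (nat a) :: 'k bipoly set)"
      by (rule ideal_pow_mono) (simp add: irrelevant_ideal_def)
    then show "virtual_resolution F (S_mod_ideal (points_ideal X))"
      by (rule minimal_free_resolution_virtual[OF F I N J_def[THEN meta_eq_to_obj_eq]])
    have "rk F i = 0" if "i > 2" for i
    proof -
      have i: "i = Suc (Suc (Suc (i - 3)))" using that by simp
      show ?thesis
        by (subst i, rule minimal_free_resolution_rk_eq_0[OF M F G]) simp
    qed
    \<comment> \<open>The comparison with the roles exchanged: if \<open>rk F 2\<close> were 0, so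
      would be the rank \<open>n\<close> in the explicit resolution.\<close>
    moreover have "rk F 2 \<noteq> 0"
      using minimal_free_resolution_rk_eq_0[OF M G F, of 1] n by (auto simp: numeral_2_eq_2)
    ultimately show "has_length F 2"
      by (simp add: has_length_iff)
  qed
  with G show ?thesis by blast
qed

end
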